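(* Let $n\ge1$ and $m_1,m_2,m_3\in\mathbb{R}$. Let $T$ be an operator of the form $$Tu(x)=(2\pi)^{-n}\int_{\mathbb{R}^n}\int_{\mathbb{R}^n}e^{i(x-y)\cdot\xi}a(x,y,\xi)u(y)\,dy\,d\xi,$$ with amplitude $a=a(x,y,\xi)\in C^\infty(\mathbb{R}^n\times\mathbb{R}^n\times\mathbb{R}^n)$ satisfying $$|\partial_x^\alpha\partial_y^\beta\partial_\xi^\gamma a(x,y,\xi)|\le C_{\alpha\beta\gamma}\langle x\rangle^{m_1}\langle y\rangle^{m_2-|\beta|}\langle\xi\rangle^{m_3}$$ for all $\alpha,\beta,\gamma$ and all $x,y,\xi\in\mathbb{R}^n$. Then $T$ can be written in the form of a pseudo-differential operator $$Tu(x)=(2\pi)^{-n}\int_{\mathbb{R}^n}e^{ix\cdot\xi}c(x,\xi)\widehat{u}(\xi)\,d\xi,$$ with amplitude $c(x,\xi)$ satisfying $$|\partial_x^\alpha\partial_\xi^\beta c(x,\xi)|\le C_{\alpha\beta}\langle x\rangle^{m_1+m_2}\langle\xi\rangle^{m_3}$$ for all $\alpha,\beta$ and all $x,\xi\in\mathbb{R}^n$. Moreover, we have the asymptotic expansion (improving in $x$) $$c(x,\xi)\sim\sum_\beta\frac{i^{-|\beta|}}{\beta!}\,\partial_\xi^\beta\partial_y^\beta a(x,y,\xi)\big|_{y=x}.$$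
   Context: $\langle x\rangle=(1+|x|^2)^{1/2}$; $\widehat{u}(\xi)=\int e^{-iy\cdot\xi}u(y)\,dy$. Operators given by double integrals are understood as oscillatory integrals acting on $u\in\mathcal{S}(\mathbb{R}^n)$: the limit as $\epsilon\to0$ of the operators with amplitude $a(x,y,\xi)$ multiplied by $\gamma(\epsilon y,\epsilon\xi)$, where $\gamma\in C_0^\infty(\mathbb{R}^n\times\mathbb{R}^n)$ equals $1$ near the origin. Asymptotic expansion improving in $x$: for every $\alpha,\beta$ and every $M$ there exist $N$ and $C$ such that the difference between $c$ and the partial sum of the series (over multi-indices of length less than $N$), differentiated by $\partial_x^\alpha\partial_\xi^\beta$, is bounded by $C\langle x\rangle^{m_1+m_2-M}\langle\xi\rangle^{m_3}$ for all $x,\xi$. *)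

theory Defs
  imports "HOL-Analysis.Analysis"
begin

section \<open>Partial derivatives and smooth functions\<close>

definition partial_deriv ::
    "'a::real_normed_vector \<Rightarrow> ('a \<Rightarrow> 'b::real_normed_vector) \<Rightarrow> 'a \<Rightarrow> 'b" where
  "partial_deriv b f x = vector_derivative (\<lambda>t. f (x + t *\<^sub>R b)) (at 0)"

definition iter_partial ::
    "'a::real_normed_vector list \<Rightarrow> ('a \<Rightarrow> 'b::real_normed_vector) \<Rightarrow> 'a \<Rightarrow> 'b" where
  "iter_partial bs f = foldr partial_deriv bs f"

text \<open>
  \<open>f\<close> is of class \<open>C\<^sup>\<infinity>\<close> on the whole space: the partial derivatives of all orders (along the
  coordinate directions, in any order) exist and are continuous. The underlying space is an
  arbitrary Euclidean space, so that joint smoothness in several vector variables is smoothness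
  on the product space.
\<close>
definition smooth :: "('a::euclidean_space \<Rightarrow> 'b::real_normed_vector) \<Rightarrow> bool" where
  "smooth f \<longleftrightarrow> (\<forall>bs. set bs \<subseteq> Basis \<longrightarrow>
      continuous_on UNIV (iter_partial bs f) \<and>
      (\<forall>b\<in>Basis. \<forall>x. (\<lambda>t::real. iter_partial bs f (x + t *\<^sub>R b)) differentiable at 0))"

section \<open>Multi-indices\<close>

text \<open>
  A multi-index is a function \<open>'n \<Rightarrow> nat\<close>. The index type carries no order, so
  \<open>mderiv \<alpha> f = \<partial>\<^sup>\<alpha> f\<close> applies the partial derivatives in the order of a fixed but
  arbitrary enumeration of the coordinates; for smooth \<open>f\<close> the order is irrelevant.
\<close>
definition coords :: "'n::finite list" where
  "coords = (SOME l. distinct l \<and> set l = UNIV)"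

definition mderiv ::
    "('n::finite \<Rightarrow> nat) \<Rightarrow> (real^'n \<Rightarrow> 'b::real_normed_vector) \<Rightarrow> real^'n \<Rightarrow> 'b" where
  "mderiv \<alpha> f = foldr (\<lambda>i. partial_deriv (axis i 1) ^^ \<alpha> i) coords f"

definition mlen :: "('n::finite \<Rightarrow> nat) \<Rightarrow> nat" where
  "mlen \<alpha> = (\<Sum>i\<in>UNIV. \<alpha> i)"

definition mfact :: "('n::finite \<Rightarrow> nat) \<Rightarrow> nat" where
  "mfact \<alpha> = (\<Prod>i\<in>UNIV. fact (\<alpha> i))"

definition mpow :: "real^'n::finite \<Rightarrow> ('n \<Rightarrow> nat) \<Rightarrow> real" where
  "mpow x \<alpha> = (\<Prod>i\<in>UNIV. (x $ i) ^ \<alpha> i)"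

section \<open>Schwartz functions, Fourier transform, pseudo-differential operators\<close>

definition jbracket :: "'a::real_normed_vector \<Rightarrow> real" where
  "jbracket x = sqrt (1 + (norm x)\<^sup>2)"

definition schwartz :: "(real^'n::finite \<Rightarrow> complex) set" where
  "schwartz = {u. smooth u \<and>
      (\<forall>\<alpha> \<beta>. \<exists>C. \<forall>x. norm (complex_of_real (mpow x \<alpha>) * mderiv \<beta> u x) \<le> C)}"

definition fourier :: "(real^'n::finite \<Rightarrow> complex) \<Rightarrow> real^'n \<Rightarrow> complex" where
  "fourier u \<xi> = (LINT y|lborel. exp (- \<i> * complex_of_real (y \<bullet> \<xi>)) * u y)"

definition pseudo_diff_op ::
    "(real^'n::finite \<Rightarrow> real^'n \<Rightarrow> complex) \<Rightarrow> (real^'n \<Rightarrow> complex) \<Rightarrow> real^'n \<Rightarrow> complex" where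
  "pseudo_diff_op c u x =
     complex_of_real (1 / (2 * pi) ^ CARD('n)) *
     (LINT \<xi>|lborel. exp (\<i> * complex_of_real (x \<bullet> \<xi>)) * c x \<xi> * fourier u \<xi>)"

section \<open>Oscillatory integrals\<close>

definition cutoff :: "((real^'n::finite) \<times> (real^'n) \<Rightarrow> complex) \<Rightarrow> bool" where
  "cutoff \<gamma> \<longleftrightarrow> smooth \<gamma> \<and> compact (closure {p. \<gamma> p \<noteq> 0}) \<and> (\<forall>\<^sub>F p in nhds 0. \<gamma> p = 1)"

definition amplitude_integral ::
    "(real^'n::finite \<Rightarrow> real^'n \<Rightarrow> real^'n \<Rightarrow> complex) \<Rightarrow>
     (real^'n \<Rightarrow> complex) \<Rightarrow> real^'n \<Rightarrow> complex" where
  "amplitude_integral a u x =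
     complex_of_real (1 / (2 * pi) ^ CARD('n)) *
     (LINT \<xi>|lborel. LINT y|lborel.
        exp (\<i> * complex_of_real ((x - y) \<bullet> \<xi>)) * a x y \<xi> * u y)"

definition has_osc_value ::
    "(real^'n::finite \<Rightarrow> real^'n \<Rightarrow> real^'n \<Rightarrow> complex) \<Rightarrow>
     (real^'n \<Rightarrow> complex) \<Rightarrow> real^'n \<Rightarrow> complex \<Rightarrow> bool" where
  "has_osc_value a u x L \<longleftrightarrow> (\<forall>\<gamma>. cutoff \<gamma> \<longrightarrow>
     ((\<lambda>\<epsilon>. amplitude_integral (\<lambda>x y \<xi>. a x y \<xi> * \<gamma> (\<epsilon> *\<^sub>R y, \<epsilon> *\<^sub>R \<xi>)) u x) \<longlongrightarrow> L)
       (at_right 0))"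

text \<open>
  The operator with amplitude \<open>a\<close> as an oscillatory integral. The value is meaningful only where
  the limit exists and does not depend on the cutoff, i.e. where
  \<open>has_osc_value a u x (osc_op a u x)\<close> holds.
\<close>
definition osc_op ::
    "(real^'n::finite \<Rightarrow> real^'n \<Rightarrow> real^'n \<Rightarrow> complex) \<Rightarrow>
     (real^'n \<Rightarrow> complex) \<Rightarrow> real^'n \<Rightarrow> complex" where
  "osc_op a u x = (THE L. has_osc_value a u x L)"

section \<open>Asymptotic expansion\<close>

text \<open>
  The partial sum, over multi-indices \<open>\<beta>\<close> with \<open>|\<beta>| < N\<close>, of
  \<open>i\<^sup>-\<^sup>|\<^sup>\<beta>\<^sup>| / \<beta>! \<partial>\<^sub>\<xi>\<^sup>\<beta> \<partial>\<^sub>y\<^sup>\<beta> a(x,y,\<xi>)\<close> at \<open>y = x\<close>.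
\<close>
definition expansion_sum ::
    "(real^'n::finite \<Rightarrow> real^'n \<Rightarrow> real^'n \<Rightarrow> complex) \<Rightarrow> nat \<Rightarrow>
     real^'n \<Rightarrow> real^'n \<Rightarrow> complex" where
  "expansion_sum a N x \<xi> =
     (\<Sum>\<beta>\<in>{\<beta>. mlen \<beta> < N}.
        \<i> powi (- int (mlen \<beta>)) / of_nat (mfact \<beta>) *
        mderiv \<beta> (\<lambda>\<eta>. mderiv \<beta> (\<lambda>y. a x y \<eta>) x) \<xi>)"

end

theory Submission
  imports Defs "HOL-Probability.Characteristic_Functions" "HOL-Probability.Sinc_Integral"
begin

text \<open>
  Write \<open>I[b] = (2\<pi>)\<^sup>-\<^sup>n \<integral>\<integral> e\<^sup>-\<^sup>i\<^sup>y\<^sup>\<eta> b(y,\<eta>) dy d\<eta>\<close> for the oscillatory integral. The symbol is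
  \<open>c(x,\<xi>) = I[a(x, x+y, \<xi>+\<eta>)]\<close>, which one sees by inserting the Fourier inversion formula for \<open>u\<close> into
  the cut-off integral and letting \<open>\<epsilon> \<rightarrow> 0\<close>. Integrations by parts in \<open>y\<close> and in \<open>\<eta>\<close>, together with
  Peetre's inequality, make \<open>I\<close> absolutely convergent with bounds uniform in \<open>(x,\<xi>)\<close>; since the class of
  amplitudes is stable under \<open>\<partial>\<^sub>x + \<partial>\<^sub>y\<close> and \<open>\<partial>\<^sub>\<xi>\<close>, which correspond to \<open>\<partial>\<^sub>x\<close> and \<open>\<partial>\<^sub>\<xi>\<close> acting on \<open>c\<close>, no
  separate estimate of the derivatives is needed.

  For the expansion, interpolate by \<open>c\<^sub>t(x,\<xi>) = I[a(x, x+ty, \<xi>+\<eta>)]\<close>. Here \<open>c\<^sub>0(x,\<xi>) = a(x,x,\<xi>)\<close> and,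
  because \<open>I[y\<^sub>j b] = I[-i \<partial>\<^sub>\<eta>\<^sub>j b]\<close>, the \<open>t\<close>-derivative of \<open>c\<^sub>t\<close> is the same expression for the amplitude
  \<open>Da\<close>, \<open>D = -i \<Sum>\<^sub>j \<partial>\<^sub>\<xi>\<^sub>j \<partial>\<^sub>y\<^sub>j\<close>, which gains one power of \<open>\<langle>y\<rangle>\<close>. Taylor's formula in \<open>t\<close> at order \<open>N\<close> has
  a remainder of order \<open>\<langle>x\<rangle>\<^sup>-\<^sup>N\<close>, and \<open>D\<^sup>j/j!\<close> is the sum of the terms with \<open>|\<beta>| = j\<close>.
\<close>

section \<open>Smooth functions\<close>

text \<open>The amplitude gains decay only from derivatives in y; derivatives in \<xi> gain nothing.
  Absolute convergence is therefore bought with powers of 1 - \<Delta>: k of them in y against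
  growth in \<eta>, and arbitrarily many in \<eta> against growth in y. The number k depends only on
  m3 and the dimension, because \<open>dshift\<close> and \<open>mixed\<close> change at most the
  order in y; one k serves the symbol, all its derivatives and all remainders. Removing the cutoff,
  continuity in (x,\<xi>) and differentiation in a parameter all reduce to one limit theorem,
  \<open>osc_I_tendsto\<close>: a family bounded in one weight class that converges pointwise with
  all derivatives has convergent oscillatory integrals. Integration by parts in \<eta> is checked on
  cut-off amplitudes, where Fubini and the Fourier transform apply, and extended by the same
  theorem. The bounds are kept for |t| \<le> 2 although t runs over [0,1], so that two-sided
  derivatives in t exist up to the end points.\<close>

lemma iter_partial_Nil [simp]: "iter_partial [] f = f"
  by (simp add: iter_partial_def)

lemma iter_partial_Cons [simp]: "iter_partial (b # bs) f = partial_deriv b (iter_partial bs f)"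
  by (simp add: iter_partial_def)

lemma iter_partial_append [simp]: "iter_partial (bs @ cs) f = iter_partial bs (iter_partial cs f)"
  by (simp add: iter_partial_def)

lemma partial_derivI:
  "((\<lambda>t. f (x + t *\<^sub>R b)) has_vector_derivative D) (at 0) \<Longrightarrow> partial_deriv b f x = D"
  unfolding partial_deriv_def by (rule vector_derivative_at)

text \<open>\<open>smooth\<close> speaks of every iterated derivative. Exhibiting a class of
  continuous, directionally differentiable functions that is stable under coordinate derivatives
  avoids computing any of them; the proofs below only have to choose the class.\<close>

lemma smooth_coinduct:
  fixes f :: "'a::euclidean_space \<Rightarrow> 'b::real_normed_vector"
  assumes "f \<in> X"
    and cont: "\<And>f. f \<in> X \<Longrightarrow> continuous_on UNIV f"
    and diff: "\<And>f b x. f \<in> X \<Longrightarrow> b \<in> Basis \<Longrightarrow> (\<lambda>t::real. f (x + t *\<^sub>R b)) differentiable at 0"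
    and closed: "\<And>f b. f \<in> X \<Longrightarrow> b \<in> Basis \<Longrightarrow> partial_deriv b f \<in> X"
  shows "smooth f"
proof -
  have "iter_partial bs f \<in> X" if "set bs \<subseteq> Basis" for bs
    using that by (induction bs) (auto intro: closed assms(1))
  then show ?thesis unfolding smooth_def using cont diff by blast
qed

lemma smooth_continuous: "smooth f \<Longrightarrow> continuous_on UNIV f"
  unfolding smooth_def by (metis empty_subsetI iter_partial_Nil list.set(1))

lemma smooth_isCont: "smooth f \<Longrightarrow> isCont f x"
  using smooth_continuous continuous_on_eq_continuous_at by blast

lemma smooth_differentiable:
  "smooth f \<Longrightarrow> b \<in> Basis \<Longrightarrow> (\<lambda>t::real. f (x + t *\<^sub>R b)) differentiable at 0"
  unfolding smooth_def by (metis empty_subsetI iter_partial_Nil list.set(1))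

lemma smooth_partial_deriv: "smooth f \<Longrightarrow> b \<in> Basis \<Longrightarrow> smooth (partial_deriv b f)"
  unfolding smooth_def
proof (intro allI impI)
  fix bs :: "'a list"
  assume s: "\<forall>bs. set bs \<subseteq> Basis \<longrightarrow> continuous_on UNIV (iter_partial bs f) \<and>
      (\<forall>b\<in>Basis. \<forall>x. (\<lambda>t::real. iter_partial bs f (x + t *\<^sub>R b)) differentiable at 0)"
    and b: "b \<in> Basis" and bs: "set bs \<subseteq> Basis"
  show "continuous_on UNIV (iter_partial bs (partial_deriv b f)) \<and>
      (\<forall>c\<in>Basis. \<forall>x. (\<lambda>t::real. iter_partial bs (partial_deriv b f) (x + t *\<^sub>R c)) differentiable at 0)"
    using s[rule_format, of "bs @ [b]"] b bs by simp
qed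

lemma smooth_iter_partial: "smooth f \<Longrightarrow> set bs \<subseteq> Basis \<Longrightarrow> smooth (iter_partial bs f)"
  by (induction bs) (auto intro: smooth_partial_deriv)

lemma has_vector_derivative_shift_0:
  fixes f :: "'a::real_normed_vector \<Rightarrow> 'b::real_normed_vector"
  shows "((\<lambda>t. f (x + t *\<^sub>R b)) has_vector_derivative D) (at s) \<longleftrightarrow>
    ((\<lambda>t. f ((x + s *\<^sub>R b) + t *\<^sub>R b)) has_vector_derivative D) (at 0)"
proof
  assume "((\<lambda>t. f (x + t *\<^sub>R b)) has_vector_derivative D) (at s)"
  then have "((\<lambda>t. f (x + t *\<^sub>R b)) has_vector_derivative D) (at (0 + s))" by simp
  then have "((\<lambda>t. f (x + t *\<^sub>R b)) \<circ> (\<lambda>t. t + s) has_vector_derivative 1 *\<^sub>R D) (at 0)"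
    by (intro vector_diff_chain_at) (auto intro!: derivative_eq_intros)
  then show "((\<lambda>t. f ((x + s *\<^sub>R b) + t *\<^sub>R b)) has_vector_derivative D) (at 0)"
    by (simp add: o_def algebra_simps)
next
  assume "((\<lambda>t. f ((x + s *\<^sub>R b) + t *\<^sub>R b)) has_vector_derivative D) (at 0)"
  then have "((\<lambda>t. f ((x + s *\<^sub>R b) + t *\<^sub>R b)) has_vector_derivative D) (at (s - s))" by simp
  then have "((\<lambda>t. f ((x + s *\<^sub>R b) + t *\<^sub>R b)) \<circ> (\<lambda>t. t - s) has_vector_derivative 1 *\<^sub>R D) (at s)"
    by (intro vector_diff_chain_at) (auto intro!: derivative_eq_intros)
  then show "((\<lambda>t. f (x + t *\<^sub>R b)) has_vector_derivative D) (at s)"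
    by (simp add: o_def algebra_simps)
qed

lemma smooth_has_vector_derivative:
  assumes "smooth f" "b \<in> Basis"
  shows "((\<lambda>t. f (x + t *\<^sub>R b)) has_vector_derivative partial_deriv b f (x + s *\<^sub>R b)) (at s)"
  by (subst has_vector_derivative_shift_0)
    (use smooth_differentiable[OF assms] in \<open>simp add: partial_deriv_def vector_derivative_works\<close>)

text \<open>Continuous partial derivatives imply total differentiability: telescope along the basis.\<close>
lemma smooth_has_derivative:
  fixes f :: "'a::euclidean_space \<Rightarrow> 'b::real_normed_vector"
  assumes sm: "smooth f"
  shows "(f has_derivative (\<lambda>h. \<Sum>b\<in>Basis. (h \<bullet> b) *\<^sub>R partial_deriv b f x)) (at x)"
proof -
  \<comment> \<open>Induction over the directions already moved in: the increment along
    \<open>insert b S\<close> is the increment along S plus one step in direction b from the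
    displaced point x + \<sigma> h.\<close>
  have main: "((\<lambda>h. f (x + (\<Sum>b\<in>S. (h \<bullet> b) *\<^sub>R b))) has_derivative
      (\<lambda>h. \<Sum>b\<in>S. (h \<bullet> b) *\<^sub>R partial_deriv b f x)) (at 0)" if "finite S" "S \<subseteq> Basis" for S
    using that
  proof (induction S)
    case empty
    then show ?case by simp
  next
    case (insert b S)
    define \<sigma> where "\<sigma> h = (\<Sum>b\<in>S. (h \<bullet> b) *\<^sub>R b)" for h :: 'a
    have b: "b \<in> Basis" using insert by auto
    have IH: "((\<lambda>h. f (x + \<sigma> h)) has_derivative (\<lambda>h. \<Sum>b\<in>S. (h \<bullet> b) *\<^sub>R partial_deriv b f x)) (at 0)"
      unfolding \<sigma>_def using insert by auto
    have \<sigma>b: "norm (\<sigma> h) \<le> card S * norm h" for h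
    proof -
      have "norm (\<sigma> h) \<le> (\<Sum>b\<in>S. norm ((h \<bullet> b) *\<^sub>R b))" unfolding \<sigma>_def by (rule norm_sum)
      also have "\<dots> \<le> (\<Sum>b\<in>S. norm h)"
        using insert by (intro sum_mono) (auto simp: Basis_le_norm)
      finally show ?thesis by simp
    qed
    have 1: "((\<lambda>h. f (x + \<sigma> h + (h \<bullet> b) *\<^sub>R b) - f (x + \<sigma> h)) has_derivative
        (\<lambda>h. (h \<bullet> b) *\<^sub>R partial_deriv b f x)) (at 0)"
      unfolding has_derivative_at_alt
    proof (intro conjI allI impI)
      show "bounded_linear (\<lambda>h. (h \<bullet> b) *\<^sub>R partial_deriv b f x)"
        by (intro bounded_linear_intros)
      fix e :: real assume e: "e > 0"
      have "isCont (partial_deriv b f) x"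
        by (intro smooth_isCont smooth_partial_deriv sm b)
      then obtain \<delta> where \<delta>: "\<delta> > 0" "\<And>y. dist y x < \<delta> \<Longrightarrow> dist (partial_deriv b f y) (partial_deriv b f x) < e"
        unfolding continuous_at_eps_delta using e by metis
      \<comment> \<open>The points x + \<sigma> h + t b with |t| \<le> |h| lie within (card S +
        1)|h| of x.\<close>
      define \<delta>' where "\<delta>' = \<delta> / (card S + 1)"
      show "\<exists>d>0. \<forall>h. norm (h - 0) < d \<longrightarrow> norm (f (x + \<sigma> h + (h \<bullet> b) *\<^sub>R b) - f (x + \<sigma> h) -
            (f (x + \<sigma> 0 + (0 \<bullet> b) *\<^sub>R b) - f (x + \<sigma> 0)) - ((h - 0) \<bullet> b) *\<^sub>R partial_deriv b f x) \<le> e * norm (h - 0)"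
      proof (intro exI[of _ \<delta>'] conjI allI impI)
        show "\<delta>' > 0" using \<delta> by (auto simp: \<delta>'_def)
        fix h :: 'a assume h: "norm (h - 0) < \<delta>'"
        have hb: "\<bar>h \<bullet> b\<bar> \<le> norm h" using b by (rule Basis_le_norm)
        \<comment> \<open>Subtracting the linear part leaves a curve whose velocity is a difference
          of two values of the partial derivative, hence at most e; the mean value inequality then
          gives the error bound.\<close>
        define g where "g t = f (x + \<sigma> h + t *\<^sub>R b) - t *\<^sub>R partial_deriv b f x" for t :: real
        have "norm (g (h \<bullet> b) - g 0) \<le> e * norm (h \<bullet> b - 0)"
        proof (rule differentiable_bound[where S="cball 0 (norm h)" and f'="\<lambda>t. (\<lambda>k. k *\<^sub>R (partial_deriv b f (x + \<sigma> h + t *\<^sub>R b) - partial_deriv b f x))"])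
          fix t :: real assume t: "t \<in> cball 0 (norm h)"
          have "(g has_vector_derivative partial_deriv b f (x + \<sigma> h + t *\<^sub>R b) - 1 *\<^sub>R partial_deriv b f x) (at t)"
            unfolding g_def by (intro has_vector_derivative_diff smooth_has_vector_derivative sm b)
              (auto intro!: derivative_eq_intros)
          then show "(g has_derivative (\<lambda>k. k *\<^sub>R (partial_deriv b f (x + \<sigma> h + t *\<^sub>R b) - partial_deriv b f x))) (at t within cball 0 (norm h))"
            by (auto simp: has_vector_derivative_def intro: has_derivative_at_withinI)
          have "dist (x + \<sigma> h + t *\<^sub>R b) x \<le> norm (\<sigma> h) + norm (t *\<^sub>R b)"
            using norm_triangle_ineq[of "\<sigma> h" "t *\<^sub>R b"] by (simp add: dist_norm add.assoc)
          also have "\<dots> \<le> card S * norm h + norm h" using \<sigma>b[of h] t b by (intro add_mono) auto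
          also have "\<dots> < \<delta>" using h by (simp add: \<delta>'_def field_simps)
          finally have "dist (partial_deriv b f (x + \<sigma> h + t *\<^sub>R b)) (partial_deriv b f x) < e" by (rule \<delta>)
          then have "norm (k *\<^sub>R (partial_deriv b f (x + \<sigma> h + t *\<^sub>R b) - partial_deriv b f x)) \<le> e * norm k" for k :: real
            using mult_left_mono[of "norm (partial_deriv b f (x + \<sigma> h + t *\<^sub>R b) - partial_deriv b f x)" e "\<bar>k\<bar>"]
            by (simp add: dist_norm mult.commute)
          then show "onorm (\<lambda>k. k *\<^sub>R (partial_deriv b f (x + \<sigma> h + t *\<^sub>R b) - partial_deriv b f x)) \<le> e"
            by (rule onorm_le)
        qed (use hb in auto)
        also have "\<dots> \<le> e * norm h" using hb e by simp
        finally show "norm (f (x + \<sigma> h + (h \<bullet> b) *\<^sub>R b) - f (x + \<sigma> h) -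
            (f (x + \<sigma> 0 + (0 \<bullet> b) *\<^sub>R b) - f (x + \<sigma> 0)) - ((h - 0) \<bullet> b) *\<^sub>R partial_deriv b f x) \<le> e * norm (h - 0)"
          by (simp add: g_def algebra_simps)
      qed
    qed
    have 2: "(\<Sum>b\<in>insert b S. (h \<bullet> b) *\<^sub>R b) = \<sigma> h + (h \<bullet> b) *\<^sub>R b" for h
      using insert by (simp add: \<sigma>_def)
    show ?case
      using has_derivative_add[OF IH 1] insert(1,2) by (simp add: 2 add.assoc[symmetric] add.commute[of _ "\<Sum>b\<in>S. _ b"])
  qed
  have "((\<lambda>h. f (x + h)) has_derivative (\<lambda>h. \<Sum>b\<in>Basis. (h \<bullet> b) *\<^sub>R partial_deriv b f x)) (at 0)"
    using main[of Basis] by (simp add: euclidean_representation)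
  moreover have "((\<lambda>y. y - x) has_derivative (\<lambda>h. h)) (at x)"
    by (auto intro!: derivative_eq_intros)
  ultimately have "((\<lambda>y. f (x + (y - x))) has_derivative (\<lambda>h. \<Sum>b\<in>Basis. (h \<bullet> b) *\<^sub>R partial_deriv b f x)) (at x)"
    by (intro has_derivative_compose[where f="\<lambda>y. y - x" and g="\<lambda>h. f (x + h)", of "\<lambda>h. h"]) auto
  then show ?thesis by simp
qed

lemma partial_deriv_has_derivative:
  assumes "(f has_derivative f') (at x)"
  shows "partial_deriv v f x = f' v"
proof -
  have "((\<lambda>t. x + t *\<^sub>R v) has_derivative (\<lambda>t. t *\<^sub>R v)) (at 0)"
    by (auto intro!: derivative_eq_intros)
  then have "((\<lambda>t. f (x + t *\<^sub>R v)) has_derivative (\<lambda>t. f' (t *\<^sub>R v))) (at 0)"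
    by (rule has_derivative_compose) (use assms in simp)
  moreover have "f' (t *\<^sub>R v) = t *\<^sub>R f' v" for t
    by (rule linear_scale[OF has_derivative_linear[OF assms]])
  ultimately show ?thesis by (intro partial_derivI) (simp add: has_vector_derivative_def)
qed

lemma has_derivative_imp_differentiable_dir:
  assumes "(f has_derivative f') (at x)"
  shows "(\<lambda>t::real. f (x + t *\<^sub>R b)) differentiable at 0"
proof -
  have "(f \<circ> (\<lambda>t. x + t *\<^sub>R b)) differentiable at 0"
    by (rule differentiable_chain_at) (use assms in \<open>auto simp: differentiable_def intro!: derivative_eq_intros exI\<close>)
  then show ?thesis by (simp add: o_def)
qed

lemma smooth_has_derivative_partial:
  assumes "smooth f"
  shows "(f has_derivative (\<lambda>v. partial_deriv v f x)) (at x)"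
proof -
  note D = smooth_has_derivative[OF assms, of x]
  show ?thesis
    using D by (rule has_derivative_eq_rhs) (rule ext, rule partial_deriv_has_derivative[OF D, symmetric])
qed

lemma partial_deriv_expand:
  assumes "smooth f"
  shows "partial_deriv v f x = (\<Sum>b\<in>Basis. (v \<bullet> b) *\<^sub>R partial_deriv b f x)"
  by (rule partial_deriv_has_derivative[OF smooth_has_derivative[OF assms]])

section \<open>Closure of smoothness under sums, linear and bilinear maps, and composition\<close>

lemma partial_deriv_const: "partial_deriv b (\<lambda>x. c) = (\<lambda>x. 0)"
  by (rule ext) (auto intro!: partial_derivI)

text \<open>A derivative of a product or composite is a sum of products or composites, so the class
  handed to \<open>smooth_coinduct\<close> must contain finite sums of the basic shape G. Stability
  under derivatives then has to be checked on G alone.\<close>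

inductive_set sums_of :: "('a \<Rightarrow> 'b::comm_monoid_add) set \<Rightarrow> ('a \<Rightarrow> 'b) set" for G where
  base: "g \<in> G \<Longrightarrow> g \<in> sums_of G"
| zero: "(\<lambda>x. 0) \<in> sums_of G"
| add: "f \<in> sums_of G \<Longrightarrow> g \<in> sums_of G \<Longrightarrow> (\<lambda>x. f x + g x) \<in> sums_of G"

lemma sums_of_sum: "(\<And>i. i \<in> A \<Longrightarrow> g i \<in> sums_of G) \<Longrightarrow> (\<lambda>x. \<Sum>i\<in>A. g i x) \<in> sums_of G"
  by (induction A rule: infinite_finite_induct) (auto intro: sums_of.intros)

lemma partial_deriv_add_gen:
  assumes "(\<lambda>t::real. f (x + t *\<^sub>R b)) differentiable at 0" "(\<lambda>t::real. g (x + t *\<^sub>R b)) differentiable at 0"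
  shows "partial_deriv b (\<lambda>x. f x + g x) x = partial_deriv b f x + partial_deriv b g x"
  using assms unfolding partial_deriv_def by (auto simp: vector_derivative_add_at)

lemma smooth_sums_of:
  fixes G :: "('a::euclidean_space \<Rightarrow> 'b::real_normed_vector) set"
  assumes cont: "\<And>g. g \<in> G \<Longrightarrow> continuous_on UNIV g"
    and diff: "\<And>g b x. g \<in> G \<Longrightarrow> b \<in> Basis \<Longrightarrow> (\<lambda>t::real. g (x + t *\<^sub>R b)) differentiable at 0"
    and deriv: "\<And>g b. g \<in> G \<Longrightarrow> b \<in> Basis \<Longrightarrow> partial_deriv b g \<in> sums_of G"
    and f: "f \<in> sums_of G"
  shows "smooth f"
proof (rule smooth_coinduct[OF f])
  fix f assume "f \<in> sums_of G"
  then show "continuous_on UNIV f"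
    by induction (auto intro: cont continuous_intros)
next
  fix f :: "'a \<Rightarrow> 'b" and b x :: 'a assume f: "f \<in> sums_of G" and b: "b \<in> Basis"
  from f show "(\<lambda>t::real. f (x + t *\<^sub>R b)) differentiable at 0"
    by induction (auto intro: diff b)
next
  fix f :: "'a \<Rightarrow> 'b" and b :: 'a assume f: "f \<in> sums_of G" and b: "b \<in> Basis"
  have d: "(\<lambda>t::real. f (x + t *\<^sub>R b)) differentiable at 0" if "f \<in> sums_of G" for f x
    using that by induction (auto intro: diff b)
  from f show "partial_deriv b f \<in> sums_of G"
  proof induction
    case (base g) then show ?case using deriv b by auto
  next
    case zero then show ?case by (simp add: partial_deriv_const sums_of.zero)
  next
    case (add f g)
    have "partial_deriv b (\<lambda>x. f x + g x) = (\<lambda>x. partial_deriv b f x + partial_deriv b g x)"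
      by (rule ext, rule partial_deriv_add_gen) (use add d in auto)
    then show ?case using add by (auto intro: sums_of.add)
  qed
qed

lemma smooth_add:
  assumes "smooth f" "smooth g" shows "smooth (\<lambda>x. f x + g x)"
proof (rule smooth_sums_of[where G="{f. smooth f}"])
  show "(\<lambda>x. f x + g x) \<in> sums_of {f. smooth f}" using assms by (auto intro: sums_of.intros)
qed (auto intro: smooth_continuous smooth_differentiable smooth_partial_deriv sums_of.base)

lemma smooth_sums_of_smooth:
  assumes "f \<in> sums_of {f. smooth f}" shows "smooth f"
  by (rule smooth_sums_of[OF _ _ _ assms])
    (auto intro: smooth_continuous smooth_differentiable smooth_partial_deriv sums_of.base)

lemma smooth_const [simp]: "smooth (\<lambda>x. c)"
proof (rule smooth_coinduct[where X="range (\<lambda>c x. c)"])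
  show "partial_deriv b f \<in> range (\<lambda>c x. c)" if "f \<in> range (\<lambda>c x. c)" for f :: "'a \<Rightarrow> 'b" and b
    using that by (auto simp: partial_deriv_const)
qed auto

lemma smooth_sum: "(\<And>i. i \<in> A \<Longrightarrow> smooth (f i)) \<Longrightarrow> smooth (\<lambda>x. \<Sum>i\<in>A. f i x)"
  by (rule smooth_sums_of_smooth, rule sums_of_sum) (auto intro: sums_of.base)

lemma partial_deriv_add:
  assumes "smooth f" "smooth g"
  shows "partial_deriv v (\<lambda>x. f x + g x) = (\<lambda>x. partial_deriv v f x + partial_deriv v g x)"
  by (rule ext, rule partial_deriv_has_derivative)
    (intro has_derivative_add smooth_has_derivative_partial assms)

lemma partial_deriv_sum:
  assumes "\<And>i. i \<in> A \<Longrightarrow> smooth (f i)"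
  shows "partial_deriv v (\<lambda>x. \<Sum>i\<in>A. f i x) = (\<lambda>x. \<Sum>i\<in>A. partial_deriv v (f i) x)"
  by (rule ext, rule partial_deriv_has_derivative)
    (intro has_derivative_sum smooth_has_derivative_partial assms)

lemma partial_deriv_bounded_linear:
  assumes "smooth f" "bounded_linear L"
  shows "partial_deriv v (\<lambda>x. L (f x)) = (\<lambda>x. L (partial_deriv v f x))"
  by (rule ext, rule partial_deriv_has_derivative)
    (intro bounded_linear.has_derivative[OF assms(2)] smooth_has_derivative_partial assms)

lemma smooth_bounded_linear:
  fixes f :: "'a::euclidean_space \<Rightarrow> 'b::real_normed_vector" and L :: "'b \<Rightarrow> 'c::real_normed_vector"
  assumes L: "bounded_linear L" and f: "smooth f"
  shows "smooth (\<lambda>x. L (f x))"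
proof (rule smooth_coinduct[where X="{\<lambda>x. L (f x) |f. smooth f}"])
  fix g :: "'a \<Rightarrow> 'c" and b x :: 'a assume "g \<in> {\<lambda>x. L (f x) |f. smooth f}" and b: "b \<in> Basis"
  then obtain f where f: "g = (\<lambda>x. L (f x))" "smooth f" by auto
  have "((\<lambda>t. L (f (x + t *\<^sub>R b))) has_vector_derivative L (partial_deriv b f (x + 0 *\<^sub>R b))) (at 0)"
    by (intro bounded_linear.has_vector_derivative[OF L] smooth_has_vector_derivative f b)
  then show "(\<lambda>t::real. g (x + t *\<^sub>R b)) differentiable at 0"
    using f by (auto intro: differentiableI_vector)
next
  let ?X = "{\<lambda>x. L (f x) |f :: 'a \<Rightarrow> 'b. smooth f}"
  show "(\<lambda>x. L (f x)) \<in> ?X" using f by blast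
  fix g :: "'a \<Rightarrow> 'c" assume "g \<in> ?X"
  then obtain f where f: "g = (\<lambda>x. L (f x))" "smooth f" by auto
  show "continuous_on UNIV g"
    unfolding f by (intro bounded_linear.continuous_on[OF L] smooth_continuous f)
  show "partial_deriv b g \<in> ?X" if "b \<in> Basis" for b
    unfolding f(1) partial_deriv_bounded_linear[OF f(2) L] using smooth_partial_deriv[OF f(2) that] by blast
qed

lemma smooth_linear:
  fixes f :: "'a::euclidean_space \<Rightarrow> 'b::real_normed_vector"
  assumes lin: "bounded_linear f" shows "smooth f"
proof (rule smooth_coinduct[where X="{f. bounded_linear f} \<union> range (\<lambda>c x. c)"])
  fix f :: "'a \<Rightarrow> 'b" and b x :: 'a assume f: "f \<in> {f. bounded_linear f} \<union> range (\<lambda>c x. c)" "b \<in> Basis"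
  have D: "(f has_derivative f) (at x)" if "bounded_linear f" for x
    using that by (rule bounded_linear.has_derivative) auto
  have "partial_deriv b f = (\<lambda>x. f b)" if "bounded_linear f"
    by (rule ext, rule partial_deriv_has_derivative, rule D[OF that])
  moreover have "partial_deriv b f = (\<lambda>x. 0)" if "f \<in> range (\<lambda>c x. c)"
    using that by (auto simp: partial_deriv_const)
  ultimately show "partial_deriv b f \<in> {f. bounded_linear f} \<union> range (\<lambda>c x. c)"
    using f(1) by auto
  show "(\<lambda>t::real. f (x + t *\<^sub>R b)) differentiable at 0"
  proof (cases "bounded_linear f")
    case True
    show ?thesis by (rule has_derivative_imp_differentiable_dir[OF D[OF True]])
  qed (use f in auto)
next
  show "f \<in> {f. bounded_linear f} \<union> range (\<lambda>c x. c)" using lin by blast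
  fix f :: "'a \<Rightarrow> 'b" assume "f \<in> {f. bounded_linear f} \<union> range (\<lambda>c x. c)"
  then show "continuous_on UNIV f"
    by (elim UnE) (auto intro: linear_continuous_on)
qed

lemma partial_deriv_bilinear:
  assumes P: "bounded_bilinear P" and "smooth f" "smooth g"
  shows "partial_deriv v (\<lambda>x. P (f x) (g x)) = (\<lambda>x. P (partial_deriv v f x) (g x) + P (f x) (partial_deriv v g x))"
  by (rule ext, subst partial_deriv_has_derivative[OF bounded_bilinear.FDERIV[OF P
        smooth_has_derivative_partial[OF assms(2)] smooth_has_derivative_partial[OF assms(3)]]])
    (simp add: add.commute)

lemma smooth_bilinear:
  fixes f :: "'a::euclidean_space \<Rightarrow> 'b::real_normed_vector" and g :: "'a \<Rightarrow> 'c::real_normed_vector"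
    and P :: "'b \<Rightarrow> 'c \<Rightarrow> 'd::real_normed_vector"
  assumes P: "bounded_bilinear P" and "smooth f" "smooth g"
  shows "smooth (\<lambda>x. P (f x) (g x))"
proof (rule smooth_sums_of[where G="{\<lambda>x. P (f x) (g x) | f g. smooth f \<and> smooth g}"])
  let ?G = "{\<lambda>x. P (f x) (g x) | f g. smooth f \<and> smooth g}"
  fix h :: "'a \<Rightarrow> 'd" assume "h \<in> ?G"
  then obtain f g where h: "h = (\<lambda>x. P (f x) (g x))" and f: "smooth f" and g: "smooth g" by auto
  show "(\<lambda>t::real. h (x + t *\<^sub>R b)) differentiable at 0" if b: "b \<in> Basis" for x b
    unfolding h by (rule differentiableI_vector, rule bounded_bilinear.has_vector_derivative[OF P])
      (rule smooth_has_vector_derivative[OF f b] smooth_has_vector_derivative[OF g b])+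
  show "partial_deriv b h \<in> sums_of ?G" if b: "b \<in> Basis" for b
    unfolding h partial_deriv_bilinear[OF P f g]
    by (intro sums_of.add sums_of.base) (use f g b smooth_partial_deriv in blast)+
  show "continuous_on UNIV h"
    unfolding h by (intro bounded_bilinear.continuous_on[OF P] smooth_continuous f g)
next
  show "(\<lambda>x. P (f x) (g x)) \<in> sums_of {\<lambda>x. P (f x) (g x) | f g. smooth f \<and> smooth g}"
    using assms by (intro sums_of.base) blast
qed

lemmas smooth_mult = smooth_bilinear[OF bounded_bilinear_mult]
lemmas smooth_scaleR = smooth_bilinear[OF bounded_bilinear_scaleR]
lemmas partial_deriv_mult = partial_deriv_bilinear[OF bounded_bilinear_mult]

lemma smooth_compose_has_derivative:
  assumes "smooth f" "smooth \<phi>"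
  shows "((\<lambda>x. f (\<phi> x)) has_derivative (\<lambda>v. partial_deriv (partial_deriv v \<phi> x) f (\<phi> x))) (at x)"
  by (rule has_derivative_compose) (intro smooth_has_derivative_partial assms)+

lemma partial_deriv_compose:
  assumes "smooth f" "smooth \<phi>"
  shows "partial_deriv v (\<lambda>x. f (\<phi> x)) x = partial_deriv (partial_deriv v \<phi> x) f (\<phi> x)"
  by (rule partial_deriv_has_derivative[OF smooth_compose_has_derivative[OF assms]])

text \<open>The basic shape carries a scalar coefficient h because the chain rule multiplies by
  components of the derivative of \<phi>; composites f(\<phi> x) alone would not be stable.\<close>

lemma smooth_compose:
  fixes f :: "'b::euclidean_space \<Rightarrow> 'c::real_normed_vector" and \<phi> :: "'a::euclidean_space \<Rightarrow> 'b"
  assumes "smooth f" and \<phi>: "smooth \<phi>"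
  shows "smooth (\<lambda>x. f (\<phi> x))"
proof (rule smooth_sums_of[where G="{\<lambda>x. h x *\<^sub>R f (\<phi> x) | (h :: 'a \<Rightarrow> real) (f :: 'b \<Rightarrow> 'c). smooth h \<and> smooth f}"])
  let ?G = "{\<lambda>x. h x *\<^sub>R f (\<phi> x) | (h :: 'a \<Rightarrow> real) (f :: 'b \<Rightarrow> 'c). smooth h \<and> smooth f}"
  have c: "continuous_on UNIV (\<lambda>x. f (\<phi> x))" if "smooth f" for f :: "'b \<Rightarrow> 'c"
    by (rule continuous_on_compose2[OF smooth_continuous[OF that] smooth_continuous[OF \<phi>]]) auto
  fix g :: "'a \<Rightarrow> 'c" assume "g \<in> ?G"
  then obtain h :: "'a \<Rightarrow> real" and f :: "'b \<Rightarrow> 'c"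
    where g: "g = (\<lambda>x. h x *\<^sub>R f (\<phi> x))" and h: "smooth h" and f: "smooth f" by auto
  show "continuous_on UNIV g" unfolding g by (intro continuous_intros smooth_continuous h c f)
  note D = has_derivative_scaleR[OF smooth_has_derivative_partial[OF h] smooth_compose_has_derivative[OF f \<phi>]]
  show "(\<lambda>t::real. g (x + t *\<^sub>R b)) differentiable at 0" for x b
    unfolding g by (rule has_derivative_imp_differentiable_dir[OF D])
  fix b :: 'a assume b: "b \<in> Basis"
  have "partial_deriv b g = (\<lambda>x. partial_deriv b h x *\<^sub>R f (\<phi> x) +
      (\<Sum>c\<in>Basis. (h x * (partial_deriv b \<phi> x \<bullet> c)) *\<^sub>R partial_deriv c f (\<phi> x)))"
  proof
    fix x
    show "partial_deriv b g x = partial_deriv b h x *\<^sub>R f (\<phi> x) +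
      (\<Sum>c\<in>Basis. (h x * (partial_deriv b \<phi> x \<bullet> c)) *\<^sub>R partial_deriv c f (\<phi> x))"
      unfolding g partial_deriv_has_derivative[OF D]
      by (subst partial_deriv_expand[OF f, of "partial_deriv b \<phi> x"]) (simp add: scaleR_sum_right)
  qed
  also have "\<dots> \<in> sums_of ?G"
  proof (intro sums_of.add sums_of_sum sums_of.base)
    show "(\<lambda>x. partial_deriv b h x *\<^sub>R f (\<phi> x)) \<in> ?G"
      using smooth_partial_deriv[OF h b] f by auto
    fix c :: 'b assume c: "c \<in> Basis"
    have "smooth (\<lambda>x. h x * (partial_deriv b \<phi> x \<bullet> c))"
      by (intro smooth_mult h smooth_bounded_linear[OF bounded_linear_inner_left] smooth_partial_deriv \<phi> b)
    then show "(\<lambda>x. (h x * (partial_deriv b \<phi> x \<bullet> c)) *\<^sub>R partial_deriv c f (\<phi> x)) \<in> ?G"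
      using smooth_partial_deriv[OF f c]
      by (intro CollectI exI[of _ "\<lambda>x. h x * (partial_deriv b \<phi> x \<bullet> c)"] exI[of _ "partial_deriv c f"]) auto
  qed
  finally show "partial_deriv b g \<in> sums_of ?G" .
next
  have "(\<lambda>x. 1 *\<^sub>R f (\<phi> x)) \<in> {\<lambda>x. h x *\<^sub>R f (\<phi> x) | (h :: 'a \<Rightarrow> real) (f :: 'b \<Rightarrow> 'c). smooth h \<and> smooth f}"
    using assms(1) by (intro CollectI exI[of _ "\<lambda>_. 1"] exI[of _ f]) auto
  then show "(\<lambda>x. f (\<phi> x)) \<in> sums_of {\<lambda>x. h x *\<^sub>R f (\<phi> x) | (h :: 'a \<Rightarrow> real) (f :: 'b \<Rightarrow> 'c). smooth h \<and> smooth f}"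
    by (auto intro: sums_of.base)
qed

text \<open>Symmetry: differentiate \<open>f(x+sb+tc) = f(x+sb) + \<integral>\<^sub>0\<^sup>t \<partial>\<^sub>cf(x+sb+rc) dr\<close> first in \<open>s\<close>, then in \<open>t\<close>.\<close>
lemma partial_deriv_commute:
  fixes f :: "'a::euclidean_space \<Rightarrow> 'b::banach"
  assumes f: "smooth f" and b: "b \<in> Basis" and c: "c \<in> Basis"
  shows "partial_deriv b (partial_deriv c f) = partial_deriv c (partial_deriv b f)"
proof
  fix x
  define F where "F t = f (x + t *\<^sub>R c)" for t
  have fc: "smooth (partial_deriv c f)" and fb: "smooth (partial_deriv b f)" and fbc: "smooth (partial_deriv b (partial_deriv c f))"
    by (intro smooth_partial_deriv f b c)+
  have cont: "continuous_on S (\<lambda>p. g (\<phi> p))" if "smooth g" "continuous_on S \<phi>" for g :: "'a \<Rightarrow> 'b" and \<phi> :: "'z::topological_space \<Rightarrow> 'a" and S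
    by (rule continuous_on_compose2[OF smooth_continuous[OF that(1)] that(2)]) auto
  have 1: "f (y + t *\<^sub>R c) = f y + integral {0..t} (\<lambda>r. partial_deriv c f (y + r *\<^sub>R c))" if "t \<ge> 0" for y t
  proof -
    have "((\<lambda>r. partial_deriv c f (y + r *\<^sub>R c)) has_integral (f (y + t *\<^sub>R c) - f (y + 0 *\<^sub>R c))) {0..t}"
      by (rule fundamental_theorem_of_calculus[OF that])
        (rule has_vector_derivative_at_within, rule smooth_has_vector_derivative[OF f c])
    then show ?thesis by (simp add: integral_unique)
  qed
  have 2: "partial_deriv b f (x + t *\<^sub>R c) = partial_deriv b f x + integral {0..t} (\<lambda>r. partial_deriv b (partial_deriv c f) (x + r *\<^sub>R c))"
    if t: "t \<ge> 0" for t
  proof (rule partial_derivI)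
    have "((\<lambda>s. f (x + s *\<^sub>R b) + integral (cbox 0 t) (\<lambda>r. partial_deriv c f ((x + r *\<^sub>R c) + s *\<^sub>R b))) has_vector_derivative
        partial_deriv b f (x + 0 *\<^sub>R b) + integral (cbox 0 t) (\<lambda>r. partial_deriv b (partial_deriv c f) (x + r *\<^sub>R c + 0 *\<^sub>R b))) (at 0)"
    proof (rule has_vector_derivative_add[OF smooth_has_vector_derivative[OF f b]], rule leibniz_rule_vector_derivative[where U=UNIV])
      show "((\<lambda>s. partial_deriv c f (x + r *\<^sub>R c + s *\<^sub>R b)) has_vector_derivative partial_deriv b (partial_deriv c f) (x + r *\<^sub>R c + s *\<^sub>R b)) (at s)" for r s
        by (intro smooth_has_vector_derivative fc b)
      show "(\<lambda>r. partial_deriv c f (x + r *\<^sub>R c + s *\<^sub>R b)) integrable_on cbox 0 t" for s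
        by (intro integrable_continuous cont fc continuous_intros)
      show "continuous_on (UNIV \<times> cbox 0 t) (\<lambda>(s, r). partial_deriv b (partial_deriv c f) (x + r *\<^sub>R c + s *\<^sub>R b))"
        unfolding case_prod_beta by (intro cont fbc continuous_intros)
    qed auto
    moreover have "f (x + t *\<^sub>R c + s *\<^sub>R b) = f (x + s *\<^sub>R b) + integral (cbox 0 t) (\<lambda>r. partial_deriv c f ((x + r *\<^sub>R c) + s *\<^sub>R b))" for s
      using 1[OF t, of "x + s *\<^sub>R b"] by (simp add: algebra_simps)
    ultimately show "((\<lambda>s. f (x + t *\<^sub>R c + s *\<^sub>R b)) has_vector_derivative partial_deriv b f x + integral {0..t} (\<lambda>r. partial_deriv b (partial_deriv c f) (x + r *\<^sub>R c))) (at 0)"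
      by simp
  qed
  \<comment> \<open>The formula for the b-derivative along the c-line is available for t \<ge> 0
    only, hence derivatives within {0..1}; these still determine the value at 0.\<close>
  have "((\<lambda>t. integral {0..t} (\<lambda>r. partial_deriv b (partial_deriv c f) (x + r *\<^sub>R c))) has_vector_derivative partial_deriv b (partial_deriv c f) (x + 0 *\<^sub>R c)) (at 0 within {0..1})"
    by (intro integral_has_vector_derivative cont fbc continuous_intros) auto
  then have "((\<lambda>t. partial_deriv b f x + integral {0..t} (\<lambda>r. partial_deriv b (partial_deriv c f) (x + r *\<^sub>R c))) has_vector_derivative partial_deriv b (partial_deriv c f) x) (at 0 within {0..1})"
    by (auto intro!: derivative_eq_intros)
  then have A: "((\<lambda>t. partial_deriv b f (x + t *\<^sub>R c)) has_vector_derivative partial_deriv b (partial_deriv c f) x) (at 0 within {0..1})"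
    by (rule has_vector_derivative_transform[rotated 2]) (auto simp: 2)
  have B: "((\<lambda>t. partial_deriv b f (x + t *\<^sub>R c)) has_vector_derivative partial_deriv c (partial_deriv b f) x) (at 0 within {0..1})"
    using has_vector_derivative_at_within[OF smooth_has_vector_derivative[OF fb c, of x 0]] by simp
  show "partial_deriv b (partial_deriv c f) x = partial_deriv c (partial_deriv b f) x"
    using A B by (intro vector_derivative_unique_within_closed_interval[of 0 1 0]) (auto simp: box_real)
qed

section \<open>Uniformly bounded families and weights\<close>

lemma partial_deriv_scale_dir:
  "smooth f \<Longrightarrow> partial_deriv (c *\<^sub>R v) f x = c *\<^sub>R partial_deriv v f x"
  by (rule linear_scale[OF has_derivative_linear[OF smooth_has_derivative_partial]])

lemma partial_deriv_add_dir:
  "smooth f \<Longrightarrow> partial_deriv (u + v) f x = partial_deriv u f x + partial_deriv v f x"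
  by (rule linear_add[OF has_derivative_linear[OF smooth_has_derivative_partial]])

lemma partial_deriv_linear:
  assumes "bounded_linear L" shows "partial_deriv v (\<lambda>x. c + L x) = (\<lambda>x. L v)"
proof (rule ext, rule partial_deriv_has_derivative)
  fix x
  have "(L has_derivative L) (at x)" by (rule bounded_linear_imp_has_derivative[OF assms])
  from has_derivative_add[OF has_derivative_const this]
  show "((\<lambda>x. c + L x) has_derivative L) (at x)" by simp
qed

lemma smooth_affine:
  fixes L :: "'a::euclidean_space \<Rightarrow> 'b::real_normed_vector"
  assumes "bounded_linear L" shows "smooth (\<lambda>x. c + L x)"
  by (intro smooth_add smooth_const smooth_linear assms)

lemma smooth_cmult: "smooth f \<Longrightarrow> smooth (\<lambda>x. c * f x)" for c :: "'b::real_normed_algebra"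
  by (intro smooth_mult smooth_const)

lemma iter_partial_add:
  assumes "smooth f" "smooth g" "set bs \<subseteq> Basis"
  shows "iter_partial bs (\<lambda>x. f x + g x) = (\<lambda>x. iter_partial bs f x + iter_partial bs g x)"
  using assms(3) by (induction bs) (auto simp: partial_deriv_add smooth_iter_partial assms)

lemma iter_partial_bounded_linear:
  assumes "smooth f" "bounded_linear L" "set bs \<subseteq> Basis"
  shows "iter_partial bs (\<lambda>x. L (f x)) = (\<lambda>x. L (iter_partial bs f x))"
  using assms(3) by (induction bs)
    (auto simp: partial_deriv_bounded_linear[OF _ assms(2)] smooth_iter_partial assms)

lemmas iter_partial_cmult = iter_partial_bounded_linear[OF _ bounded_linear_mult_right]

lemma iter_partial_sum:
  assumes "\<And>i. i \<in> A \<Longrightarrow> smooth (f i)" "set bs \<subseteq> Basis"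
  shows "iter_partial bs (\<lambda>x. \<Sum>i\<in>A. f i x) = (\<lambda>x. \<Sum>i\<in>A. iter_partial bs (f i) x)"
  using assms(2) by (induction bs) (auto simp: partial_deriv_sum smooth_iter_partial assms(1))

lemma iter_partial_diff:
  assumes "smooth f" "smooth g" "set bs \<subseteq> Basis"
  shows "iter_partial bs (\<lambda>x. f x - g x) = (\<lambda>x. iter_partial bs f x - iter_partial bs g x)"
proof -
  have "iter_partial bs (\<lambda>x. f x + (- g x)) = (\<lambda>x. iter_partial bs f x + (- iter_partial bs g x))"
    using iter_partial_add[OF assms(1) smooth_bounded_linear[OF bounded_linear_minus[OF bounded_linear_ident] assms(2)] assms(3)]
      iter_partial_bounded_linear[OF assms(2) bounded_linear_minus[OF bounded_linear_ident] assms(3)] by simp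
  then show ?thesis by simp
qed

lemma smooth_diff: "smooth f \<Longrightarrow> smooth g \<Longrightarrow> smooth (\<lambda>x. f x - g x)"
  using smooth_add[OF _ smooth_bounded_linear[OF bounded_linear_minus[OF bounded_linear_ident]], of f g] by simp

lemma partial_deriv_cmult:
  fixes c :: "'b::real_normed_algebra"
  assumes "smooth f"
  shows "partial_deriv v (\<lambda>x. c * f x) = (\<lambda>x. c * partial_deriv v f x)"
  by (rule partial_deriv_bounded_linear[OF assms bounded_linear_mult_right])

lemma iter_partial_commute1:
  fixes f :: "'a::euclidean_space \<Rightarrow> 'b::banach"
  assumes "smooth f" "b \<in> Basis" "set bs \<subseteq> Basis"
  shows "iter_partial bs (partial_deriv b f) = partial_deriv b (iter_partial bs f)"
  using assms(3)
  by (induction bs) (auto simp: partial_deriv_commute[OF smooth_iter_partial[OF assms(1)] _ assms(2)])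

text \<open>The head of one list is moved past the entries in front of it in the other. The bounds
  of the theorem use the fixed order of \<open>mderiv\<close>, whereas \<open>smooth\<close>,
  \<open>ubd\<close> and \<open>ampl\<close> range over arbitrary lists; this lemma joins the
  two.\<close>

lemma iter_partial_perm:
  fixes f :: "'a::euclidean_space \<Rightarrow> 'b::banach"
  assumes f: "smooth f" and "mset bs = mset cs" "set bs \<subseteq> Basis"
  shows "iter_partial bs f = iter_partial cs f"
  using assms(2,3)
proof (induction bs arbitrary: cs)
  case Nil
  then show ?case by simp
next
  case (Cons b bs)
  have "b \<in> set cs" using mset_eq_setD[OF Cons.prems(1)] by auto
  then obtain us vs where cs: "cs = us @ b # vs" by (auto simp: in_set_conv_decomp)
  have "set cs \<subseteq> Basis" using mset_eq_setD[OF Cons.prems(1)] Cons.prems(2) by auto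
  then have 1: "set us \<subseteq> Basis" "b \<in> Basis" "set vs \<subseteq> Basis" using cs by auto
  have "iter_partial bs f = iter_partial (us @ vs) f"
    using Cons.prems cs by (intro Cons.IH) auto
  then show ?case
    using iter_partial_commute1[OF smooth_iter_partial[OF f 1(3)] 1(2,1)] cs by simp
qed

text \<open>Derivatives are local. This is used where a cutoff equals 1 near a point and where a
  function vanishes outside a ball.\<close>

lemma iter_partial_cong_open:
  assumes "open S" "\<And>x. x \<in> S \<Longrightarrow> f x = g x" "x \<in> S"
  shows "iter_partial bs f x = iter_partial bs g x"
  using assms(3)
proof (induction bs arbitrary: x)
  case Nil
  then show ?case using assms by simp
next
  case (Cons b bs)
  have "((\<lambda>t::real. x + t *\<^sub>R b) \<longlongrightarrow> x + 0 *\<^sub>R b) (nhds 0)"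
    by (intro tendsto_intros filterlim_ident)
  then have "\<forall>\<^sub>F t in nhds (0::real). x + t *\<^sub>R b \<in> S"
    using assms(1) Cons.prems by (auto simp: tendsto_def)
  then show ?case
    unfolding iter_partial_Cons partial_deriv_def
    by (intro vector_derivative_cong_eq) (auto elim!: eventually_mono intro: Cons.IH)
qed

text \<open>Covers dilations, where \<tau> is the identity, and the map taking (y,\<eta>) to (x, x +
  ty, \<xi> + \<eta>), where \<tau> embeds a direction into the last two slots and \<kappa> is t or
  1.\<close>

lemma iter_partial_affine:
  fixes f :: "'b::euclidean_space \<Rightarrow> 'c::real_normed_vector" and \<phi> :: "'a::euclidean_space \<Rightarrow> 'b"
  assumes f: "smooth f" and \<phi>: "smooth \<phi>"
    and d: "\<And>b x. b \<in> Basis \<Longrightarrow> partial_deriv b \<phi> x = \<kappa> b *\<^sub>R \<tau> b"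
    and \<tau>: "\<And>b. b \<in> Basis \<Longrightarrow> \<tau> b \<in> Basis"
    and bs: "set bs \<subseteq> Basis"
  shows "iter_partial bs (\<lambda>x. f (\<phi> x)) = (\<lambda>x. prod_list (map \<kappa> bs) *\<^sub>R iter_partial (map \<tau> bs) f (\<phi> x))"
  using bs
proof (induction bs)
  case (Cons b bs)
  have b: "b \<in> Basis" "set (map \<tau> bs) \<subseteq> Basis" using Cons.prems \<tau> by auto
  let ?g = "iter_partial (map \<tau> bs) f"
  have g: "smooth ?g" by (rule smooth_iter_partial[OF f b(2)])
  have "partial_deriv b (\<lambda>x. prod_list (map \<kappa> bs) *\<^sub>R ?g (\<phi> x)) = (\<lambda>x. prod_list (map \<kappa> bs) *\<^sub>R (\<kappa> b *\<^sub>R partial_deriv (\<tau> b) ?g (\<phi> x)))"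
    by (subst partial_deriv_bounded_linear[OF smooth_compose[OF g \<phi>] bounded_linear_scaleR_right])
      (auto simp: partial_deriv_compose[OF g \<phi>] d[OF b(1)] partial_deriv_scale_dir[OF g])
  then show ?case using Cons by (simp add: mult.commute)
qed simp

section \<open>Functions of two variables with one variable fixed\<close>

lemma smooth_section_snd: "smooth f \<Longrightarrow> smooth (\<lambda>\<eta>. f (y, \<eta>))"
  by (rule smooth_compose[where \<phi>="\<lambda>\<eta>. (y, \<eta>)"], assumption)
    (use smooth_affine[of "\<lambda>\<eta>. (0, \<eta>)" "(y,0)"] in \<open>simp add: bounded_linear_Pair bounded_linear_zero bounded_linear_ident\<close>)

lemma smooth_section_fst: "smooth f \<Longrightarrow> smooth (\<lambda>y. f (y, \<eta>))"
  by (rule smooth_compose[where \<phi>="\<lambda>y. (y, \<eta>)"], assumption)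
    (use smooth_affine[of "\<lambda>y. (y, 0)" "(0,\<eta>)"] in \<open>simp add: bounded_linear_Pair bounded_linear_zero bounded_linear_ident\<close>)

lemma Basis_fst [simp]: "b \<in> Basis \<Longrightarrow> (b, 0) \<in> Basis"
  and Basis_snd [simp]: "c \<in> Basis \<Longrightarrow> (0, c) \<in> Basis"
  by (auto simp: Basis_prod_def)

lemma partial_deriv_section_snd: "partial_deriv b (\<lambda>\<eta>. f (y, \<eta>)) = (\<lambda>\<eta>. partial_deriv (0, b) f (y, \<eta>))"
  by (rule ext) (simp add: partial_deriv_def)

lemma partial_deriv_section_fst: "partial_deriv b (\<lambda>y. f (y, \<eta>)) = (\<lambda>y. partial_deriv (b, 0) f (y, \<eta>))"
  by (rule ext) (simp add: partial_deriv_def)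

lemma iter_partial_section_snd:
  "iter_partial bs (\<lambda>\<eta>. f (y, \<eta>)) = (\<lambda>\<eta>. iter_partial (map (Pair 0) bs) f (y, \<eta>))"
  by (induction bs) (auto simp: partial_deriv_section_snd)

lemma iter_partial_section_fst:
  "iter_partial bs (\<lambda>y. f (y, \<eta>)) = (\<lambda>y. iter_partial (map (\<lambda>b. (b, 0)) bs) f (y, \<eta>))"
  by (induction bs) (auto simp: partial_deriv_section_fst)

text \<open>Constants uniform over an index set \<open>I\<close>, so that estimates depending on parameters
  (\<open>x\<close>, \<open>\<xi>\<close>, \<open>\<epsilon>\<close>, \<open>t\<close>) can be read off by taking the parameters as index.\<close>
definition ubd :: "('a::euclidean_space \<Rightarrow> real) \<Rightarrow> 'i set \<Rightarrow> ('i \<Rightarrow> 'a \<Rightarrow> complex) \<Rightarrow> bool" where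
  "ubd w I f \<longleftrightarrow> (\<forall>x. 0 \<le> w x) \<and> (\<forall>i\<in>I. smooth (f i)) \<and>
    (\<forall>bs. set bs \<subseteq> Basis \<longrightarrow> (\<exists>C\<ge>0. \<forall>i\<in>I. \<forall>x. norm (iter_partial bs (f i) x) \<le> C * w x))"

lemma ubdI:
  assumes "\<And>x. 0 \<le> w x" "\<And>i. i \<in> I \<Longrightarrow> smooth (f i)"
    "\<And>bs. set bs \<subseteq> Basis \<Longrightarrow> \<exists>C. \<forall>i\<in>I. \<forall>x. norm (iter_partial bs (f i) x) \<le> C * w x"
  shows "ubd w I f"
proof -
  have "\<exists>C\<ge>0. \<forall>i\<in>I. \<forall>x. norm (iter_partial bs (f i) x) \<le> C * w x" if bs: "set bs \<subseteq> Basis" for bs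
  proof -
    obtain C where C: "\<forall>i\<in>I. \<forall>x. norm (iter_partial bs (f i) x) \<le> C * w x" using assms(3)[OF bs] by auto
    have "C * w x \<le> \<bar>C\<bar> * w x" for x by (intro mult_right_mono assms) auto
    then show ?thesis using C by (intro exI[of _ "\<bar>C\<bar>"]) (meson abs_ge_zero order_trans)
  qed
  then show ?thesis using assms by (auto simp: ubd_def)
qed

lemma ubd_smooth: "ubd w I f \<Longrightarrow> i \<in> I \<Longrightarrow> smooth (f i)"
  by (auto simp: ubd_def)

lemma ubd_weight: "ubd w I f \<Longrightarrow> 0 \<le> w x"
  by (auto simp: ubd_def)

lemma ubdE:
  assumes "ubd w I f" "set bs \<subseteq> Basis"
  obtains C where "C \<ge> 0" "\<And>i x. i \<in> I \<Longrightarrow> norm (iter_partial bs (f i) x) \<le> C * w x"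
  using assms unfolding ubd_def by metis

lemma ubdE0:
  assumes "ubd w I f"
  obtains C where "C \<ge> 0" "\<And>i x. i \<in> I \<Longrightarrow> norm (f i x) \<le> C * w x"
  using ubdE[OF assms, of "[]"] by auto

lemma ubd_cong:
  assumes "ubd w I f" "\<And>i. i \<in> I \<Longrightarrow> g i = f i"
  shows "ubd w I g"
  using assms by (simp add: ubd_def)

lemma ubd_reindex: "ubd w J f \<Longrightarrow> (\<And>i. i \<in> I \<Longrightarrow> h i \<in> J) \<Longrightarrow> ubd w I (\<lambda>i. f (h i))"
  unfolding ubd_def by (metis (no_types, lifting))

lemma ubd_weaken:
  assumes "ubd w I f" "\<And>x. w x \<le> K * v x" "\<And>x. 0 \<le> v x"
  shows "ubd v I f"
proof (rule ubdI[OF assms(3) ubd_smooth[OF assms(1)]])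
  fix bs :: "'a list" assume bs: "set bs \<subseteq> Basis"
  obtain C where C: "C \<ge> 0" "\<And>i x. i \<in> I \<Longrightarrow> norm (iter_partial bs (f i) x) \<le> C * w x"
    using ubdE[OF assms(1) bs] by blast
  have "C * w x \<le> C * K * v x" for x
    using mult_left_mono[OF assms(2) C(1)] by (simp add: mult.assoc)
  then show "\<exists>C. \<forall>i\<in>I. \<forall>x. norm (iter_partial bs (f i) x) \<le> C * v x"
    using C(2) by (meson order_trans)
qed

lemma ubd_partial:
  assumes "ubd w I f" "b \<in> Basis"
  shows "ubd w I (\<lambda>i. partial_deriv b (f i))"
proof (rule ubdI)
  fix bs :: "'a list" assume "set bs \<subseteq> Basis"
  then have "set (bs @ [b]) \<subseteq> Basis" using assms by auto
  then obtain C where "\<And>i x. i \<in> I \<Longrightarrow> norm (iter_partial (bs @ [b]) (f i) x) \<le> C * w x"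
    using ubdE[OF assms(1)] by metis
  then show "\<exists>C. \<forall>i\<in>I. \<forall>x. norm (iter_partial bs (partial_deriv b (f i)) x) \<le> C * w x" by auto
qed (use assms in \<open>auto intro: smooth_partial_deriv ubd_smooth ubd_weight\<close>)

lemma ubd_add:
  assumes "ubd w I f" "ubd w I g"
  shows "ubd w I (\<lambda>i x. f i x + g i x)"
proof (rule ubdI)
  fix bs :: "'a list" assume bs: "set bs \<subseteq> Basis"
  obtain C where C: "\<And>i x. i \<in> I \<Longrightarrow> norm (iter_partial bs (f i) x) \<le> C * w x" using ubdE[OF assms(1) bs] by metis
  obtain D where D: "\<And>i x. i \<in> I \<Longrightarrow> norm (iter_partial bs (g i) x) \<le> D * w x" using ubdE[OF assms(2) bs] by metis
  have "norm (iter_partial bs (\<lambda>x. f i x + g i x) x) \<le> (C + D) * w x" if i: "i \<in> I" for i x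
    unfolding iter_partial_add[OF ubd_smooth[OF assms(1) i] ubd_smooth[OF assms(2) i] bs] distrib_right
    by (rule norm_triangle_mono[OF C[OF i] D[OF i]])
  then show "\<exists>C. \<forall>i\<in>I. \<forall>x. norm (iter_partial bs (\<lambda>x. f i x + g i x) x) \<le> C * w x" by blast
qed (use assms in \<open>auto intro: smooth_add ubd_smooth ubd_weight\<close>)

lemma ubd_mult:
  assumes "ubd w I f" "ubd v I g"
  shows "ubd (\<lambda>x. w x * v x) I (\<lambda>i x. f i x * g i x)"
proof (rule ubdI)
  fix bs :: "'a list" assume bs: "set bs \<subseteq> Basis"
  then show "\<exists>C. \<forall>i\<in>I. \<forall>x. norm (iter_partial bs (\<lambda>x. f i x * g i x) x) \<le> C * (w x * v x)"
    using assms
  \<comment> \<open>Reverse induction peels off the derivative applied first, so that the Leibniz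
    rule acts on f and g themselves and the induction hypothesis on the two resulting
    products.\<close>
  proof (induction bs arbitrary: f g rule: rev_induct)
    case Nil
    obtain C where C: "C \<ge> 0" "\<And>i x. i \<in> I \<Longrightarrow> norm (f i x) \<le> C * w x" using ubdE0[OF Nil(2)] by metis
    obtain D where D: "D \<ge> 0" "\<And>i x. i \<in> I \<Longrightarrow> norm (g i x) \<le> D * v x" using ubdE0[OF Nil(3)] by metis
    have "norm (f i x * g i x) \<le> (C * w x) * (D * v x)" if "i \<in> I" for i x
      unfolding norm_mult using that C D ubd_weight[OF Nil(2), of x] by (intro mult_mono) auto
    then show ?case by (intro exI[of _ "C * D"]) (simp add: mult_ac)
  next
    case (snoc b bs)
    have b: "b \<in> Basis" "set bs \<subseteq> Basis" using snoc.prems by auto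
    obtain C where C: "\<And>i x. i \<in> I \<Longrightarrow> norm (iter_partial bs (\<lambda>x. partial_deriv b (f i) x * g i x) x) \<le> C * (w x * v x)"
      using snoc.IH[OF b(2) ubd_partial[OF snoc.prems(2) b(1)] snoc.prems(3)] by metis
    obtain D where D: "\<And>i x. i \<in> I \<Longrightarrow> norm (iter_partial bs (\<lambda>x. f i x * partial_deriv b (g i) x) x) \<le> D * (w x * v x)"
      using snoc.IH[OF b(2) snoc.prems(2) ubd_partial[OF snoc.prems(3) b(1)]] by metis
    have "norm (iter_partial (bs @ [b]) (\<lambda>x. f i x * g i x) x) \<le> (C + D) * (w x * v x)" if i: "i \<in> I" for i x
    proof -
      have sf: "smooth (f i)" "smooth (g i)" using snoc.prems i by (auto intro: ubd_smooth)
      have "iter_partial (bs @ [b]) (\<lambda>x. f i x * g i x) x =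
          iter_partial bs (\<lambda>x. partial_deriv b (f i) x * g i x) x + iter_partial bs (\<lambda>x. f i x * partial_deriv b (g i) x) x"
        by (simp add: partial_deriv_mult sf iter_partial_add smooth_mult smooth_partial_deriv b)
      also have "norm \<dots> \<le> (C + D) * (w x * v x)"
        unfolding distrib_right by (rule norm_triangle_mono[OF C[OF i] D[OF i]])
      finally show ?thesis .
    qed
    then show ?case by blast
  qed
qed (use assms in \<open>auto intro: smooth_mult ubd_smooth intro!: mult_nonneg_nonneg ubd_weight[OF assms(1)] ubd_weight[OF assms(2)]\<close>)

lemma ubd_const:
  assumes "\<And>i. i \<in> I \<Longrightarrow> norm (c i) \<le> C"
  shows "ubd (\<lambda>x::'a::euclidean_space. 1) I (\<lambda>i x. c i)"
proof (rule ubdI)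
  fix bs :: "'a list"
  have 0: "iter_partial bs (\<lambda>x. 0) = (\<lambda>x. 0 :: complex)" for bs :: "'a list"
    by (induction bs) (auto simp: partial_deriv_const)
  have "iter_partial bs (\<lambda>x. c i) = (\<lambda>x. if bs = [] then c i else 0)" for i
    by (induction bs rule: rev_induct) (auto simp: partial_deriv_const 0)
  then show "\<exists>C. \<forall>i\<in>I. \<forall>x. norm (iter_partial bs (\<lambda>x. c i) x) \<le> C * 1"
    using assms by (intro exI[of _ "\<bar>C\<bar>"]) force
qed auto

lemma ubd_cmult: "ubd w I f \<Longrightarrow> ubd w I (\<lambda>i x. c * f i x)"
  using ubd_mult[OF ubd_const[of I "\<lambda>_. c" "norm c"], of w f] by simp

lemma ubd_zero: "(\<And>x. 0 \<le> w x) \<Longrightarrow> ubd w I (\<lambda>i x. 0)"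
  using ubd_weaken[OF ubd_const[of I "\<lambda>_. 0" 0], of 1 "\<lambda>x. 1"]
  by (intro ubdI) (auto intro!: exI[of _ 0] simp: iter_partial_bounded_linear[of "\<lambda>_. 0", OF smooth_const bounded_linear_zero])

lemma ubd_sum:
  assumes "\<And>j. j \<in> A \<Longrightarrow> ubd w I (f j)" "\<And>x. 0 \<le> w x"
  shows "ubd w I (\<lambda>i x. \<Sum>j\<in>A. f j i x)"
  using assms by (induction A rule: infinite_finite_induct) (auto intro!: ubd_zero ubd_add)

lemma ubd_diff: "ubd w I f \<Longrightarrow> ubd w I g \<Longrightarrow> ubd w I (\<lambda>i x. f i x - g i x)"
  using ubd_add[OF _ ubd_cmult[of w I g "-1"], of f] by simp

text \<open>The operator 1 - \<Delta> in the directions B. For B = \<open>Basis\<close> the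
  exponential with frequency \<eta> is an eigenfunction with eigenvalue 1 + |\<eta>|^2, so powers of
  the operator trade derivatives for decay on the Fourier side.\<close>

definition helm :: "'a set \<Rightarrow> ('a::real_normed_vector \<Rightarrow> complex) \<Rightarrow> 'a \<Rightarrow> complex" where
  "helm B f x = f x - (\<Sum>e\<in>B. partial_deriv e (partial_deriv e f) x)"

lemma ubd_helm:
  assumes "ubd w I f" "B \<subseteq> Basis"
  shows "ubd w I (\<lambda>i. helm B (f i))"
  unfolding helm_def
  by (intro ubd_diff assms ubd_sum ubd_partial ubd_weight[OF assms(1)]) (use assms(2) in auto)

lemma ubd_helm_pow:
  assumes "ubd w I f" "B \<subseteq> Basis"
  shows "ubd w I (\<lambda>i. (helm B ^^ k) (f i))"
proof (induction k)
  case (Suc k)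
  show ?case using ubd_helm[OF Suc assms(2)] by simp
qed (use assms in simp)

lemma smooth_helm: "smooth f \<Longrightarrow> B \<subseteq> Basis \<Longrightarrow> smooth (helm B f)"
  unfolding helm_def by (intro smooth_diff smooth_sum smooth_partial_deriv) auto

lemma smooth_helm_pow: "smooth f \<Longrightarrow> B \<subseteq> Basis \<Longrightarrow> smooth ((helm B ^^ k) f)"
  by (induction k) (auto intro: smooth_helm)

section \<open>The bracket \<langle>x\<rangle> and Peetre's inequality\<close>

lemma jbracket_ge_1: "1 \<le> jbracket x"
  by (simp add: jbracket_def)

lemma jbracket_pos [simp]: "0 < jbracket x"
  using jbracket_ge_1[of x] by linarith

lemma jbracket_neq_0 [simp]: "jbracket x \<noteq> 0"
  using jbracket_pos[of x] by linarith

lemma jbracket_sq: "(jbracket x)\<^sup>2 = 1 + (norm x)\<^sup>2"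
  by (simp add: jbracket_def)

lemma norm_le_jbracket: "norm x \<le> jbracket x"
  unfolding jbracket_def by (rule real_le_rsqrt) simp

lemma jbracket_powr_mono: "s \<le> t \<Longrightarrow> jbracket x powr s \<le> jbracket x powr t"
  by (intro powr_mono jbracket_ge_1)

lemma continuous_on_jbracket [continuous_intros]: "continuous_on S f \<Longrightarrow> continuous_on S (\<lambda>x. jbracket (f x))"
  unfolding jbracket_def by (intro continuous_intros)

lemma continuous_on_jbracket_powr [continuous_intros]:
  "continuous_on S f \<Longrightarrow> continuous_on S (\<lambda>x. jbracket (f x) powr s)"
  by (intro continuous_intros ballI jbracket_neq_0)

lemma jbracket_add: "jbracket (x + y) \<le> 2 * jbracket x * jbracket y"
proof (rule power2_le_imp_le)
  have "(norm (x + y))\<^sup>2 \<le> (norm x + norm y)\<^sup>2"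
    by (intro power_mono norm_triangle_ineq) auto
  also have "\<dots> \<le> 2 * (norm x)\<^sup>2 + 2 * (norm y)\<^sup>2"
    using sum_squares_bound[of "norm x" "norm y"] by (simp add: power2_sum)
  finally have 1: "(norm (x + y))\<^sup>2 \<le> 2 * (norm x)\<^sup>2 + 2 * (norm y)\<^sup>2" .
  have 2: "0 \<le> (norm x)\<^sup>2 * (norm y)\<^sup>2" by simp
  have key: "1 + n \<le> 2\<^sup>2 * (1 + a) * (1 + b)" if "n \<le> 2 * a + 2 * b" "0 \<le> a" "0 \<le> b" "0 \<le> a * b" for a b n :: real
  proof -
    have "2\<^sup>2 * (1 + a) * (1 + b) = 4 + 4 * a + 4 * b + 4 * (a * b)" by (simp add: algebra_simps)
    then show ?thesis using that by linarith
  qed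
  show "(jbracket (x + y))\<^sup>2 \<le> (2 * jbracket x * jbracket y)\<^sup>2"
    unfolding power_mult_distrib jbracket_sq by (rule key[OF 1 _ _ 2]) auto
qed (simp add: less_imp_le)

lemma jbracket_minus [simp]: "jbracket (- x) = jbracket x"
  by (simp add: jbracket_def)

text \<open>For s \<ge> 0 this is a power of \<open>jbracket_add\<close>; for s < 0 the same
  estimate is applied to x = (x + y) - y and raised to a negative power.\<close>

lemma peetre_inequality:
  "jbracket (x + y) powr s \<le> 2 powr \<bar>s\<bar> * jbracket x powr s * jbracket y powr \<bar>s\<bar>"
proof (cases "s \<ge> 0")
  case True
  have "jbracket (x + y) powr s \<le> (2 * jbracket x * jbracket y) powr s"
    using True jbracket_add by (intro powr_mono2) (auto simp: less_imp_le)
  then show ?thesis using True by (simp add: powr_mult less_imp_le)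
next
  case False
  have "jbracket x \<le> 2 * jbracket (x + y) * jbracket y"
    using jbracket_add[of "x + y" "- y"] by simp
  then have "(2 * jbracket (x + y) * jbracket y) powr s \<le> jbracket x powr s"
    using False by (intro powr_mono2') auto
  then have "2 powr s * jbracket (x + y) powr s * jbracket y powr s \<le> jbracket x powr s"
    by (simp add: powr_mult less_imp_le)
  then have "jbracket (x + y) powr s \<le> jbracket x powr s / (2 powr s * jbracket y powr s)"
    by (subst pos_le_divide_eq) (auto simp: mult_ac)
  then show ?thesis using False by (simp add: powr_minus field_simps)
qed

text \<open>The inverse of the multiplier 1 + |x|^2 that \<open>helm\<close> produces under the
  Fourier transform.\<close>

definition wt :: "'a::euclidean_space \<Rightarrow> complex" where
  "wt x = complex_of_real (1 / (1 + x \<bullet> x))"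

lemma norm_wt: "norm (wt x) = jbracket x powr (-2)"
proof -
  have "0 < 1 + x \<bullet> x" using inner_ge_zero[of x] by linarith
  then have "norm (wt x) = inverse (1 + x \<bullet> x)"
    unfolding wt_def norm_of_real by (simp add: inverse_eq_divide)
  also have "\<dots> = inverse ((jbracket x)\<^sup>2)" by (simp add: jbracket_sq power2_norm_eq_inner)
  also have "\<dots> = jbracket x powr (-2)" by (simp add: powr_minus powr_numeral less_imp_le)
  finally show ?thesis .
qed

text \<open>Closed under differentiation, so that all derivatives of \<open>wt\<close> are controlled at once.\<close>
inductive rat :: "int \<Rightarrow> ('a::euclidean_space \<Rightarrow> complex) \<Rightarrow> bool" where
  rat_const: "rat 0 (\<lambda>x. c)"
| rat_coord: "rat 1 (\<lambda>x. complex_of_real (x \<bullet> v))"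
| rat_wt: "rat (-2) wt"
| rat_add: "rat d f \<Longrightarrow> rat d g \<Longrightarrow> rat d (\<lambda>x. f x + g x)"
| rat_mult: "rat d f \<Longrightarrow> rat e g \<Longrightarrow> rat (d + e) (\<lambda>x. f x * g x)"
| rat_weaken: "rat d f \<Longrightarrow> d \<le> e \<Longrightarrow> rat e f"

lemma rat_bound: "rat d f \<Longrightarrow> \<exists>C\<ge>0. \<forall>x. norm (f x) \<le> C * jbracket x powr d"
proof (induction rule: rat.induct)
  case (rat_const c)
  show ?case using jbracket_pos by (intro exI[of _ "norm c"]) auto
next
  case (rat_coord v)
  have "\<bar>x \<bullet> v\<bar> \<le> norm v * jbracket x" for x
    by (rule order_trans[OF Cauchy_Schwarz_ineq2]) (subst mult.commute, intro mult_left_mono norm_le_jbracket, simp)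
  then show ?case by (intro exI[of _ "norm v"]) (simp add: less_imp_le)
next
  case rat_wt
  show ?case by (intro exI[of _ 1]) (simp add: norm_wt)
next
  case (rat_add d f g)
  then obtain C D where "C \<ge> 0" "D \<ge> 0" and C: "\<And>x. norm (f x) \<le> C * jbracket x powr d" and D: "\<And>x. norm (g x) \<le> D * jbracket x powr d" by metis
  have "norm (f x + g x) \<le> (C + D) * jbracket x powr d" for x
    unfolding distrib_right by (rule norm_triangle_mono[OF C D])
  then show ?case using \<open>C \<ge> 0\<close> \<open>D \<ge> 0\<close> by (intro exI[of _ "C + D"]) auto
next
  case (rat_mult d f e g)
  then obtain C D where "C \<ge> 0" "D \<ge> 0" and C: "\<And>x. norm (f x) \<le> C * jbracket x powr d" and D: "\<And>x. norm (g x) \<le> D * jbracket x powr e" by metis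
  have "norm (f x * g x) \<le> (C * jbracket x powr d) * (D * jbracket x powr e)" for x
    unfolding norm_mult using \<open>C \<ge> 0\<close> \<open>D \<ge> 0\<close> C D by (intro mult_mono) auto
  then show ?case using \<open>C \<ge> 0\<close> \<open>D \<ge> 0\<close> by (intro exI[of _ "C * D"]) (auto simp: powr_add mult_ac)
next
  case (rat_weaken d f e)
  then obtain C where "C \<ge> 0" and C: "\<And>x. norm (f x) \<le> C * jbracket x powr d" by metis
  have "C * jbracket x powr d \<le> C * jbracket x powr e" for x
    using rat_weaken \<open>C \<ge> 0\<close> by (intro mult_left_mono jbracket_powr_mono) auto
  then show ?case using \<open>C \<ge> 0\<close> C by (meson order_trans)
qed

lemma rat_has_derivative:
  "rat d f \<Longrightarrow> \<exists>f'. (\<forall>x. (f has_derivative f' x) (at x)) \<and> (\<forall>v. rat d (\<lambda>x. f' x v))"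
proof (induction rule: rat.induct)
  case (rat_const c)
  show ?case by (intro exI[of _ "\<lambda>_ _. 0"]) (auto intro: rat.rat_const)
next
  case (rat_coord u)
  have "rat 1 (\<lambda>x. complex_of_real (v \<bullet> u))" for v by (rule rat_weaken[OF rat.rat_const]) simp
  moreover have "((\<lambda>x. complex_of_real (x \<bullet> u)) has_derivative (\<lambda>v. complex_of_real (v \<bullet> u))) (at x)" for x
    by (auto intro!: derivative_eq_intros)
  ultimately show ?case by (intro exI[of _ "\<lambda>x v. complex_of_real (v \<bullet> u)"]) auto
next
  case rat_wt
  let ?f' = "\<lambda>x v. - 2 * complex_of_real (x \<bullet> v) * (wt x * wt x)"
  have "(wt has_derivative ?f' x) (at x)" for x :: 'a
  proof -
    have pos: "1 + x \<bullet> x \<noteq> 0" using inner_ge_zero[of x] by linarith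
    have "((\<lambda>x. 1 / (1 + x \<bullet> x)) has_derivative (\<lambda>v. - (2 * (x \<bullet> v)) * (1 / (1 + x \<bullet> x) * (1 / (1 + x \<bullet> x))))) (at x)"
      using pos by (auto intro!: derivative_eq_intros simp: inner_commute field_simps)
    from has_derivative_of_real[OF this]
    have "(wt has_derivative (\<lambda>v. complex_of_real (- (2 * (x \<bullet> v)) * (1 / (1 + x \<bullet> x) * (1 / (1 + x \<bullet> x)))))) (at x)"
      unfolding wt_def[abs_def] .
    then show ?thesis by (rule has_derivative_eq_rhs) (auto simp: wt_def)
  qed
  \<comment> \<open>The derivative has degree -3; it is weakened to -2 because the classes only have
    to be stable under derivatives, not to record a gain.\<close>
  moreover have "rat (-2) (\<lambda>x. ?f' x v)" for v
    by (rule rat_weaken[of "(0 + 1) + (-2 + -2)"]) (intro rat.intros, simp)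
  ultimately show ?case by (intro exI[of _ ?f']) auto
next
  case (rat_add d f g)
  then obtain f' g' where "\<And>x. (f has_derivative f' x) (at x)" "\<And>v. rat d (\<lambda>x. f' x v)"
    "\<And>x. (g has_derivative g' x) (at x)" "\<And>v. rat d (\<lambda>x. g' x v)" by metis
  then show ?case
    by (intro exI[of _ "\<lambda>x v. f' x v + g' x v"] conjI allI has_derivative_add rat.rat_add) auto
next
  case (rat_mult d f e g)
  then obtain f' g' where "\<And>x. (f has_derivative f' x) (at x)" "\<And>v. rat d (\<lambda>x. f' x v)"
    "\<And>x. (g has_derivative g' x) (at x)" "\<And>v. rat e (\<lambda>x. g' x v)" by metis
  then show ?case using rat_mult.hyps
    by (intro exI[of _ "\<lambda>x v. f x * g' x v + f' x v * g x"] conjI allI has_derivative_mult rat.rat_add rat.rat_mult) auto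
next
  case (rat_weaken d f e)
  then show ?case by (meson rat.rat_weaken)
qed

lemma rat_partial: "rat d f \<Longrightarrow> rat d (partial_deriv b f)"
proof -
  assume "rat d f"
  then obtain f' where f': "\<And>x. (f has_derivative f' x) (at x)" "\<And>v. rat d (\<lambda>x. f' x v)"
    using rat_has_derivative by metis
  have "partial_deriv b f = (\<lambda>x. f' x b)" by (rule ext, rule partial_deriv_has_derivative[OF f'(1)])
  then show ?thesis using f'(2) by simp
qed

lemma rat_smooth: "rat d f \<Longrightarrow> smooth f"
proof (rule smooth_coinduct[where X="{f. rat d f}"])
  fix f :: "'a \<Rightarrow> complex" assume "f \<in> {f. rat d f}"
  then obtain f' where f': "\<And>x. (f has_derivative f' x) (at x)" using rat_has_derivative by blast
  show "continuous_on UNIV f"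
    by (intro continuous_at_imp_continuous_on ballI) (rule has_derivative_continuous[OF f'])
  show "(\<lambda>t::real. f (x + t *\<^sub>R b)) differentiable at 0" for x b
    by (rule has_derivative_imp_differentiable_dir[OF f'])
qed (auto intro: rat_partial)

lemma rat_ubd:
  assumes "rat d f" shows "ubd (\<lambda>x. jbracket x powr d) I (\<lambda>i. f)"
proof (rule ubdI)
  fix bs :: "'a list"
  have "rat d (iter_partial bs f)" by (induction bs) (auto intro: rat_partial assms)
  from rat_bound[OF this] show "\<exists>C. \<forall>i\<in>I. \<forall>x. norm (iter_partial bs f x) \<le> C * jbracket x powr d" by auto
qed (use assms in \<open>auto intro: rat_smooth\<close>)

lemma rat_wt_pow: "rat (- 2 * int k) (\<lambda>x. wt x ^ k)"
proof (induction k)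
  case 0
  then show ?case using rat.rat_const[of 1] by simp
next
  case (Suc k)
  then show ?case using rat.rat_mult[OF rat.rat_wt Suc] by (simp add: algebra_simps)
qed

lemma ubd_wt_pow: "ubd (\<lambda>x. jbracket x powr (- 2 * real k)) I (\<lambda>i x. wt x ^ k)"
  using rat_ubd[OF rat_wt_pow] by simp

section \<open>Integration by parts and the Fourier transform\<close>

lemma
  fixes f :: "'a::euclidean_space \<Rightarrow> real \<Rightarrow> 'c::{real_normed_field,banach,second_countable_topology}"
  assumes int: "\<And>b. b \<in> Basis \<Longrightarrow> integrable lborel (f b)"
  shows lborel_integral_prod: "(LINT x|lborel. (\<Prod>b\<in>Basis. f b (x \<bullet> b))) = (\<Prod>b\<in>Basis. integral\<^sup>L lborel (f b))"
    and lborel_integrable_prod: "integrable lborel (\<lambda>x. \<Prod>b\<in>Basis. f b (x \<bullet> b))"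
proof -
  interpret product_sigma_finite "\<lambda>_::'a. lborel :: real measure" by standard
  have [measurable]: "b \<in> Basis \<Longrightarrow> f b \<in> borel_measurable borel" for b using int by auto
  have m: "(\<lambda>x. \<Prod>b\<in>Basis. f b (x \<bullet> b)) \<in> borel_measurable borel" by measurable
  have s: "(\<lambda>f. \<Sum>b\<in>Basis. f b *\<^sub>R b) \<in> measurable (\<Pi>\<^sub>M b\<in>(Basis::'a set). (lborel :: real measure)) borel"
    by measurable
  have e: "(\<Prod>b\<in>Basis. f b ((\<Sum>c\<in>Basis. g c *\<^sub>R c) \<bullet> b)) = (\<Prod>b\<in>Basis. f b (g b))" for g :: "'a \<Rightarrow> real"
    by (intro prod.cong) auto
  show "(LINT x|lborel. (\<Prod>b\<in>Basis. f b (x \<bullet> b))) = (\<Prod>b\<in>Basis. integral\<^sup>L lborel (f b))"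
    unfolding lborel_eq[where 'a='a] integral_distr[OF s m] e
    by (intro product_integral_prod) (auto intro: int)
  show "integrable lborel (\<lambda>x. \<Prod>b\<in>Basis. f b (x \<bullet> b))"
    unfolding lborel_eq[where 'a='a] integrable_distr_eq[OF s m] e
    by (intro product_integrable_prod) (auto intro: int)
qed

lemma lborel_integral_affine:
  fixes f :: "'a::euclidean_space \<Rightarrow> 'b::{banach,second_countable_topology}"
  assumes [measurable]: "f \<in> borel_measurable borel" and c: "c \<noteq> 0"
  shows "integral\<^sup>L lborel f = \<bar>c\<bar> ^ DIM('a) *\<^sub>R (LINT x|lborel. f (t + c *\<^sub>R x))"
proof -
  have "integral\<^sup>L lborel f = integral\<^sup>L (density (distr lborel borel (\<lambda>x. t + c *\<^sub>R x)) (\<lambda>_. ennreal (\<bar>c\<bar> ^ DIM('a)))) f"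
    using lborel_affine[OF c, of t] by simp
  also have "\<dots> = (LINT x|distr lborel borel (\<lambda>x. t + c *\<^sub>R x). \<bar>c\<bar> ^ DIM('a) *\<^sub>R f x)"
    by (rule integral_density) auto
  also have "\<dots> = (LINT x|lborel. \<bar>c\<bar> ^ DIM('a) *\<^sub>R f (t + c *\<^sub>R x))"
    by (rule integral_distr) measurable
  finally show ?thesis by simp
qed

lemma lborel_integral_translate:
  fixes f :: "'a::euclidean_space \<Rightarrow> 'b::{banach,second_countable_topology}"
  assumes "f \<in> borel_measurable borel"
  shows "(LINT x|lborel. f (t + x)) = integral\<^sup>L lborel f"
  using lborel_integral_affine[OF assms, of 1 t] by simp

lemma lborel_integrable_translate:
  fixes f :: "'a::euclidean_space \<Rightarrow> 'b::{banach,second_countable_topology}"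
  assumes f: "integrable lborel f"
  shows "integrable lborel (\<lambda>x. f (t + x))"
proof -
  have m: "f \<in> borel_measurable borel" using f by auto
  have "integrable (density (distr lborel borel (\<lambda>x. t + 1 *\<^sub>R x)) (\<lambda>_. ennreal (\<bar>1\<bar> ^ DIM('a)))) f"
    using lborel_affine[of 1 t] f by simp
  then have "integrable (distr lborel borel (\<lambda>x. t + x)) f"
    by (simp add: density_1)
  then show ?thesis by (subst (asm) integrable_distr_eq) (use m in measurable)
qed

lemma jbracket_powr_even: "jbracket x powr (2 * real k) = ((jbracket x)\<^sup>2) ^ k"
  using powr_realpow[OF jbracket_pos[of x], of "2 * k"] by (simp add: power_mult)

text \<open>With n the dimension, \<langle>x\<rangle>^(-2n) is a product of n factors
  \<langle>x\<rangle>^(-2), each below 1/(1 + x_b^2), so the one-dimensional integral of 1/(1 + t^2)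
  suffices. This is the origin of the threshold -2n used throughout.\<close>

lemma integrable_jbracket:
  assumes "s \<le> - 2 * real DIM('a)"
  shows "integrable lborel (\<lambda>x::'a::euclidean_space. jbracket x powr s)"
proof (rule Bochner_Integration.integrable_bound)
  have "integrable lborel (\<lambda>x::real. inverse (1 + x\<^sup>2))"
    using integrable_inverse_1_plus_square by (simp add: set_integrable_def)
  then show "integrable lborel (\<lambda>x::'a. \<Prod>b\<in>Basis. inverse (1 + (x \<bullet> b)\<^sup>2))"
    by (intro lborel_integrable_prod)
  show "(\<lambda>x::'a. jbracket x powr s) \<in> borel_measurable lborel"
    by (simp, intro borel_measurable_continuous_onI continuous_intros)
  show "AE x::'a in lborel. norm (jbracket x powr s) \<le> norm (\<Prod>b\<in>Basis. inverse (1 + (x \<bullet> b)\<^sup>2))"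
  proof (rule AE_I2)
    fix x :: 'a
    have pos: "0 < 1 + (x \<bullet> b)\<^sup>2" for b by (simp add: add_pos_nonneg)
    have "jbracket x powr s \<le> jbracket x powr (- 2 * real DIM('a))"
      by (rule jbracket_powr_mono[OF assms])
    also have "\<dots> = (\<Prod>b\<in>(Basis::'a set). inverse ((jbracket x)\<^sup>2))"
      using jbracket_powr_even[of x "DIM('a)"] by (simp add: powr_minus power_inverse)
    also have "\<dots> \<le> (\<Prod>b\<in>Basis. inverse (1 + (x \<bullet> b)\<^sup>2))"
    proof (intro prod_mono conjI le_imp_inverse_le pos)
      fix b :: 'a assume "b \<in> Basis"
      then have "\<bar>x \<bullet> b\<bar> \<le> \<bar>norm x\<bar>" by (simp add: Basis_le_norm)
      then show "1 + (x \<bullet> b)\<^sup>2 \<le> (jbracket x)\<^sup>2" unfolding jbracket_sq abs_le_square_iff by simp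
    qed auto
    finally show "norm (jbracket x powr s) \<le> norm (\<Prod>b\<in>Basis. inverse (1 + (x \<bullet> b)\<^sup>2))"
      using prod_nonneg[of Basis "\<lambda>b. inverse (1 + (x \<bullet> b)\<^sup>2)"] pos by (simp add: less_imp_le)
  qed
qed

lemma integrable_continuous_bound:
  fixes f :: "'a::euclidean_space \<Rightarrow> complex"
  assumes "continuous_on UNIV f" "integrable lborel g" "\<And>x. norm (f x) \<le> g x"
  shows "integrable lborel f"
  using assms(2)
  by (rule Bochner_Integration.integrable_bound)
    (use assms in \<open>auto intro!: borel_measurable_continuous_onI order_trans[OF _ abs_ge_self]\<close>)

lemma integrable_prod_bound:
  fixes f :: "'a::euclidean_space \<times> 'b::euclidean_space \<Rightarrow> complex"
  assumes f: "f \<in> borel_measurable borel" and g: "integrable lborel g" and h: "integrable lborel h"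
    and b: "\<And>x y. norm (f (x, y)) \<le> g x * h y"
  shows "integrable (lborel \<Otimes>\<^sub>M lborel) f"
proof (rule Bochner_Integration.integrable_bound)
  have [measurable]: "g \<in> borel_measurable borel" "h \<in> borel_measurable borel" using g h by auto
  show "integrable (lborel \<Otimes>\<^sub>M lborel) (\<lambda>p. g (fst p) * h (snd p))"
  proof (rule lborel_pair.Fubini_integrable)
    show "(\<lambda>p. g (fst p) * h (snd p)) \<in> borel_measurable (lborel \<Otimes>\<^sub>M lborel)" by measurable
    show "integrable lborel (\<lambda>x. LINT y|lborel. norm (g (fst (x, y)) * h (snd (x, y))))"
      using g h by (simp add: abs_mult)
    show "AE x in lborel. integrable lborel (\<lambda>y. g (fst (x, y)) * h (snd (x, y)))"
      using h by simp
  qed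
  show "f \<in> borel_measurable (lborel \<Otimes>\<^sub>M lborel)" using f by (simp add: lborel_prod)
  show "AE p in lborel \<Otimes>\<^sub>M lborel. norm (f p) \<le> norm (g (fst p) * h (snd p))"
    using b by (auto intro!: AE_I2 order_trans[OF _ abs_ge_self])
qed

text \<open>Integrate \<open>f(x + b) - f(x) = \<integral>\<^sub>0\<^sup>1 \<partial>\<^sub>b f(x + sb) ds\<close> over \<open>x\<close> and use translation invariance.\<close>
lemma integral_partial_deriv_zero:
  fixes f :: "'a::euclidean_space \<Rightarrow> complex"
  assumes f: "smooth f" and b: "b \<in> Basis"
    and int: "integrable lborel f" "integrable lborel (partial_deriv b f)"
  shows "integral\<^sup>L lborel (partial_deriv b f) = 0"
proof -
  let ?D = "partial_deriv b f"
  have cD: "continuous_on UNIV ?D" by (intro smooth_continuous smooth_partial_deriv f b)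
  have mD [measurable]: "?D \<in> borel_measurable borel" using cD by (rule borel_measurable_continuous_onI)
  have mf: "f \<in> borel_measurable borel" using int by auto
  have shift: "(LINT x|lborel. h (x + t)) = integral\<^sup>L lborel h" if "h \<in> borel_measurable borel" for h :: "'a \<Rightarrow> complex" and t
    using lborel_integral_translate[OF that, of t] by (simp add: add.commute)
  have shiftn: "(LINT x|lborel. norm (?D (x + t))) = (LINT x|lborel. norm (?D x))" for t
    using lborel_integral_translate[of "\<lambda>x. norm (?D x)" t] by (simp add: add.commute)
  have shifti: "integrable lborel (\<lambda>x. h (x + t))" if "integrable lborel h" for h :: "'a \<Rightarrow> complex" and t
    using lborel_integrable_translate[OF that, of t] by (simp add: add.commute)
  have 1: "(LINT s|lborel. indicator {0..1} s *\<^sub>R ?D (x + s *\<^sub>R b)) = f (x + b) - f x" for x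
  proof -
    have "(LINT s|lborel. indicator {0..1} s *\<^sub>R ?D (x + s *\<^sub>R b)) = f (x + 1 *\<^sub>R b) - f (x + 0 *\<^sub>R b)"
    proof (rule integral_FTC_Icc)
      show "((\<lambda>t. f (x + t *\<^sub>R b)) has_vector_derivative ?D (x + s *\<^sub>R b)) (at s within {0..1})" for s
        by (rule has_vector_derivative_at_within[OF smooth_has_vector_derivative[OF f b]])
      show "continuous_on {0..1} (\<lambda>s. ?D (x + s *\<^sub>R b))"
        by (rule continuous_on_compose2[OF cD]) (auto intro!: continuous_intros)
    qed auto
    then show ?thesis by simp
  qed
  \<comment> \<open>Translation invariance makes the x-integral of the norm independent of s, which
    gives integrability over the strip.\<close>
  have int2: "integrable (lborel \<Otimes>\<^sub>M lborel) (\<lambda>(s, x). indicator {0..1} s *\<^sub>R ?D (x + s *\<^sub>R b))"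
  proof (rule lborel_pair.Fubini_integrable)
    show "(\<lambda>(s, x). indicator {0..1} s *\<^sub>R ?D (x + s *\<^sub>R b)) \<in> borel_measurable (lborel \<Otimes>\<^sub>M lborel)"
      by measurable
    show "integrable lborel (\<lambda>s::real. LINT x|lborel. norm (case (s, x) of (s, x) \<Rightarrow> indicator {0..1} s *\<^sub>R ?D (x + s *\<^sub>R b)))"
      by (simp add: shiftn)
    show "AE s::real in lborel. integrable lborel (\<lambda>x. case (s, x) of (s, x) \<Rightarrow> indicator {0..1} s *\<^sub>R ?D (x + s *\<^sub>R b))"
      by (auto intro!: shifti int)
  qed
  have "0 = (LINT x|lborel. f (x + b)) - (LINT x|lborel. f x)" using shift[OF mf] by simp
  also have "\<dots> = (LINT x|lborel. f (x + b) - f x)"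
    by (rule Bochner_Integration.integral_diff[symmetric]) (intro shifti int)+
  also have "\<dots> = (LINT x|lborel. LINT s|lborel. indicator {0..1} s *\<^sub>R ?D (x + s *\<^sub>R b))" by (simp add: 1)
  also have "\<dots> = (LINT s|lborel. LINT x|lborel. indicator {0..1} s *\<^sub>R ?D (x + s *\<^sub>R b))"
    by (rule lborel_pair.Fubini_integral[OF int2])
  also have "\<dots> = (LINT s|lborel. indicator {0..1::real} s *\<^sub>R integral\<^sup>L lborel ?D)"
    by (simp add: shift)
  also have "\<dots> = integral\<^sup>L lborel ?D"
    by simp
  finally show ?thesis by simp
qed

section \<open>The Fourier transform: derivatives and decay\<close>

lemma smooth_cexp: "smooth (\<lambda>x::'a::euclidean_space. exp (- \<i> * complex_of_real (x \<bullet> y)))"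
  and partial_deriv_cexp: "partial_deriv b (\<lambda>x. exp (- \<i> * complex_of_real (x \<bullet> y))) =
    (\<lambda>x::'a::euclidean_space. - \<i> * complex_of_real (b \<bullet> y) * exp (- \<i> * complex_of_real (x \<bullet> y)))"
proof -
  have D: "((\<lambda>x. c * exp (- \<i> * complex_of_real (x \<bullet> y))) has_derivative
      (\<lambda>v. c * (- \<i> * complex_of_real (v \<bullet> y)) * exp (- \<i> * complex_of_real (x \<bullet> y)))) (at x)" for c x
  proof -
    have "((\<lambda>x. - \<i> * complex_of_real (x \<bullet> y)) has_derivative (\<lambda>v. - \<i> * complex_of_real (v \<bullet> y))) (at x)"
      by (intro has_derivative_mult_right has_derivative_of_real bounded_linear_imp_has_derivative bounded_linear_inner_left)
    from has_derivative_mult_right[OF has_derivative_compose[OF this DERIV_exp[unfolded has_field_derivative_def]], of c] show ?thesis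
      by (rule has_derivative_eq_rhs) (simp add: fun_eq_iff)
  qed
  have P: "partial_deriv b (\<lambda>x. c * exp (- \<i> * complex_of_real (x \<bullet> y))) =
     (\<lambda>x. c * (- \<i> * complex_of_real (b \<bullet> y)) * exp (- \<i> * complex_of_real (x \<bullet> y)))" for b c
    by (rule ext) (rule partial_deriv_has_derivative[OF D])
  show "partial_deriv b (\<lambda>x. exp (- \<i> * complex_of_real (x \<bullet> y))) =
      (\<lambda>x. - \<i> * complex_of_real (b \<bullet> y) * exp (- \<i> * complex_of_real (x \<bullet> y)))"
    using P[of b 1] by simp
  let ?X = "range (\<lambda>c (x::'a). c * exp (- \<i> * complex_of_real (x \<bullet> y)))"
  have "smooth (\<lambda>x::'a. 1 * exp (- \<i> * complex_of_real (x \<bullet> y)))"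
  proof (rule smooth_coinduct[where X="?X"])
    fix f :: "'a \<Rightarrow> complex" assume "f \<in> ?X"
    then obtain c where f: "f = (\<lambda>x. c * exp (- \<i> * complex_of_real (x \<bullet> y)))" by auto
    show "continuous_on UNIV f" unfolding f by (intro continuous_intros)
    show "(\<lambda>t::real. f (x + t *\<^sub>R b)) differentiable at 0" for x b
      unfolding f by (rule has_derivative_imp_differentiable_dir[OF D])
    show "partial_deriv b f \<in> ?X" for b
    proof -
      define d where "d = c * (- \<i> * complex_of_real (b \<bullet> y))"
      have "partial_deriv b f = (\<lambda>x. c * (- \<i> * complex_of_real (b \<bullet> y)) * exp (- \<i> * complex_of_real (x \<bullet> y)))"
        unfolding f by (rule P)
      also have "\<dots> \<in> ?X" unfolding d_def[symmetric] by blast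
      finally show ?thesis .
    qed
  qed blast
  then show "smooth (\<lambda>x::'a. exp (- \<i> * complex_of_real (x \<bullet> y)))" by simp
qed

lemma norm_cexp [simp]: "norm (exp (- \<i> * complex_of_real t)) = 1" "norm (exp (- (\<i> * complex_of_real t))) = 1"
  using norm_exp_i_times[of "-t"] by simp_all

lemma fourier_norm_le: "norm (fourier g y) \<le> (LINT x|lborel. norm (g x))"
  unfolding fourier_def
  by (rule order_trans[OF integral_norm_bound]) (simp add: norm_mult)

lemma integrable_cexp_mult:
  assumes "integrable lborel (g :: 'a::euclidean_space \<Rightarrow> complex)"
  shows "integrable lborel (\<lambda>x. exp (- \<i> * complex_of_real (x \<bullet> y)) * g x)"
proof (rule Bochner_Integration.integrable_bound[OF assms])
  have [measurable]: "g \<in> borel_measurable borel" using assms by auto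
  show "(\<lambda>x. exp (- \<i> * complex_of_real (x \<bullet> y)) * g x) \<in> borel_measurable lborel"
    by measurable
qed (simp add: norm_mult)

lemma fourier_measurable [measurable]:
  assumes [measurable]: "g \<in> borel_measurable borel"
  shows "fourier g \<in> borel_measurable borel"
  unfolding fourier_def by measurable

lemma fourier_continuous:
  assumes "integrable lborel g"
  shows "continuous_on UNIV (fourier g)"
proof (rule continuous_on_sequentiallyI)
  fix u :: "nat \<Rightarrow> real^'a" and a assume u: "u \<longlonglongrightarrow> a"
  have [measurable]: "g \<in> borel_measurable borel" using assms by auto
  show "(\<lambda>n. fourier g (u n)) \<longlonglongrightarrow> fourier g a"
    unfolding fourier_def
  proof (rule integral_dominated_convergence[where w="\<lambda>x. norm (g x)"])
    show "AE x in lborel. (\<lambda>i. exp (- \<i> * complex_of_real (x \<bullet> u i)) * g x) \<longlonglongrightarrow> exp (- \<i> * complex_of_real (x \<bullet> a)) * g x"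
      by (intro AE_I2 tendsto_intros u)
  qed (use assms in \<open>auto simp: norm_mult\<close>)
qed

lemma fourier_partial:
  fixes g :: "real^'n \<Rightarrow> complex"
  assumes g: "smooth g" and b: "b \<in> Basis"
    and int: "integrable lborel g" "integrable lborel (partial_deriv b g)"
  shows "fourier (partial_deriv b g) y = \<i> * complex_of_real (y \<bullet> b) * fourier g y"
proof -
  let ?e = "\<lambda>x. exp (- \<i> * complex_of_real (x \<bullet> y))"
  have D: "partial_deriv b (\<lambda>x. ?e x * g x) = (\<lambda>x. - (\<i> * complex_of_real (b \<bullet> y)) * (?e x * g x) + ?e x * partial_deriv b g x)"
    unfolding partial_deriv_mult[OF smooth_cexp g] partial_deriv_cexp by (simp add: fun_eq_iff)
  have i1: "integrable lborel (\<lambda>x. ?e x * g x)" "integrable lborel (\<lambda>x. ?e x * partial_deriv b g x)"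
    by (intro integrable_cexp_mult int)+
  have "0 = integral\<^sup>L lborel (partial_deriv b (\<lambda>x. ?e x * g x))"
    by (rule integral_partial_deriv_zero[symmetric, OF smooth_mult[OF smooth_cexp g] b i1(1)])
      (unfold D, intro Bochner_Integration.integrable_add integrable_mult_right i1)
  also have "\<dots> = - (\<i> * complex_of_real (b \<bullet> y)) * fourier g y + fourier (partial_deriv b g) y"
    unfolding D fourier_def
    by (subst Bochner_Integration.integral_add, intro integrable_mult_right i1, rule i1) simp
  finally show ?thesis by (simp add: inner_commute)
qed

lemma ubd_integrable:
  assumes "ubd (\<lambda>x. jbracket x powr s) I g" "i \<in> I" "s \<le> - 2 * real DIM('a)"
  shows "integrable lborel (g i :: 'a::euclidean_space \<Rightarrow> complex)"
proof -
  obtain C where "\<And>i x. i \<in> I \<Longrightarrow> norm (g i x) \<le> C * jbracket x powr s" using ubdE0[OF assms(1)] by metis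
  then show ?thesis using assms
    by (intro integrable_continuous_bound[of _ "\<lambda>x. C * jbracket x powr s"])
      (auto intro!: integrable_jbracket smooth_continuous ubd_smooth[OF assms(1)])
qed

lemma fourier_partial_ubd:
  fixes g :: "'i \<Rightarrow> real^'n \<Rightarrow> complex"
  assumes "ubd (\<lambda>x. jbracket x powr s) I g" "i \<in> I" "s \<le> - 2 * real CARD('n)" "b \<in> Basis"
  shows "fourier (partial_deriv b (g i)) y = \<i> * complex_of_real (y \<bullet> b) * fourier (g i) y"
  using assms
  by (intro fourier_partial ubd_smooth[OF assms(1)] ubd_integrable[OF assms(1)] ubd_integrable[OF ubd_partial[OF assms(1)]]) auto

lemma fourier_helm:
  fixes g :: "'i \<Rightarrow> real^'n \<Rightarrow> complex"
  assumes u: "ubd (\<lambda>x. jbracket x powr s) I g" and i: "i \<in> I" and s: "s \<le> - 2 * real CARD('n)"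
  shows "fourier (helm Basis (g i)) y = complex_of_real (1 + y \<bullet> y) * fourier (g i) y"
proof -
  let ?e = "\<lambda>x. exp (- \<i> * complex_of_real (x \<bullet> y))"
  have 1: "integrable lborel (\<lambda>x. ?e x * g i x)"
    by (intro integrable_cexp_mult ubd_integrable[OF u i]) (use s in simp)
  have 2: "integrable lborel (\<lambda>x. ?e x * partial_deriv b (partial_deriv b (g i)) x)" if "b \<in> Basis" for b
    by (intro integrable_cexp_mult ubd_integrable[OF ubd_partial[OF ubd_partial[OF u]]] that i) (use s in simp)
  have "fourier (helm Basis (g i)) y = (LINT x|lborel. ?e x * g i x - (\<Sum>b\<in>Basis. ?e x * partial_deriv b (partial_deriv b (g i)) x))"
    unfolding fourier_def helm_def by (simp add: right_diff_distrib sum_distrib_left)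
  also have "\<dots> = fourier (g i) y - (\<Sum>b\<in>Basis. fourier (partial_deriv b (partial_deriv b (g i))) y)"
    unfolding fourier_def
    by (subst Bochner_Integration.integral_diff, rule 1, intro Bochner_Integration.integrable_sum 2, assumption)
      (simp only: Bochner_Integration.integral_sum[OF 2])
  also have "(\<Sum>b\<in>Basis. fourier (partial_deriv b (partial_deriv b (g i))) y) = (\<Sum>b\<in>Basis. - complex_of_real ((y \<bullet> b) * (y \<bullet> b)) * fourier (g i) y)"
    by (intro sum.cong refl) (simp add: fourier_partial_ubd[OF ubd_partial[OF u] i s] fourier_partial_ubd[OF u i s] algebra_simps)
  also have "\<dots> = - complex_of_real (y \<bullet> y) * fourier (g i) y"
    by (subst (3) euclidean_inner) (simp add: sum_distrib_right sum_negf)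
  finally show ?thesis by (simp add: algebra_simps)
qed

lemma fourier_helm_pow:
  fixes g :: "'i \<Rightarrow> real^'n \<Rightarrow> complex"
  assumes u: "ubd (\<lambda>x. jbracket x powr s) I g" and i: "i \<in> I" and s: "s \<le> - 2 * real CARD('n)"
  shows "fourier ((helm Basis ^^ l) (g i)) y = complex_of_real (1 + y \<bullet> y) ^ l * fourier (g i) y"
proof (induction l)
  case (Suc l)
  show ?case
    using fourier_helm[OF ubd_helm_pow[OF u order_refl] i s, of l y] Suc by simp
qed simp

text \<open>(1 + |y|^2)^l times the transform is the transform of (1 - \<Delta>)^l g, hence bounded
  by an L^1 norm. The common majorant of the family makes C independent of i, and l is
  arbitrary.\<close>

lemma fourier_decay:
  fixes g :: "'i \<Rightarrow> real^'n \<Rightarrow> complex"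
  assumes u: "ubd (\<lambda>x. jbracket x powr s) I g" and s: "s \<le> - 2 * real CARD('n)"
  shows "\<exists>C\<ge>0. \<forall>i\<in>I. \<forall>y. norm (fourier (g i) y) \<le> C * jbracket y powr (- 2 * real l)"
proof -
  have u': "ubd (\<lambda>x. jbracket x powr s) I (\<lambda>i. (helm Basis ^^ l) (g i))" by (rule ubd_helm_pow[OF u order_refl])
  obtain C where C: "C \<ge> 0" "\<And>i x. i \<in> I \<Longrightarrow> norm ((helm Basis ^^ l) (g i) x) \<le> C * jbracket x powr s"
    using ubdE0[OF u'] by metis
  define K where "K = C * (LINT x|lborel. jbracket (x::real^'n) powr s)"
  have K: "K \<ge> 0" unfolding K_def using C by simp
  have "norm (fourier (g i) y) \<le> K * jbracket y powr (- 2 * real l)" if i: "i \<in> I" for i y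
  proof -
    have "norm (fourier ((helm Basis ^^ l) (g i)) y) \<le> (LINT x|lborel. norm ((helm Basis ^^ l) (g i) x))"
      by (rule fourier_norm_le)
    also have "\<dots> \<le> (LINT x::real^'n|lborel. C * jbracket x powr s)"
    proof (rule Bochner_Integration.integral_mono)
      show "integrable lborel (\<lambda>x. norm ((helm Basis ^^ l) (g i) x))"
        using s by (intro integrable_norm ubd_integrable[OF u' i]) simp
      show "integrable lborel (\<lambda>x::real^'n. C * jbracket x powr s)"
        using s by (intro integrable_mult_right integrable_jbracket) simp
    qed (rule C(2)[OF i])
    finally have "norm (fourier ((helm Basis ^^ l) (g i)) y) \<le> K" by (simp add: K_def)
    moreover have "norm (fourier ((helm Basis ^^ l) (g i)) y) = jbracket y powr (2 * real l) * norm (fourier (g i) y)"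
    proof -
      have "0 \<le> 1 + y \<bullet> y" using inner_ge_zero[of y] by linarith
      then have "norm (complex_of_real (1 + y \<bullet> y) ^ l) = ((jbracket y)\<^sup>2) ^ l"
        unfolding norm_power norm_of_real jbracket_sq by (simp add: power2_norm_eq_inner)
      also have "\<dots> = jbracket y powr (2 * real l)" by (rule jbracket_powr_even[symmetric])
      finally show ?thesis unfolding fourier_helm_pow[OF u i s] norm_mult by simp
    qed
    ultimately have "norm (fourier (g i) y) * jbracket y powr (2 * real l) \<le> K" by (simp add: mult.commute)
    then have "norm (fourier (g i) y) \<le> K / jbracket y powr (2 * real l)"
      by (subst pos_le_divide_eq) auto
    then show ?thesis by (simp add: powr_minus divide_inverse)
  qed
  then show ?thesis using K by blast
qed

section \<open>Fourier inversion\<close>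

definition gauss :: "'a::euclidean_space \<Rightarrow> complex" where
  "gauss x = complex_of_real (exp (- (x \<bullet> x) / 2))"

lemma gauss_prod: "gauss x = (\<Prod>b\<in>Basis. complex_of_real (exp (- (x \<bullet> b)\<^sup>2 / 2)))"
proof -
  have "- (x \<bullet> x) / 2 = (\<Sum>b\<in>Basis. - (x \<bullet> b)\<^sup>2 / 2)"
    by (subst euclidean_inner) (simp add: sum_negf sum_divide_distrib power2_eq_square)
  then show ?thesis by (simp add: gauss_def exp_sum)
qed

lemma gauss_real_integrable: "integrable lborel (\<lambda>t::real. complex_of_real (exp (- t\<^sup>2 / 2)))"
proof -
  have "integrable lborel (\<lambda>t. sqrt (2 * pi) * std_normal_density t)"
    by (intro integrable_mult_right integrable_normal_density) simp
  then show ?thesis by (intro integrable_of_real) (simp add: std_normal_density_def)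
qed

lemma gauss_integrable: "integrable lborel (gauss :: 'a::euclidean_space \<Rightarrow> complex)"
  unfolding gauss_prod[abs_def] by (intro lborel_integrable_prod gauss_real_integrable)

lemma fourier_gauss: "fourier (gauss :: real^'n \<Rightarrow> complex) y = complex_of_real (sqrt (2 * pi) ^ CARD('n)) * gauss y"
proof -
  \<comment> \<open>The one-dimensional case is the characteristic function of the standard normal
    law.\<close>
  have 1: "(LINT t|lborel. exp (- \<i> * complex_of_real (t * s)) * complex_of_real (exp (- t\<^sup>2 / 2))) =
    complex_of_real (sqrt (2 * pi)) * complex_of_real (exp (- s\<^sup>2 / 2))" for s
  proof -
    have "complex_of_real (exp (- s\<^sup>2 / 2)) = char std_normal_distribution (- s)"
      by (simp add: char_std_normal_distribution)
    also have "\<dots> = (LINT t|lborel. std_normal_density t *\<^sub>R iexp (- s * t))"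
      unfolding char_def by (subst integral_density) auto
    also have "\<dots> = (LINT t|lborel. complex_of_real (1 / sqrt (2 * pi)) * (exp (- \<i> * complex_of_real (t * s)) * complex_of_real (exp (- t\<^sup>2 / 2))))"
      by (intro Bochner_Integration.integral_cong) (auto simp: std_normal_density_def scaleR_conv_of_real mult_ac)
    also have "\<dots> = complex_of_real (1 / sqrt (2 * pi)) * (LINT t|lborel. (exp (- \<i> * complex_of_real (t * s)) * complex_of_real (exp (- t\<^sup>2 / 2))))"
      by (rule integral_mult_right_zero)
    finally have "complex_of_real (exp (- s\<^sup>2 / 2)) = complex_of_real (1 / sqrt (2 * pi)) * (LINT t|lborel. (exp (- \<i> * complex_of_real (t * s)) * complex_of_real (exp (- t\<^sup>2 / 2))))" .
    then show ?thesis by (simp add: field_simps)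
  qed
  have "fourier gauss y = (LINT x::real^'n|lborel. (\<Prod>b\<in>Basis. exp (- \<i> * complex_of_real ((x \<bullet> b) * (y \<bullet> b))) * complex_of_real (exp (- (x \<bullet> b)\<^sup>2 / 2))))"
    unfolding fourier_def gauss_prod prod.distrib
  proof (intro Bochner_Integration.integral_cong refl arg_cong2[where f="(*)"])
    fix x :: "real^'n"
    have "- \<i> * complex_of_real (x \<bullet> y) = (\<Sum>b\<in>Basis. - \<i> * complex_of_real ((x \<bullet> b) * (y \<bullet> b)))"
      by (subst euclidean_inner) (simp add: sum_distrib_left sum_negf)
    then show "exp (- \<i> * complex_of_real (x \<bullet> y)) = (\<Prod>b\<in>Basis. exp (- \<i> * complex_of_real ((x \<bullet> b) * (y \<bullet> b))))"
      by (simp add: exp_sum)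
  qed
  also have "\<dots> = (\<Prod>b\<in>(Basis::(real^'n) set). (LINT t|lborel. exp (- \<i> * complex_of_real (t * (y \<bullet> b))) * complex_of_real (exp (- t\<^sup>2 / 2))))"
  proof (rule lborel_integral_prod[where f="\<lambda>b t. exp (- \<i> * complex_of_real (t * (y \<bullet> b))) * complex_of_real (exp (- t\<^sup>2 / 2))"])
    fix b :: "real^'n"
    show "integrable lborel (\<lambda>t::real. exp (- \<i> * complex_of_real (t * (y \<bullet> b))) * complex_of_real (exp (- t\<^sup>2 / 2)))"
      using integrable_cexp_mult[OF gauss_real_integrable, of "y \<bullet> b"] by simp
  qed
  also have "\<dots> = complex_of_real (sqrt (2 * pi) ^ CARD('n)) * gauss y"
    unfolding 1 gauss_prod prod.distrib by simp
  finally show ?thesis .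
qed

text \<open>Gaussian regularisation: insert the Gaussian at e y, exchange the integrals, and let e
  tend to 0. Dominated convergence applies on both sides, with majorant |fourier g| on one and B
  times the Gaussian on the other.\<close>

lemma fourier_inversion_0:
  fixes g :: "real^'n \<Rightarrow> complex"
  assumes int: "integrable lborel g" "integrable lborel (fourier g)"
    and cont: "continuous_on UNIV g" and bdd: "\<And>x. norm (g x) \<le> B"
  shows "(LINT y|lborel. fourier g y) = complex_of_real ((2 * pi) ^ CARD('n)) * g 0"
proof -
  define \<epsilon> where "\<epsilon> m = 1 / (real m + 1)" for m
  have \<epsilon>: "\<epsilon> m > 0" "\<epsilon> \<longlonglongrightarrow> 0" for m
    unfolding \<epsilon>_def using LIMSEQ_inverse_real_of_nat by (auto simp: inverse_eq_divide add.commute)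
  have [measurable]: "g \<in> borel_measurable borel" using int by auto
  have cg: "continuous_on UNIV (gauss :: real^'n \<Rightarrow> complex)" unfolding gauss_def by (intro continuous_intros) auto
  have [measurable]: "(gauss :: real^'n \<Rightarrow> complex) \<in> borel_measurable borel" by (rule borel_measurable_continuous_onI[OF cg])
  let ?N = "CARD('n)" and ?c = "complex_of_real (sqrt (2 * pi) ^ CARD('n))"
  have gi: "integrable lborel (\<lambda>y::real^'n. gauss (e *\<^sub>R y))" if "e > 0" for e
  proof -
    have "integrable (density (distr lborel borel (\<lambda>x::real^'n. 0 + e *\<^sub>R x)) (\<lambda>_. ennreal (\<bar>e\<bar> ^ DIM(real^'n)))) gauss"
      using lborel_affine[of e "0::real^'n"] gauss_integrable[where 'a="real^'n"] that by simp
    then have "integrable (distr lborel borel (\<lambda>x::real^'n. 0 + e *\<^sub>R x)) (\<lambda>x. \<bar>e\<bar> ^ DIM(real^'n) *\<^sub>R gauss x)"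
      by (subst (asm) integrable_density) auto
    from integrable_scaleR_right[OF this, of "inverse (\<bar>e\<bar> ^ DIM(real^'n))"]
    have "integrable (distr lborel borel (\<lambda>x::real^'n. 0 + e *\<^sub>R x)) gauss" using that by simp
    then show ?thesis by (subst (asm) integrable_distr_eq) auto
  qed
  have eq: "(LINT y|lborel. fourier g y * gauss (e *\<^sub>R y)) = ?c * (LINT z|lborel. g (e *\<^sub>R z) * gauss z)" if e: "e > 0" for e
  proof -
    have I: "integrable (lborel \<Otimes>\<^sub>M lborel) (\<lambda>(y, x). exp (- \<i> * complex_of_real (x \<bullet> y)) * g x * gauss (e *\<^sub>R y))"
    proof (rule integrable_prod_bound[of _ "\<lambda>y. norm (gauss (e *\<^sub>R y))" "\<lambda>x. norm (g x)"])
      have "(\<lambda>(y, x). exp (- \<i> * complex_of_real (x \<bullet> y)) * g x * gauss (e *\<^sub>R y)) \<in> borel_measurable (borel \<Otimes>\<^sub>M borel)"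
        by measurable
      then show "(\<lambda>(y, x). exp (- \<i> * complex_of_real (x \<bullet> y)) * g x * gauss (e *\<^sub>R y)) \<in> borel_measurable borel"
        by (simp add: borel_prod)
    qed (use gi[OF e] int in \<open>auto simp: norm_mult mult.commute\<close>)
    have "(LINT y|lborel. fourier g y * gauss (e *\<^sub>R y)) = (LINT y|lborel. LINT x|lborel. exp (- \<i> * complex_of_real (x \<bullet> y)) * g x * gauss (e *\<^sub>R y))"
      unfolding fourier_def by simp
    also have "\<dots> = (LINT x|lborel. LINT y|lborel. exp (- \<i> * complex_of_real (x \<bullet> y)) * g x * gauss (e *\<^sub>R y))"
      by (rule lborel_pair.Fubini_integral[OF I, symmetric])
    \<comment> \<open>Substituting e x for x produces exactly the Jacobian that the substitution of
      e y in the inner integral consumes; what is left inside is the transform of the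
      Gaussian.\<close>
    also have "\<dots> = \<bar>e\<bar> ^ DIM(real^'n) *\<^sub>R (LINT x|lborel. LINT y|lborel. exp (- \<i> * complex_of_real ((0 + e *\<^sub>R x) \<bullet> y)) * g (0 + e *\<^sub>R x) * gauss (e *\<^sub>R y))"
      using e by (intro lborel_integral_affine) auto
    also have "\<dots> = (LINT x|lborel. g (e *\<^sub>R x) * (\<bar>e\<bar> ^ DIM(real^'n) *\<^sub>R (LINT y|lborel. exp (- \<i> * complex_of_real (x \<bullet> (0 + e *\<^sub>R y))) * gauss (0 + e *\<^sub>R y))))"
      by (subst integral_scaleR_right[symmetric]; intro Bochner_Integration.integral_cong refl; simp add: mult_ac
          flip: integral_mult_right_zero integral_scaleR_right)
    also have "\<dots> = (LINT x|lborel. g (e *\<^sub>R x) * (LINT y|lborel. exp (- \<i> * complex_of_real (x \<bullet> y)) * gauss y))"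
      using e by (subst lborel_integral_affine[symmetric]) auto
    also have "\<dots> = (LINT x|lborel. g (e *\<^sub>R x) * (?c * gauss x))"
      using fourier_gauss[where 'n='n] unfolding fourier_def by (simp add: inner_commute)
    also have "\<dots> = (LINT x|lborel. ?c * (g (e *\<^sub>R x) * gauss x))" by (simp add: mult_ac)
    finally show ?thesis by (simp only: integral_mult_right_zero)
  qed
  have ng: "norm (gauss x) \<le> 1" for x :: "real^'n" by (simp add: gauss_def)
  have L: "(\<lambda>m. LINT y|lborel. fourier g y * gauss (\<epsilon> m *\<^sub>R y)) \<longlonglongrightarrow> (LINT y|lborel. fourier g y)"
  proof (rule integral_dominated_convergence[where w="\<lambda>y. norm (fourier g y)"])
    show "AE y in lborel. (\<lambda>m. fourier g y * gauss (\<epsilon> m *\<^sub>R y)) \<longlonglongrightarrow> fourier g y"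
    proof (rule AE_I2)
      fix y :: "real^'n"
      have "(\<lambda>m. gauss (\<epsilon> m *\<^sub>R y)) \<longlonglongrightarrow> gauss (0 *\<^sub>R y)"
        by (intro continuous_on_tendsto_compose[OF cg] tendsto_intros \<epsilon>) auto
      from tendsto_mult[OF tendsto_const[of "fourier g y"] this]
      show "(\<lambda>m. fourier g y * gauss (\<epsilon> m *\<^sub>R y)) \<longlonglongrightarrow> fourier g y" by (simp add: gauss_def)
    qed
    show "AE y in lborel. norm (fourier g y * gauss (\<epsilon> m *\<^sub>R y)) \<le> norm (fourier g y)" for m
      unfolding norm_mult by (intro AE_I2 mult_left_le ng norm_ge_zero)
  qed (use int in auto)
  have R: "(\<lambda>m. LINT z|lborel. g (\<epsilon> m *\<^sub>R z) * gauss z) \<longlonglongrightarrow> (LINT z|lborel. g 0 * gauss (z::real^'n))"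
  proof (rule integral_dominated_convergence[where w="\<lambda>z. B * norm (gauss z)"])
    show "AE z in lborel. (\<lambda>m. g (\<epsilon> m *\<^sub>R z) * gauss z) \<longlonglongrightarrow> g 0 * gauss z"
    proof (rule AE_I2)
      fix z :: "real^'n"
      have "(\<lambda>m. g (\<epsilon> m *\<^sub>R z)) \<longlonglongrightarrow> g (0 *\<^sub>R z)"
        by (intro continuous_on_tendsto_compose[OF cont] tendsto_intros \<epsilon>) auto
      then show "(\<lambda>m. g (\<epsilon> m *\<^sub>R z) * gauss z) \<longlonglongrightarrow> g 0 * gauss z" by (intro tendsto_intros) simp
    qed
    show "AE z in lborel. norm (g (\<epsilon> m *\<^sub>R z) * gauss z) \<le> B * norm (gauss z)" for m
      unfolding norm_mult by (intro AE_I2 mult_right_mono bdd norm_ge_zero)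
  qed (use gauss_integrable[where 'a="real^'n"] in auto)
  have "(LINT z|lborel. gauss (z::real^'n)) = ?c"
    using fourier_gauss[where 'n='n, of 0] by (simp add: fourier_def gauss_def)
  then have "(\<lambda>m. ?c * (LINT z|lborel. g (\<epsilon> m *\<^sub>R z) * gauss z)) \<longlonglongrightarrow> ?c * (g 0 * ?c)"
    using R by (intro tendsto_intros) simp
  then have "(LINT y|lborel. fourier g y) = ?c * (g 0 * ?c)"
    using L eq[OF \<epsilon>(1)] by (simp add: LIMSEQ_unique)
  also have "?c * (g 0 * ?c) = complex_of_real ((sqrt (2 * pi) * sqrt (2 * pi)) ^ CARD('n)) * g 0"
    unfolding power_mult_distrib of_real_mult by (simp only: mult_ac)
  also have "sqrt (2 * pi) * sqrt (2 * pi) = 2 * pi" by simp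
  finally show ?thesis .
qed

text \<open>The value at x follows from the value at 0 for the translate of g by x, whose transform
  differs by the phase exp(i x.y).\<close>

lemma fourier_inversion:
  fixes g :: "'i \<Rightarrow> real^'n \<Rightarrow> complex"
  assumes u: "ubd (\<lambda>x. jbracket x powr s) I g" and i: "i \<in> I" and s: "s \<le> - 2 * real CARD('n)"
  shows "(LINT y|lborel. exp (\<i> * complex_of_real (x \<bullet> y)) * fourier (g i) y) = complex_of_real ((2 * pi) ^ CARD('n)) * g i x"
    and "integrable lborel (fourier (g i))"
proof -
  have gi: "integrable lborel (g i)" by (rule ubd_integrable[OF u i]) (use s in simp)
  then have [measurable]: "g i \<in> borel_measurable borel" by auto
  obtain C where C: "C \<ge> 0" "\<And>i x. i \<in> I \<Longrightarrow> norm (g i x) \<le> C * jbracket x powr s" using ubdE0[OF u] by metis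
  have bdd: "norm (g i (x + z)) \<le> C" for z
  proof -
    have "C * jbracket (x + z) powr s \<le> C * jbracket (x + z) powr 0"
      using s C by (intro mult_left_mono jbracket_powr_mono) auto
    also have "\<dots> \<le> C" using C by simp
    finally show ?thesis using C(2)[OF i, of "x + z"] by simp
  qed
  obtain D where "D \<ge> 0" and D: "\<And>y. norm (fourier (g i) y) \<le> D * jbracket y powr (- 2 * real CARD('n))"
    using fourier_decay[OF u s, of "CARD('n)"] i by metis
  show fi: "integrable lborel (fourier (g i))"
    by (rule integrable_continuous_bound[OF fourier_continuous[OF gi] _ D]) (intro integrable_mult_right integrable_jbracket, simp)
  have sh: "fourier (\<lambda>z. g i (x + z)) y = exp (\<i> * complex_of_real (x \<bullet> y)) * fourier (g i) y" for y
  proof -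
    have "exp (\<i> * complex_of_real (x \<bullet> y)) * fourier (g i) y = (LINT z|lborel. exp (\<i> * complex_of_real (x \<bullet> y)) * (exp (- \<i> * complex_of_real (z \<bullet> y)) * g i z))"
      unfolding fourier_def by simp
    also have "\<dots> = (LINT z|lborel. exp (\<i> * complex_of_real (x \<bullet> y)) * (exp (- \<i> * complex_of_real ((x + z) \<bullet> y)) * g i (x + z)))"
      by (rule lborel_integral_translate[symmetric]) measurable
    also have "\<dots> = fourier (\<lambda>z. g i (x + z)) y"
      unfolding fourier_def by (intro Bochner_Integration.integral_cong refl)
        (simp add: inner_add_left algebra_simps exp_diff exp_minus exp_add)
    finally show ?thesis by simp
  qed
  have "(LINT y|lborel. fourier (\<lambda>z. g i (x + z)) y) = complex_of_real ((2 * pi) ^ CARD('n)) * g i (x + 0)"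
  proof (rule fourier_inversion_0[OF lborel_integrable_translate[OF gi] _ _ bdd])
    show "integrable lborel (fourier (\<lambda>z. g i (x + z)))"
      using fi by (rule Bochner_Integration.integrable_bound) (auto simp: sh norm_mult)
    show "continuous_on UNIV (\<lambda>z. g i (x + z))"
      by (rule continuous_on_compose2[OF smooth_continuous[OF ubd_smooth[OF u i]]]) (auto intro!: continuous_intros)
  qed
  then show "(LINT y|lborel. exp (\<i> * complex_of_real (x \<bullet> y)) * fourier (g i) y) = complex_of_real ((2 * pi) ^ CARD('n)) * g i x"
    by (simp add: sh)
qed

section \<open>Oscillatory integrals\<close>

abbreviation ubd1 :: "('a::euclidean_space \<Rightarrow> real) \<Rightarrow> ('a \<Rightarrow> complex) \<Rightarrow> bool" where
  "ubd1 w f \<equiv> ubd w (UNIV :: unit set) (\<lambda>_. f)"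

lemma ubd1I: "ubd w I f \<Longrightarrow> i \<in> I \<Longrightarrow> ubd1 w (f i)"
  by (rule ubd_reindex[where h="\<lambda>_. i"])

lemma ubd1_const_family: "ubd1 w f \<Longrightarrow> ubd w I (\<lambda>_. f)"
  by (rule ubd_reindex[where h="\<lambda>_. ()"]) auto

definition pw :: "real \<Rightarrow> real \<Rightarrow> 'a::real_normed_vector \<times> 'b::real_normed_vector \<Rightarrow> real" where
  "pw M M' p = jbracket (fst p) powr M * jbracket (snd p) powr M'"

lemma pw_pos: "0 < pw M M' p"
  unfolding pw_def by (intro mult_pos_pos) auto

lemma pw_mult: "pw M M' p * pw N N' p = pw (M + N) (M' + N') p"
  by (simp add: pw_def powr_add mult_ac)

lemma pw_mono: "M \<le> N \<Longrightarrow> M' \<le> N' \<Longrightarrow> pw M M' p \<le> pw N N' p"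
  unfolding pw_def by (intro mult_mono jbracket_powr_mono) auto

lemma ubd_pw_mono: "ubd (pw M M') I f \<Longrightarrow> M \<le> N \<Longrightarrow> M' \<le> N' \<Longrightarrow> ubd (pw N N') I f"
  by (erule ubd_weaken[where K=1]) (auto simp: pw_mono less_imp_le[OF pw_pos])

lemma ubd_pw_mult:
  assumes "ubd (pw M M') I f" "ubd (pw N N') I g"
  shows "ubd (pw (M + N) (M' + N')) I (\<lambda>i p. f i p * g i p)"
  using ubd_mult[OF assms] by (simp add: pw_mult)

text \<open>Dividing by \<langle>y\<rangle>^M and adding y to the index set turns joint bounds into
  bounds in \<eta> whose constants do not depend on y, the form that \<open>fourier_decay\<close>
  takes.\<close>

lemma ubd_section_snd:
  assumes f: "ubd (pw M M') I f"
  shows "ubd (\<lambda>\<eta>. jbracket \<eta> powr M') (I \<times> UNIV) (\<lambda>j \<eta>. complex_of_real (jbracket (snd j) powr (- M)) * f (fst j) (snd j, \<eta>))"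
proof (rule ubdI)
  fix bs :: "'b list" assume bs: "set bs \<subseteq> Basis"
  then have bs': "set (map (Pair (0::'a)) bs) \<subseteq> Basis" by auto
  obtain C where C: "\<And>i x. i \<in> I \<Longrightarrow> norm (iter_partial (map (Pair 0) bs) (f i) x) \<le> C * pw M M' x"
    using ubdE[OF f bs'] by metis
  have "norm (iter_partial bs (\<lambda>\<eta>. complex_of_real (jbracket y powr (- M)) * f i (y, \<eta>)) \<eta>) \<le> C * jbracket \<eta> powr M'"
    if i: "i \<in> I" for i y \<eta>
  proof -
    have "norm (iter_partial bs (\<lambda>\<eta>. complex_of_real (jbracket y powr (- M)) * f i (y, \<eta>)) \<eta>) =
        jbracket y powr (- M) * norm (iter_partial (map (Pair 0) bs) (f i) (y, \<eta>))"
      by (subst iter_partial_cmult[OF smooth_section_snd[OF ubd_smooth[OF f i]] bs])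
        (simp add: norm_mult iter_partial_section_snd)
    also have "\<dots> \<le> jbracket y powr (- M) * (C * pw M M' (y, \<eta>))"
      by (intro mult_left_mono C i) auto
    also have "\<dots> = (jbracket y powr (- M) * jbracket y powr M) * (C * jbracket \<eta> powr M')"
      by (simp add: pw_def)
    also have "jbracket y powr (- M) * jbracket y powr M = 1"
      by (simp add: powr_add[symmetric])
    finally show ?thesis by simp
  qed
  then show "\<exists>C. \<forall>j\<in>I \<times> UNIV. \<forall>\<eta>. norm (iter_partial bs (\<lambda>\<eta>. complex_of_real (jbracket (snd j) powr (- M)) * f (fst j) (snd j, \<eta>)) \<eta>)
      \<le> C * jbracket \<eta> powr M'" by auto
qed (use f in \<open>auto intro!: smooth_cmult smooth_section_snd ubd_smooth[OF f]\<close>)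

lemma ubd_section_fst:
  assumes f: "ubd (pw M M') I f"
  shows "ubd (\<lambda>y. jbracket y powr M) (I \<times> UNIV) (\<lambda>j y. complex_of_real (jbracket (snd j) powr (- M')) * f (fst j) (y, snd j))"
proof (rule ubdI)
  fix bs :: "'a list" assume bs: "set bs \<subseteq> Basis"
  then have bs': "set (map (\<lambda>b. (b, 0::'b)) bs) \<subseteq> Basis" by auto
  obtain C where C: "\<And>i x. i \<in> I \<Longrightarrow> norm (iter_partial (map (\<lambda>b. (b, 0)) bs) (f i) x) \<le> C * pw M M' x"
    using ubdE[OF f bs'] by metis
  have "norm (iter_partial bs (\<lambda>y. complex_of_real (jbracket \<eta> powr (- M')) * f i (y, \<eta>)) y) \<le> C * jbracket y powr M"
    if i: "i \<in> I" for i y \<eta>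
  proof -
    have "norm (iter_partial bs (\<lambda>y. complex_of_real (jbracket \<eta> powr (- M')) * f i (y, \<eta>)) y) =
        jbracket \<eta> powr (- M') * norm (iter_partial (map (\<lambda>b. (b, 0)) bs) (f i) (y, \<eta>))"
      by (subst iter_partial_cmult[OF smooth_section_fst[OF ubd_smooth[OF f i]] bs])
        (simp add: norm_mult iter_partial_section_fst)
    also have "\<dots> \<le> jbracket \<eta> powr (- M') * (C * pw M M' (y, \<eta>))"
      by (intro mult_left_mono C i) auto
    also have "\<dots> = (jbracket \<eta> powr (- M') * jbracket \<eta> powr M') * (C * jbracket y powr M)"
      by (simp add: pw_def)
    also have "jbracket \<eta> powr (- M') * jbracket \<eta> powr M' = 1"
      by (simp add: powr_add[symmetric])
    finally show ?thesis by simp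
  qed
  then show "\<exists>C. \<forall>j\<in>I \<times> UNIV. \<forall>y. norm (iter_partial bs (\<lambda>y. complex_of_real (jbracket (snd j) powr (- M')) * f (fst j) (y, snd j)) y)
      \<le> C * jbracket y powr M" by auto
qed (use f in \<open>auto intro!: smooth_cmult smooth_section_fst ubd_smooth[OF f]\<close>)

lemma ubd1_section_snd: "ubd1 (pw M M') f \<Longrightarrow> ubd1 (\<lambda>\<eta>. jbracket \<eta> powr M') (\<lambda>\<eta>. f (y, \<eta>))"
  using ubd_cmult[OF ubd1I[OF ubd_section_snd, of M M' UNIV "\<lambda>_. f" "((), y)"], of "complex_of_real (jbracket y powr M)"]
  by (simp add: powr_add[symmetric] mult.assoc[symmetric] flip: of_real_mult)

lemma ubd1_section_fst: "ubd1 (pw M M') f \<Longrightarrow> ubd1 (\<lambda>y. jbracket y powr M) (\<lambda>y. f (y, \<eta>))"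
  using ubd_cmult[OF ubd1I[OF ubd_section_fst, of M M' UNIV "\<lambda>_. f" "((), \<eta>)"], of "complex_of_real (jbracket \<eta> powr M')"]
  by (simp add: powr_add[symmetric] mult.assoc[symmetric] flip: of_real_mult)

abbreviation YB :: "('a::euclidean_space \<times> 'b::euclidean_space) set" where
  "YB \<equiv> (\<lambda>e. (e, 0)) ` Basis"

lemma YB_Basis: "YB \<subseteq> Basis" by auto

lemma helm_section_fst: "helm YB f (y, \<eta>) = helm Basis (\<lambda>y. f (y, \<eta>)) y"
  unfolding helm_def by (subst sum.reindex) (auto simp: inj_on_def partial_deriv_section_fst)

lemma helm_pow_section_fst: "(helm YB ^^ k) f (y, \<eta>) = (helm Basis ^^ k) (\<lambda>y. f (y, \<eta>)) y"
proof (induction k arbitrary: y)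
  case (Suc k)
  have "(\<lambda>y. (helm YB ^^ k) f (y, \<eta>)) = (helm Basis ^^ k) (\<lambda>y. f (y, \<eta>))" using Suc by blast
  then show ?case by (simp add: helm_section_fst)
qed simp

text \<open>The inner \<eta>-integral read as a Fourier transform at y, the same y that is the first
  argument of b. Integrations by parts in \<eta> are then supplied by
  \<open>fourier_decay\<close>.\<close>

definition osc_J :: "nat \<Rightarrow> ((real^'n) \<times> (real^'n) \<Rightarrow> complex) \<Rightarrow> real^'n \<Rightarrow> complex" where
  "osc_J k b y = fourier (\<lambda>\<eta>. wt \<eta> ^ k * (helm YB ^^ k) b (y, \<eta>)) y"

text \<open>
  The oscillatory integral \<open>(2\<pi>)\<^sup>-\<^sup>n \<integral>\<integral> e\<^sup>-\<^sup>i\<^sup>y\<^sup>\<eta> b(y,\<eta>) d\<eta> dy\<close> after \<open>2k\<close> integrations by parts in \<open>y\<close>;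
  the inner integral then converges absolutely and decays rapidly in \<open>y\<close>.
\<close>
definition osc_I :: "nat \<Rightarrow> ((real^'n) \<times> (real^'n) \<Rightarrow> complex) \<Rightarrow> complex" where
  "osc_I k b = complex_of_real (1 / (2 * pi) ^ CARD('n)) * (LINT y|lborel. osc_J k b y)"

lemma osc_integrand_ubd:
  assumes "ubd (pw M M') I b"
  shows "ubd (\<lambda>\<eta>. jbracket \<eta> powr (M' - 2 * real k)) (I \<times> UNIV)
    (\<lambda>j \<eta>. complex_of_real (jbracket (snd j) powr (- M)) * (wt \<eta> ^ k * (helm YB ^^ k) (b (fst j)) (snd j, \<eta>)))"
proof -
  have "ubd (\<lambda>\<eta>. jbracket \<eta> powr (- 2 * real k) * jbracket \<eta> powr M') (I \<times> UNIV)
    (\<lambda>j \<eta>. wt \<eta> ^ k * (complex_of_real (jbracket (snd j) powr (- M)) * (helm YB ^^ k) (b (fst j)) (snd j, \<eta>)))"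
    by (rule ubd_mult[OF ubd_wt_pow ubd_section_snd[OF ubd_helm_pow[OF assms YB_Basis]]])
  then show ?thesis by (simp add: powr_add[symmetric] mult_ac algebra_simps)
qed

lemma osc_integrand_ubd1:
  assumes "ubd (pw M M') I b" "i \<in> I"
  shows "ubd1 (\<lambda>\<eta>. jbracket \<eta> powr (M' - 2 * real k)) (\<lambda>\<eta>. wt \<eta> ^ k * (helm YB ^^ k) (b i) (y, \<eta>))"
  using ubd_cmult[OF ubd1I[OF osc_integrand_ubd[OF assms(1)], of "(i, y)" k], of "complex_of_real (jbracket y powr M)"] assms(2)
  by (simp add: powr_add[symmetric] mult.assoc[symmetric] flip: of_real_mult)

lemma fourier_cmult: "fourier (\<lambda>x. c * g x) y = c * fourier g y"
proof -
  have "fourier (\<lambda>x. c * g x) y = (LINT x|lborel. c * (exp (- \<i> * complex_of_real (x \<bullet> y)) * g x))"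
    unfolding fourier_def by (simp add: mult_ac)
  then show ?thesis unfolding fourier_def by simp
qed

text \<open>k pays for growth in \<eta>, l for growth in y. Since l is free, the order M in y never
  restricts k.\<close>

lemma osc_J_bound:
  fixes b :: "'i \<Rightarrow> (real^'n) \<times> (real^'n) \<Rightarrow> complex"
  assumes b: "ubd (pw M M') I b" and k: "M' - 2 * real k \<le> - 2 * real CARD('n)"
  shows "\<exists>C\<ge>0. \<forall>i\<in>I. \<forall>y. norm (osc_J k (b i) y) \<le> C * jbracket y powr (M - 2 * real l)"
proof -
  obtain C where C: "C \<ge> 0" "\<forall>j\<in>I \<times> UNIV. \<forall>y. norm (fourier (\<lambda>\<eta>. complex_of_real (jbracket (snd j) powr (- M)) * (wt \<eta> ^ k * (helm YB ^^ k) (b (fst j)) (snd j, \<eta>))) y)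
     \<le> C * jbracket y powr (- 2 * real l)"
    using fourier_decay[OF osc_integrand_ubd[OF b] k, of l] by blast
  have "norm (osc_J k (b i) y) \<le> C * jbracket y powr (M - 2 * real l)" if i: "i \<in> I" for i y
  proof -
    have "jbracket y powr (- M) * norm (osc_J k (b i) y) \<le> C * jbracket y powr (- 2 * real l)"
      using C(2)[rule_format, of "(i, y)" y] i by (simp add: fourier_cmult norm_mult osc_J_def)
    then have "jbracket y powr M * (jbracket y powr (- M) * norm (osc_J k (b i) y)) \<le> jbracket y powr M * (C * jbracket y powr (- 2 * real l))"
      by (rule mult_left_mono) simp
    then have "(jbracket y powr M * jbracket y powr (- M)) * norm (osc_J k (b i) y) \<le> C * (jbracket y powr M * jbracket y powr (- 2 * real l))"
      by (simp only: mult_ac)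
    then show ?thesis
      unfolding powr_add[symmetric] by simp
  qed
  then show ?thesis using C by blast
qed

lemma osc_integrand_continuous:
  assumes "smooth b"
  shows "continuous_on UNIV (\<lambda>(y, \<eta>). wt \<eta> ^ k * (helm YB ^^ k) b (y, \<eta>))"
proof -
  have "continuous_on UNIV (\<lambda>p. wt (snd p) ^ k)"
    by (intro continuous_on_power continuous_on_compose2[OF smooth_continuous[OF rat_smooth[OF rat_wt]]] continuous_intros) auto
  then show ?thesis
    unfolding case_prod_beta prod.collapse
    by (intro continuous_on_mult smooth_continuous[OF smooth_helm_pow[OF assms YB_Basis]])
qed

lemma osc_J_measurable:
  assumes "smooth b"
  shows "osc_J k b \<in> borel_measurable borel"
proof -
  have "(\<lambda>(y, \<eta>). wt \<eta> ^ k * (helm YB ^^ k) b (y, \<eta>)) \<in> borel_measurable (borel \<Otimes>\<^sub>M borel)"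
    unfolding borel_prod by (rule borel_measurable_continuous_onI[OF osc_integrand_continuous[OF assms]])
  then have [measurable]: "(\<lambda>(y, \<eta>). wt \<eta> ^ k * (helm YB ^^ k) b (y, \<eta>)) \<in> borel_measurable (borel \<Otimes>\<^sub>M lborel)"
    by (simp cong: measurable_cong_sets)
  show ?thesis unfolding osc_J_def fourier_def by measurable
qed

lemma osc_J_integrable:
  fixes b :: "'i \<Rightarrow> (real^'n) \<times> (real^'n) \<Rightarrow> complex"
  assumes b: "ubd (pw M M') I b" and i: "i \<in> I" and k: "M' - 2 * real k \<le> - 2 * real CARD('n)"
  shows "integrable lborel (osc_J k (b i))"
proof -
  obtain l :: nat where l: "M - 2 * real l \<le> - 2 * real CARD('n)"
    using real_arch_simple[of "(M + 2 * real CARD('n)) / 2"] by (auto simp: field_simps)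
  obtain C where C: "\<And>i y. i \<in> I \<Longrightarrow> norm (osc_J k (b i) y) \<le> C * jbracket y powr (M - 2 * real l)"
    using osc_J_bound[OF b k, of l] by metis
  show ?thesis
  proof (rule Bochner_Integration.integrable_bound)
    show "integrable lborel (\<lambda>y::real^'n. C * jbracket y powr (M - 2 * real l))"
      using l by (intro integrable_mult_right integrable_jbracket) simp
  qed (use C[OF i] osc_J_measurable[OF ubd_smooth[OF b i]] in \<open>auto intro!: AE_I2 order_trans[OF _ abs_ge_self]\<close>)
qed

lemma osc_I_bound:
  fixes b :: "'i \<Rightarrow> (real^'n) \<times> (real^'n) \<Rightarrow> complex"
  assumes b: "ubd (pw M M') I b" and k: "M' - 2 * real k \<le> - 2 * real CARD('n)"
  shows "\<exists>C\<ge>0. \<forall>i\<in>I. norm (osc_I k (b i)) \<le> C"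
proof -
  obtain l :: nat where l: "M - 2 * real l \<le> - 2 * real CARD('n)"
    using real_arch_simple[of "(M + 2 * real CARD('n)) / 2"] by (auto simp: field_simps)
  obtain C where C: "C \<ge> 0" "\<And>i y. i \<in> I \<Longrightarrow> norm (osc_J k (b i) y) \<le> C * jbracket y powr (M - 2 * real l)"
    using osc_J_bound[OF b k, of l] by metis
  define K where "K = 1 / (2 * pi) ^ CARD('n) * (LINT y::real^'n|lborel. C * jbracket y powr (M - 2 * real l))"
  have int: "integrable lborel (\<lambda>y::real^'n. C * jbracket y powr (M - 2 * real l))"
    using l by (intro integrable_mult_right integrable_jbracket) simp
  have "norm (osc_I k (b i)) \<le> K" if i: "i \<in> I" for i
  proof -
    have "norm (LINT y|lborel. osc_J k (b i) y) \<le> (LINT y|lborel. norm (osc_J k (b i) y))" by (rule integral_norm_bound)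
    also have "\<dots> \<le> (LINT y::real^'n|lborel. C * jbracket y powr (M - 2 * real l))"
      by (rule Bochner_Integration.integral_mono[OF integrable_norm[OF osc_J_integrable[OF b i k]] int C(2)[OF i]])
    finally show ?thesis unfolding osc_I_def K_def norm_mult norm_of_real
      by (intro mult_mono) auto
  qed
  moreover have "K \<ge> 0" unfolding K_def using C by (intro mult_nonneg_nonneg integral_nonneg) auto
  ultimately show ?thesis by blast
qed

lemma iter_partial_helm:
  assumes "smooth f" "B \<subseteq> Basis" "set bs \<subseteq> Basis"
  shows "iter_partial bs (helm B f) = (\<lambda>x. iter_partial bs f x - (\<Sum>e\<in>B. iter_partial (bs @ [e, e]) f x))"
proof -
  have s: "smooth (partial_deriv e (partial_deriv e f))" if "e \<in> B" for e
    using assms that by (intro smooth_partial_deriv) auto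
  show ?thesis
    unfolding helm_def[abs_def]
    by (subst iter_partial_diff[OF assms(1) smooth_sum[OF s] assms(3)]) (simp_all add: iter_partial_sum s assms)
qed

text \<open>The mode of convergence under which the oscillatory integral is continuous on bounded families.\<close>
definition pconv :: "(nat \<Rightarrow> 'a::euclidean_space \<Rightarrow> complex) \<Rightarrow> ('a \<Rightarrow> complex) \<Rightarrow> bool" where
  "pconv b b0 \<longleftrightarrow> (\<forall>i. smooth (b i)) \<and> smooth b0 \<and>
    (\<forall>bs p. set bs \<subseteq> Basis \<longrightarrow> (\<lambda>i. iter_partial bs (b i) p) \<longlonglongrightarrow> iter_partial bs b0 p)"

lemma pconv_helm:
  assumes "pconv b b0" "B \<subseteq> Basis"
  shows "pconv (\<lambda>i. helm B (b i)) (helm B b0)"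
  unfolding pconv_def
proof (intro conjI allI impI)
  fix bs :: "'a list" and p assume bs: "set bs \<subseteq> Basis"
  have 1: "(\<lambda>i. iter_partial bs' (b i) p) \<longlonglongrightarrow> iter_partial bs' b0 p" if "set bs' \<subseteq> Basis" for bs'
    using assms that by (auto simp: pconv_def)
  have 2: "smooth (b i)" "smooth b0" for i using assms by (auto simp: pconv_def)
  show "(\<lambda>i. iter_partial bs (helm B (b i)) p) \<longlonglongrightarrow> iter_partial bs (helm B b0) p"
    unfolding iter_partial_helm[OF 2(1) assms(2) bs] iter_partial_helm[OF 2(2) assms(2) bs]
    by (intro tendsto_intros 1) (use bs assms(2) in auto)
qed (use assms in \<open>auto simp: pconv_def intro!: smooth_helm\<close>)

lemma pconv_helm_pow:
  assumes "pconv b b0" "B \<subseteq> Basis"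
  shows "pconv (\<lambda>i. (helm B ^^ k) (b i)) ((helm B ^^ k) b0)"
proof (induction k)
  case (Suc k)
  from pconv_helm[OF this assms(2)] show ?case by simp
qed (use assms in simp)

text \<open>Dominated convergence twice: in \<eta> for each fixed y, then in y under the bound of
  \<open>osc_J_bound\<close> with l large. It serves to remove cutoffs, to prove continuity and to
  pass to the limit in difference quotients.\<close>

lemma osc_I_tendsto:
  fixes b :: "nat \<Rightarrow> (real^'n) \<times> (real^'n) \<Rightarrow> complex"
  assumes b: "ubd (pw M M') UNIV b" and k: "M' - 2 * real k \<le> - 2 * real CARD('n)" and lim: "pconv b b0"
  shows "(\<lambda>i. osc_I k (b i)) \<longlonglongrightarrow> osc_I k b0"
proof -
  obtain l :: nat where l: "M - 2 * real l \<le> - 2 * real CARD('n)"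
    using real_arch_simple[of "(M + 2 * real CARD('n)) / 2"] by (auto simp: field_simps)
  obtain C where C: "C \<ge> 0" "\<And>i y. norm (osc_J k (b i) y) \<le> C * jbracket y powr (M - 2 * real l)"
    using osc_J_bound[OF b k, of l] by auto
  have sm: "smooth (b i)" "smooth b0" for i using lim by (auto simp: pconv_def)
  have conv: "(\<lambda>i. (helm YB ^^ k) (b i) p) \<longlonglongrightarrow> (helm YB ^^ k) b0 p" for p
    using pconv_helm_pow[OF lim YB_Basis, of k, unfolded pconv_def, THEN conjunct2, THEN conjunct2, rule_format, of "[]" p]
    by simp
  have mJ: "(\<lambda>\<eta>. wt \<eta> ^ k * (helm YB ^^ k) f (y, \<eta>)) \<in> borel_measurable borel" if "smooth f" for f :: "(real^'n) \<times> (real^'n) \<Rightarrow> complex" and y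
    by (intro borel_measurable_continuous_onI smooth_continuous smooth_mult smooth_section_snd smooth_helm_pow YB_Basis that
        rat_smooth[OF rat_wt_pow])
  have J: "(\<lambda>i. osc_J k (b i) y) \<longlonglongrightarrow> osc_J k b0 y" for y
  proof -
    obtain D where D: "D \<ge> 0" "\<And>i x. norm ((helm YB ^^ k) (b i) x) \<le> D * pw M M' x"
      using ubdE0[OF ubd_helm_pow[OF b YB_Basis]] by auto
    show ?thesis unfolding osc_J_def fourier_def
    proof (rule integral_dominated_convergence[where w="\<lambda>\<eta>. D * jbracket y powr M * jbracket \<eta> powr (M' - 2 * real k)"])
      have [measurable]: "(\<lambda>\<eta>. exp (- \<i> * complex_of_real (\<eta> \<bullet> y))) \<in> borel_measurable borel"
        by (intro borel_measurable_continuous_onI continuous_intros)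
      show "(\<lambda>\<eta>. exp (- \<i> * complex_of_real (\<eta> \<bullet> y)) * (wt \<eta> ^ k * (helm YB ^^ k) b0 (y, \<eta>))) \<in> borel_measurable lborel"
        using mJ[OF sm(2)] by simp
      show "(\<lambda>\<eta>. exp (- \<i> * complex_of_real (\<eta> \<bullet> y)) * (wt \<eta> ^ k * (helm YB ^^ k) (b i) (y, \<eta>))) \<in> borel_measurable lborel" for i
        using mJ[OF sm(1)] by simp
      show "integrable lborel (\<lambda>\<eta>::real^'n. D * jbracket y powr M * jbracket \<eta> powr (M' - 2 * real k))"
        using k by (intro integrable_mult_right integrable_jbracket) simp
      show "AE \<eta> in lborel. (\<lambda>i. exp (- \<i> * complex_of_real (\<eta> \<bullet> y)) * (wt \<eta> ^ k * (helm YB ^^ k) (b i) (y, \<eta>)))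
          \<longlonglongrightarrow> exp (- \<i> * complex_of_real (\<eta> \<bullet> y)) * (wt \<eta> ^ k * (helm YB ^^ k) b0 (y, \<eta>))"
        by (intro AE_I2 tendsto_intros conv)
      show "AE \<eta> in lborel. norm (exp (- \<i> * complex_of_real (\<eta> \<bullet> y)) * (wt \<eta> ^ k * (helm YB ^^ k) (b i) (y, \<eta>)))
          \<le> D * jbracket y powr M * jbracket \<eta> powr (M' - 2 * real k)" for i
      proof (rule AE_I2)
        fix \<eta> :: "real^'n"
        have nw: "norm (wt \<eta> ^ k) = jbracket \<eta> powr (- 2 * real k)"
        proof -
          have "0 < jbracket \<eta> powr (-2)" by simp
          then have "(jbracket \<eta> powr (-2)) ^ k = (jbracket \<eta> powr (-2)) powr real k"
            by (rule powr_realpow[symmetric])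
          then show ?thesis unfolding norm_power norm_wt powr_powr .
        qed
        have "norm (exp (- \<i> * complex_of_real (\<eta> \<bullet> y)) * (wt \<eta> ^ k * (helm YB ^^ k) (b i) (y, \<eta>))) =
           jbracket \<eta> powr (- 2 * real k) * norm ((helm YB ^^ k) (b i) (y, \<eta>))"
          unfolding norm_mult norm_cexp nw by simp
        also have "\<dots> \<le> jbracket \<eta> powr (- 2 * real k) * (D * pw M M' (y, \<eta>))"
          by (intro mult_left_mono D) auto
        also have "\<dots> = D * jbracket y powr M * jbracket \<eta> powr (M' - 2 * real k)"
          by (simp add: pw_def powr_diff powr_minus divide_inverse mult_ac)
        finally show "norm (exp (- \<i> * complex_of_real (\<eta> \<bullet> y)) * (wt \<eta> ^ k * (helm YB ^^ k) (b i) (y, \<eta>)))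
          \<le> D * jbracket y powr M * jbracket \<eta> powr (M' - 2 * real k)" .
      qed
    qed
  qed
  show ?thesis unfolding osc_I_def
  proof (rule tendsto_mult[OF tendsto_const], rule integral_dominated_convergence)
    show "integrable lborel (\<lambda>y::real^'n. C * jbracket y powr (M - 2 * real l))"
      using l by (intro integrable_mult_right integrable_jbracket) simp
  qed (use osc_J_measurable[OF sm(1)] osc_J_measurable[OF sm(2)] J C in \<open>auto intro!: AE_I2\<close>)
qed

section \<open>Linearity of the oscillatory integral\<close>

lemma helm_cmult: "smooth f \<Longrightarrow> B \<subseteq> Basis \<Longrightarrow> helm B (\<lambda>x. c * f x) = (\<lambda>x. c * helm B f x)"
  by (rule ext) (simp add: helm_def subsetD partial_deriv_cmult smooth_partial_deriv right_diff_distrib sum_distrib_left)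

lemma helm_add:
  assumes "smooth f" "smooth g" "B \<subseteq> Basis"
  shows "helm B (\<lambda>x. f x + g x) = (\<lambda>x. helm B f x + helm B g x)"
  by (rule ext) (simp add: helm_def subsetD[OF assms(3)] partial_deriv_add smooth_partial_deriv assms sum.distrib)

lemma helm_pow_cmult: "smooth f \<Longrightarrow> B \<subseteq> Basis \<Longrightarrow> (helm B ^^ k) (\<lambda>x. c * f x) = (\<lambda>x. c * (helm B ^^ k) f x)"
  by (induction k) (simp_all add: helm_cmult smooth_helm_pow)

lemma helm_pow_add:
  "smooth f \<Longrightarrow> smooth g \<Longrightarrow> B \<subseteq> Basis \<Longrightarrow> (helm B ^^ k) (\<lambda>x. f x + g x) = (\<lambda>x. (helm B ^^ k) f x + (helm B ^^ k) g x)"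
  by (induction k) (simp_all add: helm_add smooth_helm_pow)

lemma osc_I_cmult:
  assumes "smooth b"
  shows "osc_I k (\<lambda>p. c * b p) = c * osc_I k b"
proof -
  have "osc_J k (\<lambda>p. c * b p) y = c * osc_J k b y" for y
    unfolding osc_J_def helm_pow_cmult[OF assms YB_Basis] fourier_cmult[symmetric] by (simp add: mult_ac)
  then show ?thesis by (simp add: osc_I_def)
qed

lemma osc_I_add:
  fixes f g :: "(real^'n) \<times> (real^'n) \<Rightarrow> complex"
  assumes f: "ubd1 (pw M M') f" and g: "ubd1 (pw M M') g" and k: "M' - 2 * real k \<le> - 2 * real CARD('n)"
  shows "osc_I k (\<lambda>p. f p + g p) = osc_I k f + osc_I k g"
proof -
  have sf: "smooth f" "smooth g" using ubd_smooth[OF f] ubd_smooth[OF g] by auto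
  have "osc_J k (\<lambda>p. f p + g p) y = osc_J k f y + osc_J k g y" for y
    unfolding osc_J_def helm_pow_add[OF sf YB_Basis] distrib_left fourier_def
    by (intro Bochner_Integration.integral_add integrable_cexp_mult ubd_integrable[OF osc_integrand_ubd1[OF f]] ubd_integrable[OF osc_integrand_ubd1[OF g]])
      (use k in auto)
  then show ?thesis
    using osc_J_integrable[OF f _ k] osc_J_integrable[OF g _ k] by (simp add: osc_I_def distrib_left)
qed

lemma osc_I_sum:
  fixes f :: "'j \<Rightarrow> (real^'n) \<times> (real^'n) \<Rightarrow> complex"
  assumes f: "\<And>j. j \<in> A \<Longrightarrow> ubd1 (pw M M') (f j)" and k: "M' - 2 * real k \<le> - 2 * real CARD('n)"
  shows "osc_I k (\<lambda>p. \<Sum>j\<in>A. f j p) = (\<Sum>j\<in>A. osc_I k (f j))"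
proof -
  have 0: "osc_I k (\<lambda>p. 0) = 0" using osc_I_cmult[OF smooth_const, of k 0 0] by simp
  show ?thesis using f
  proof (induction A rule: infinite_finite_induct)
    case (insert j A)
    have "ubd1 (pw M M') (\<lambda>p. \<Sum>j\<in>A. f j p)"
      using insert.prems by (intro ubd_sum) (auto intro: less_imp_le[OF pw_pos])
    then show ?case using insert osc_I_add[of M M' "f j" "\<lambda>p. \<Sum>j\<in>A. f j p" k] k by simp
  qed (simp_all add: 0)
qed

text \<open>On functions of \<eta> alone the operator 1 - \<Delta> in y is the identity, so what
  remains is Fourier inversion at 0, where \<open>wt\<close> equals 1.\<close>

lemma osc_I_independent:
  fixes g :: "real^'n \<Rightarrow> complex"
  assumes g: "ubd1 (\<lambda>\<eta>. jbracket \<eta> powr M') g" and k: "M' - 2 * real k \<le> - 2 * real CARD('n)"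
  shows "osc_I k (\<lambda>p. g (snd p)) = g 0"
proof -
  have "(helm YB ^^ k) (\<lambda>p. g (snd p)) (y, \<eta>) = g \<eta>" for y \<eta> :: "real^'n"
  proof -
    have "helm Basis (\<lambda>y::real^'n. c) = (\<lambda>y. c)" for c
      by (rule ext) (simp add: helm_def partial_deriv_const)
    then have "(helm Basis ^^ k) (\<lambda>y::real^'n. c) = (\<lambda>y. c)" for c
      by (induction k) auto
    then show ?thesis unfolding helm_pow_section_fst by simp
  qed
  then have J: "osc_J k (\<lambda>p. g (snd p)) y = fourier (\<lambda>\<eta>. wt \<eta> ^ k * g \<eta>) y" for y
    by (simp add: osc_J_def)
  have u: "ubd1 (\<lambda>\<eta>. jbracket \<eta> powr (M' - 2 * real k)) (\<lambda>\<eta>. wt \<eta> ^ k * g \<eta>)"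
    using ubd_mult[OF ubd_wt_pow[of k] g] by (simp add: powr_add[symmetric] algebra_simps)
  show ?thesis
    using fourier_inversion(1)[OF u _ k, of "()" 0] by (simp add: osc_I_def J wt_def)
qed

text \<open>Reduces differentiation to sequences, the setting of \<open>osc_I_tendsto\<close>. Steps
  are limited to |h| < 1 so that the parameter stays where uniform bounds are known.\<close>

lemma has_vector_derivative_sequentially:
  fixes f :: "real \<Rightarrow> complex"
  assumes "\<And>h. (\<And>m. h m \<noteq> 0) \<Longrightarrow> (\<And>m. \<bar>h m\<bar> < 1) \<Longrightarrow> h \<longlonglongrightarrow> 0 \<Longrightarrow>
    (\<lambda>m. complex_of_real (1 / h m) * (f (s + h m) - f s)) \<longlonglongrightarrow> D"
  shows "(f has_vector_derivative D) (at s)"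
proof -
  have "((\<lambda>h. complex_of_real (1 / h) * (f (s + h) - f s)) \<longlongrightarrow> D) (at 0 within ball 0 1)"
    unfolding tendsto_at_iff_sequentially o_def
    using assms by (auto simp: dist_real_def)
  then have "((\<lambda>h. complex_of_real (1 / h) * (f (s + h) - f s)) \<longlongrightarrow> D) (at 0)"
    by (subst (asm) at_within_open) auto
  then have "((\<lambda>h. norm (complex_of_real (1 / h) * (f (s + h) - f s) - D)) \<longlongrightarrow> 0) (at 0)"
    by (simp add: LIM_zero tendsto_norm_zero)
  then have "((\<lambda>h. norm (f (s + h) - f s - h *\<^sub>R D) / norm h) \<longlongrightarrow> 0) (at 0)"
  proof (rule Lim_transform_eventually)
    show "\<forall>\<^sub>F h in at 0. norm (complex_of_real (1 / h) * (f (s + h) - f s) - D) = norm (f (s + h) - f s - h *\<^sub>R D) / norm h"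
      unfolding eventually_at_filter
    proof (intro always_eventually allI impI)
      fix h :: real assume h: "h \<noteq> 0"
      have "f (s + h) - f s - h *\<^sub>R D = complex_of_real h * (complex_of_real (1 / h) * (f (s + h) - f s) - D)"
        using h by (simp add: algebra_simps scaleR_conv_of_real)
      then have "norm (f (s + h) - f s - h *\<^sub>R D) = norm h * norm (complex_of_real (1 / h) * (f (s + h) - f s) - D)"
        by (simp only: norm_mult norm_of_real real_norm_def)
      then show "norm (complex_of_real (1 / h) * (f (s + h) - f s) - D) = norm (f (s + h) - f s - h *\<^sub>R D) / norm h"
        using h by simp
    qed
  qed
  then show ?thesis
    unfolding has_vector_derivative_def has_derivative_at by (simp add: bounded_linear_scaleR_left)
qed

text \<open>The difference quotients form a bounded family by the mean value inequality and converge
  with all derivatives, so \<open>osc_I_tendsto\<close> exchanges the derivative with the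
  oscillatory integral.\<close>

lemma osc_I_has_vector_derivative:
  fixes B :: "real \<times> ((real^'n) \<times> (real^'n)) \<Rightarrow> complex"
  assumes B: "smooth B"
    and u: "ubd (pw M M') {s. \<bar>s - s0\<bar> < 1} (\<lambda>s p. B (s, p))"
    and u': "ubd (pw M M') {s. \<bar>s - s0\<bar> < 1} (\<lambda>s p. partial_deriv (1, 0) B (s, p))"
    and k: "M' - 2 * real k \<le> - 2 * real CARD('n)"
  shows "((\<lambda>s. osc_I k (\<lambda>p. B (s, p))) has_vector_derivative osc_I k (\<lambda>p. partial_deriv (1, 0) B (s0, p))) (at s0)"
proof (rule has_vector_derivative_sequentially)
  fix h :: "nat \<Rightarrow> real"
  assume h0: "\<And>m. h m \<noteq> 0" and h1: "\<And>m. \<bar>h m\<bar> < 1" and hl: "h \<longlonglongrightarrow> 0"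
  let ?I = "{s. \<bar>s - s0\<bar> < 1}"
  define b where "b m p = complex_of_real (1 / h m) * (B (s0 + h m, p) - B (s0, p))" for m p
  have b1: "(1, 0) \<in> (Basis :: (real \<times> ((real^'n) \<times> (real^'n))) set)" by simp
  have sB: "smooth (\<lambda>p. B (s, p))" for s by (rule smooth_section_snd[OF B])
  have sb: "smooth (b m)" for m unfolding b_def by (intro smooth_cmult smooth_diff sB)
  have ib: "iter_partial bs (b m) p = complex_of_real (1 / h m) *
      (iter_partial (map (Pair 0) bs) B (s0 + h m, p) - iter_partial (map (Pair 0) bs) B (s0, p))"
    if "set bs \<subseteq> Basis" for bs m p
    unfolding b_def iter_partial_cmult[OF smooth_diff[OF sB sB] that] iter_partial_diff[OF sB sB that]
      iter_partial_section_snd ..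
  \<comment> \<open>The derivative in the parameter commutes with those in p. Hence every
    p-derivative of B is differentiable in s, and its s-derivative is one of the functions bounded
    by \<open>u'\<close>.\<close>
  have der: "((\<lambda>s. iter_partial (map (Pair 0) bs) B (s, p)) has_vector_derivative
      iter_partial bs (\<lambda>p. partial_deriv (1, 0) B (s, p)) p) (at s)" if bs: "set bs \<subseteq> Basis" for bs s p
  proof -
    have bs': "set (map (Pair (0::real)) bs) \<subseteq> Basis" using bs by auto
    have "((\<lambda>t. iter_partial (map (Pair 0) bs) B ((0, p) + t *\<^sub>R (1, 0))) has_vector_derivative
       partial_deriv (1, 0) (iter_partial (map (Pair 0) bs) B) ((0, p) + s *\<^sub>R (1, 0))) (at s)"
      by (rule smooth_has_vector_derivative[OF smooth_iter_partial[OF B bs'] b1])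
    then show ?thesis
      by (simp add: iter_partial_section_snd iter_partial_commute1[OF B b1 bs'])
  qed
  have ub: "ubd (pw M M') UNIV b"
  proof (rule ubdI)
    fix bs :: "((real^'n) \<times> (real^'n)) list" assume bs: "set bs \<subseteq> Basis"
    obtain C where C: "C \<ge> 0" "\<And>s p. s \<in> ?I \<Longrightarrow> norm (iter_partial bs (\<lambda>p. partial_deriv (1, 0) B (s, p)) p) \<le> C * pw M M' p"
      using ubdE[OF u' bs] by metis
    have "norm (iter_partial bs (b m) p) \<le> C * pw M M' p" for m p
    proof -
      have conv: "convex ?I" using convex_ball[of s0 1] by (simp add: ball_def dist_real_def abs_minus_commute)
      have "norm (iter_partial (map (Pair 0) bs) B (s0 + h m, p) - iter_partial (map (Pair 0) bs) B (s0, p)) \<le>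
          (C * pw M M' p) * norm (s0 + h m - s0)"
      proof (rule differentiable_bound[OF conv, where f'="\<lambda>s k. k *\<^sub>R iter_partial bs (\<lambda>p. partial_deriv (1, 0) B (s, p)) p"])
        fix s assume s: "s \<in> ?I"
        show "((\<lambda>s. iter_partial (map (Pair 0) bs) B (s, p)) has_derivative
            (\<lambda>k. k *\<^sub>R iter_partial bs (\<lambda>p. partial_deriv (1, 0) B (s, p)) p)) (at s within ?I)"
          using der[OF bs] unfolding has_vector_derivative_def by (rule has_derivative_at_withinI)
        show "onorm (\<lambda>k. k *\<^sub>R iter_partial bs (\<lambda>p. partial_deriv (1, 0) B (s, p)) p) \<le> C * pw M M' p"
          by (rule onorm_le) (use mult_right_mono[OF C(2)[OF s]] in \<open>simp add: mult.commute\<close>)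
      qed (use h1 in auto)
      then show ?thesis unfolding ib[OF bs] norm_mult norm_of_real
        using h0[of m] by (simp add: field_simps)
    qed
    then show "\<exists>C. \<forall>m\<in>UNIV. \<forall>p. norm (iter_partial bs (b m) p) \<le> C * pw M M' p" by blast
  qed (auto intro: sb less_imp_le[OF pw_pos])
  have pc: "pconv b (\<lambda>p. partial_deriv (1, 0) B (s0, p))"
    unfolding pconv_def
  proof (intro conjI allI impI sb)
    show "smooth (\<lambda>p. partial_deriv (1, 0) B (s0, p))"
      by (rule smooth_section_snd[OF smooth_partial_deriv[OF B b1]])
    fix bs :: "((real^'n) \<times> (real^'n)) list" and p assume bs: "set bs \<subseteq> Basis"
    let ?G = "\<lambda>s. iter_partial (map (Pair 0) bs) B (s, p)"
    let ?D = "iter_partial bs (\<lambda>p. partial_deriv (1, 0) B (s0, p)) p"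
    have "((\<lambda>k. norm (?G (s0 + k) - ?G s0 - k *\<^sub>R ?D) / norm k) \<longlongrightarrow> 0) (at 0)"
      using der[OF bs, of p s0] unfolding has_vector_derivative_def has_derivative_at by simp
    then have "(\<lambda>m. norm (?G (s0 + h m) - ?G s0 - h m *\<^sub>R ?D) / norm (h m)) \<longlonglongrightarrow> 0"
      by (rule filterlim_compose) (use h0 hl in \<open>auto simp: filterlim_at\<close>)
    moreover have "norm (?G (s0 + h m) - ?G s0 - h m *\<^sub>R ?D) / norm (h m) = norm (iter_partial bs (b m) p - ?D)" for m
    proof -
      have "iter_partial bs (b m) p - ?D = complex_of_real (1 / h m) * (?G (s0 + h m) - ?G s0 - h m *\<^sub>R ?D)"
        unfolding ib[OF bs] using h0[of m] by (simp add: right_diff_distrib scaleR_conv_of_real)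
      then show ?thesis using h0[of m] by (simp add: norm_mult norm_divide)
    qed
    ultimately have "(\<lambda>m. norm (iter_partial bs (b m) p - ?D)) \<longlonglongrightarrow> 0" by simp
    then show "(\<lambda>m. iter_partial bs (b m) p) \<longlonglongrightarrow> ?D"
      by (simp add: tendsto_norm_zero_iff LIM_zero_iff)
  qed
  have "osc_I k (b m) = complex_of_real (1 / h m) * (osc_I k (\<lambda>p. B (s0 + h m, p)) - osc_I k (\<lambda>p. B (s0, p)))" for m
  proof -
    have s: "s0 + h m \<in> ?I" "s0 \<in> ?I" using h1[of m] by auto
    have "osc_I k (\<lambda>p. B (s0 + h m, p) + (-1) * B (s0, p)) = osc_I k (\<lambda>p. B (s0 + h m, p)) + (-1) * osc_I k (\<lambda>p. B (s0, p))"
      by (subst osc_I_add[OF ubd1I[OF u s(1)] ubd_cmult[OF ubd1I[OF u s(2)]] k]) (subst osc_I_cmult[OF sB], rule refl)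
    then show ?thesis unfolding b_def by (subst osc_I_cmult) (auto intro: smooth_diff sB)
  qed
  then show "(\<lambda>m. complex_of_real (1 / h m) * (osc_I k (\<lambda>p. B (s0 + h m, p)) - osc_I k (\<lambda>p. B (s0, p)))) \<longlonglongrightarrow>
      osc_I k (\<lambda>p. partial_deriv (1, 0) B (s0, p))"
    using osc_I_tendsto[OF ub k pc] by simp
qed

lemma integrable_osc_plain:
  fixes b :: "(real^'n) \<times> (real^'n) \<Rightarrow> complex"
  assumes c: "continuous_on UNIV b" and b: "\<And>p. norm (b p) \<le> C * pw s s p" and s: "s \<le> - 2 * real CARD('n)"
  shows "integrable (lborel \<Otimes>\<^sub>M lborel) (\<lambda>(y, \<eta>). exp (- \<i> * complex_of_real (y \<bullet> \<eta>)) * b (y, \<eta>))"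
proof (rule integrable_prod_bound)
  show "(\<lambda>(y, \<eta>). exp (- \<i> * complex_of_real (y \<bullet> \<eta>)) * b (y, \<eta>)) \<in> borel_measurable borel"
    unfolding case_prod_beta prod.collapse by (intro borel_measurable_continuous_onI continuous_intros c)
  show "integrable lborel (\<lambda>y::real^'n. C * jbracket y powr s)" "integrable lborel (\<lambda>\<eta>::real^'n. jbracket \<eta> powr s)"
    using s by (auto intro!: integrable_jbracket)
  show "norm (case (y, \<eta>) of (y, \<eta>) \<Rightarrow> exp (- \<i> * complex_of_real (y \<bullet> \<eta>)) * b (y, \<eta>)) \<le> C * jbracket y powr s * jbracket \<eta> powr s" for y \<eta> :: "real^'n"
    using b[of "(y, \<eta>)"] by (simp add: norm_mult pw_def mult.assoc)
qed

lemma wt_mult: "wt x ^ k * complex_of_real (1 + x \<bullet> x) ^ k = 1"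
proof -
  have "1 + x \<bullet> x \<noteq> 0" using inner_ge_zero[of x] by linarith
  then show ?thesis unfolding wt_def power_mult_distrib[symmetric] of_real_mult[symmetric] by simp
qed

text \<open>For amplitudes decaying in both variables Fubini puts the y-integral inside; there (1 -
  \<Delta>)^k becomes (1 + |\<eta>|^2)^k and cancels the weight. In particular the value does not
  depend on k.\<close>

lemma osc_I_plain:
  fixes b :: "(real^'n) \<times> (real^'n) \<Rightarrow> complex"
  assumes b: "ubd1 (pw s s) b" and s: "s \<le> - 2 * real CARD('n)"
  shows "osc_I k b = complex_of_real (1 / (2 * pi) ^ CARD('n)) *
      (LINT \<eta>|lborel. LINT y|lborel. exp (- \<i> * complex_of_real (y \<bullet> \<eta>)) * b (y, \<eta>))"
    and "osc_I k b = complex_of_real (1 / (2 * pi) ^ CARD('n)) * (LINT y|lborel. fourier (\<lambda>\<eta>. b (y, \<eta>)) y)"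
proof -
  let ?h = "(helm YB ^^ k) b"
  have uh: "ubd1 (pw s s) ?h" by (rule ubd_helm_pow[OF b YB_Basis])
  obtain D where D: "\<And>x. norm (?h x) \<le> D * pw s s x" by (rule ubdE0[OF uh]) blast
  have nw: "norm (wt \<eta> ^ k) \<le> 1" for \<eta> :: "real^'n"
    unfolding norm_power norm_wt by (intro power_le_one) (use jbracket_powr_mono[of "-2" 0 \<eta>] in \<open>auto simp:\<close>)
  have cw: "continuous_on UNIV (\<lambda>p. wt (snd p :: real^'n) ^ k * ?h p)"
    using osc_integrand_continuous[of b k] ubd_smooth[OF b] by (simp add: case_prod_beta)
  have "norm (wt (snd p) ^ k * ?h p) \<le> D * pw s s p" for p
    unfolding norm_mult using mult_mono[OF nw D] by simp
  note I = integrable_osc_plain[OF cw this s]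
  have "(LINT y|lborel. osc_J k b y) = (LINT y|lborel. LINT \<eta>|lborel. exp (- \<i> * complex_of_real (y \<bullet> \<eta>)) * (wt \<eta> ^ k * ?h (y, \<eta>)))"
    unfolding osc_J_def fourier_def by (simp add: inner_commute)
  also have "\<dots> = (LINT \<eta>|lborel. LINT y|lborel. exp (- \<i> * complex_of_real (y \<bullet> \<eta>)) * (wt \<eta> ^ k * ?h (y, \<eta>)))"
    using lborel_pair.Fubini_integral[OF I] by simp
  also have "\<dots> = (LINT \<eta>|lborel. LINT y|lborel. exp (- \<i> * complex_of_real (y \<bullet> \<eta>)) * b (y, \<eta>))"
  proof (rule Bochner_Integration.integral_cong[OF refl])
    fix \<eta> :: "real^'n"
    have "(LINT y|lborel. exp (- \<i> * complex_of_real (y \<bullet> \<eta>)) * (wt \<eta> ^ k * ?h (y, \<eta>))) = wt \<eta> ^ k * fourier (\<lambda>y. ?h (y, \<eta>)) \<eta>"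
      using fourier_cmult[of "wt \<eta> ^ k" "\<lambda>y. ?h (y, \<eta>)" \<eta>] by (simp add: fourier_def)
    also have "(\<lambda>y. ?h (y, \<eta>)) = (helm Basis ^^ k) (\<lambda>y. b (y, \<eta>))"
      by (rule ext) (rule helm_pow_section_fst)
    also have "fourier \<dots> \<eta> = complex_of_real (1 + \<eta> \<bullet> \<eta>) ^ k * fourier (\<lambda>y. b (y, \<eta>)) \<eta>"
      by (rule fourier_helm_pow[OF ubd1_section_fst[OF b] UNIV_I s])
    finally have "(LINT y|lborel. exp (- \<i> * complex_of_real (y \<bullet> \<eta>)) * (wt \<eta> ^ k * ?h (y, \<eta>))) =
        (wt \<eta> ^ k * complex_of_real (1 + \<eta> \<bullet> \<eta>) ^ k) * fourier (\<lambda>y. b (y, \<eta>)) \<eta>" by (simp only: mult.assoc helm_pow_section_fst)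
    then show "(LINT y|lborel. exp (- \<i> * complex_of_real (y \<bullet> \<eta>)) * (wt \<eta> ^ k * ?h (y, \<eta>))) = (LINT y|lborel. exp (- \<i> * complex_of_real (y \<bullet> \<eta>)) * b (y, \<eta>))"
      unfolding wt_mult fourier_def by simp
  qed
  finally have 1: "(LINT y|lborel. osc_J k b y) = (LINT \<eta>|lborel. LINT y|lborel. exp (- \<i> * complex_of_real (y \<bullet> \<eta>)) * b (y, \<eta>))" .
  then show "osc_I k b = complex_of_real (1 / (2 * pi) ^ CARD('n)) *
      (LINT \<eta>|lborel. LINT y|lborel. exp (- \<i> * complex_of_real (y \<bullet> \<eta>)) * b (y, \<eta>))"
    by (simp add: osc_I_def)
  obtain E where E: "\<And>x. norm (b x) \<le> E * pw s s x" by (rule ubdE0[OF b]) blast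
  have cb: "continuous_on UNIV b" by (rule smooth_continuous[OF ubd_smooth[OF b UNIV_I]])
  have "(LINT \<eta>|lborel. LINT y|lborel. exp (- \<i> * complex_of_real (y \<bullet> \<eta>)) * b (y, \<eta>)) = (LINT y|lborel. fourier (\<lambda>\<eta>. b (y, \<eta>)) y)"
    using lborel_pair.Fubini_integral[OF integrable_osc_plain[OF cb E s]] by (simp add: fourier_def inner_commute)
  then show "osc_I k b = complex_of_real (1 / (2 * pi) ^ CARD('n)) * (LINT y|lborel. fourier (\<lambda>\<eta>. b (y, \<eta>)) y)"
    using 1 by (simp add: osc_I_def)
qed

section \<open>Cutoff functions\<close>

text \<open>On a ball the quotient of a derivative by a positive continuous weight is bounded;
  outside the ball every derivative vanishes.\<close>

lemma ubd1_compact_support: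
  fixes f :: "'a::euclidean_space \<Rightarrow> complex"
  assumes f: "smooth f" and supp: "\<And>x. R < norm x \<Longrightarrow> f x = 0"
    and w: "continuous_on UNIV w" "\<And>x. 0 < w x"
  shows "ubd1 w f"
proof (rule ubdI)
  fix bs :: "'a list" assume bs: "set bs \<subseteq> Basis"
  have 0: "iter_partial bs f x = 0" if "R < norm x" for x
  proof -
    have "iter_partial bs (\<lambda>x. 0) = (\<lambda>x. 0 :: complex)" by (induction bs) (auto simp: partial_deriv_const)
    moreover have "open {x::'a. R < norm x}" by (intro open_Collect_less continuous_intros)
    ultimately show ?thesis
      using iter_partial_cong_open[of "{x. R < norm x}" f "\<lambda>x. 0" x bs] supp that by simp
  qed
  have "continuous_on (cball 0 R) (\<lambda>x. norm (iter_partial bs f x) / w x)"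
    by (intro continuous_on_divide continuous_on_norm continuous_on_subset[OF smooth_continuous[OF smooth_iter_partial[OF f bs]]]
        continuous_on_subset[OF w(1)]) (auto simp: less_imp_neq[OF w(2), THEN not_sym])
  then have "bounded ((\<lambda>x. norm (iter_partial bs f x) / w x) ` cball 0 R)"
    by (intro compact_imp_bounded compact_continuous_image) auto
  then obtain C where C: "\<And>x. x \<in> cball 0 R \<Longrightarrow> norm (norm (iter_partial bs f x) / w x) \<le> C"
    unfolding bounded_iff by blast
  have "norm (iter_partial bs f x) \<le> \<bar>C\<bar> * w x" for x
  proof (cases "norm x \<le> R")
    case True
    then have "norm (iter_partial bs f x) / w x \<le> \<bar>C\<bar>" using C[of x] w(2)[of x] by simp
    then show ?thesis using w(2)[of x] by (simp add: pos_divide_le_eq)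
  next
    case False
    then show ?thesis using 0[of x] w(2)[of x] by simp
  qed
  then show "\<exists>C. \<forall>i\<in>UNIV. \<forall>x. norm (iter_partial bs f x) \<le> C * w x" by blast
qed (use f w in \<open>auto intro: less_imp_le\<close>)

lemma cutoff_support:
  assumes "cutoff \<gamma>" obtains R where "\<And>p. R < norm p \<Longrightarrow> \<gamma> p = 0"
proof -
  have "bounded (closure {p. \<gamma> p \<noteq> 0})" using assms by (auto simp: cutoff_def intro: compact_imp_bounded)
  then obtain R where "\<And>p. p \<in> closure {p. \<gamma> p \<noteq> 0} \<Longrightarrow> norm p \<le> R" by (auto simp: bounded_iff)
  then show ?thesis using closure_subset[of "{p. \<gamma> p \<noteq> 0}"] by (intro that[of R]) force
qed

lemma smooth_scaled:
  fixes \<gamma> :: "'a::euclidean_space \<Rightarrow> complex"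
  shows "smooth \<gamma> \<Longrightarrow> smooth (\<lambda>p. \<gamma> (c + \<epsilon> *\<^sub>R p))"
  by (rule smooth_compose[where \<phi>="\<lambda>p. c + \<epsilon> *\<^sub>R p"]) (auto intro: smooth_affine bounded_linear_scaleR_right)

text \<open>For fixed \<epsilon> the cutoff decays to every order, which makes cut-off amplitudes
  integrable, but the constants depend on \<epsilon> and c. The uniform counterpart, without decay,
  is \<open>cutoff_scaled_ubd\<close>.\<close>

lemma cutoff_scaled_ubd1:
  fixes \<gamma> :: "(real^'n) \<times> (real^'n) \<Rightarrow> complex"
  assumes \<gamma>: "cutoff \<gamma>" and \<epsilon>: "\<epsilon> > 0"
  shows "ubd1 (pw s s') (\<lambda>p. \<gamma> (c + \<epsilon> *\<^sub>R p))"
proof -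
  obtain R where R: "\<And>p. R < norm p \<Longrightarrow> \<gamma> p = 0" using cutoff_support[OF \<gamma>] by blast
  show ?thesis
  proof (rule ubd1_compact_support[where R="(R + norm c) / \<epsilon>"])
    show "smooth (\<lambda>p. \<gamma> (c + \<epsilon> *\<^sub>R p))" using \<gamma> by (intro smooth_scaled) (simp add: cutoff_def)
    fix p :: "(real^'n) \<times> (real^'n)" assume "(R + norm c) / \<epsilon> < norm p"
    then have "R < norm (\<epsilon> *\<^sub>R p) - norm c" using \<epsilon> by (simp add: field_simps)
    also have "\<dots> \<le> norm (c + \<epsilon> *\<^sub>R p)" using norm_triangle_ineq4[of "c + \<epsilon> *\<^sub>R p" c] by simp
    finally show "\<gamma> (c + \<epsilon> *\<^sub>R p) = 0" by (rule R)
  next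
    show "continuous_on UNIV (pw s s' :: (real^'n) \<times> (real^'n) \<Rightarrow> real)"
      unfolding pw_def[abs_def] by (intro continuous_intros)
  qed (rule pw_pos)
qed

text \<open>Each derivative contributes a factor \<epsilon> \<le> 1, so the constants are those of
  \<gamma> itself, uniformly in \<epsilon> and in the centre.\<close>

lemma cutoff_scaled_ubd:
  fixes \<gamma> :: "(real^'n) \<times> (real^'n) \<Rightarrow> complex"
  assumes \<gamma>: "cutoff \<gamma>"
  shows "ubd (pw 0 0) ({0..1} \<times> UNIV) (\<lambda>j p. \<gamma> (snd j + fst j *\<^sub>R p))"
proof (rule ubdI)
  have sg: "smooth \<gamma>" using \<gamma> by (simp add: cutoff_def)
  then show "smooth (\<lambda>p. \<gamma> (snd j + fst j *\<^sub>R p))" for j :: "real \<times> _" by (rule smooth_scaled)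
  fix bs :: "((real^'n) \<times> (real^'n)) list" assume bs: "set bs \<subseteq> Basis"
  obtain C where C: "C \<ge> 0" "\<And>x. norm (iter_partial bs \<gamma> x) \<le> C * pw 0 0 x"
    using ubdE[OF cutoff_scaled_ubd1[OF \<gamma>, of 1 0 0 0] bs] by auto
  have pw0: "pw 0 0 (x :: (real^'n) \<times> (real^'n)) = 1" for x by (simp add: pw_def)
  have "norm (iter_partial bs (\<lambda>p. \<gamma> (c + \<epsilon> *\<^sub>R p)) p) \<le> C" if e: "\<epsilon> \<in> {0..1}" for \<epsilon> c p
  proof -
    have "iter_partial bs (\<lambda>p. \<gamma> (c + \<epsilon> *\<^sub>R p)) = (\<lambda>p. prod_list (map (\<lambda>_. \<epsilon>) bs) *\<^sub>R iter_partial (map (\<lambda>b. b) bs) \<gamma> (c + \<epsilon> *\<^sub>R p))"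
      by (rule iter_partial_affine[OF sg]) (auto simp: partial_deriv_linear bounded_linear_scaleR_right bs intro: smooth_affine)
    then have "norm (iter_partial bs (\<lambda>p. \<gamma> (c + \<epsilon> *\<^sub>R p)) p) = \<epsilon> ^ length bs * norm (iter_partial bs \<gamma> (c + \<epsilon> *\<^sub>R p))"
      using e by (simp add: map_replicate_const prod_list_replicate power_abs)
    also have "\<dots> \<le> 1 * (C * pw 0 0 (c + \<epsilon> *\<^sub>R p))" using e C by (intro mult_mono power_le_one) auto
    finally show ?thesis by (simp add: pw0)
  qed
  then show "\<exists>C. \<forall>j\<in>{0..1} \<times> UNIV. \<forall>p. norm (iter_partial bs (\<lambda>p. \<gamma> (snd j + fst j *\<^sub>R p)) p) \<le> C * pw 0 0 p"
    by (intro exI[of _ C]) (auto simp: pw0)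
qed (rule less_imp_le[OF pw_pos])

text \<open>A whole neighbourhood of p is asked for, because the derivatives of the cut-off
  amplitude at p must agree with those of the amplitude, not only the values.\<close>

lemma cutoff_eventually_1:
  fixes \<gamma> :: "(real^'n) \<times> (real^'n) \<Rightarrow> complex"
  assumes \<gamma>: "cutoff \<gamma>" and \<epsilon>: "\<epsilon> \<longlonglongrightarrow> 0"
  shows "\<forall>\<^sub>F m in sequentially. \<exists>S. open S \<and> p \<in> S \<and> (\<forall>q\<in>S. \<gamma> (\<epsilon> m *\<^sub>R c + \<epsilon> m *\<^sub>R q) = 1)"
proof -
  obtain U where U: "open U" "0 \<in> U" "\<And>x. x \<in> U \<Longrightarrow> \<gamma> x = 1"
    using \<gamma> unfolding cutoff_def eventually_nhds by auto
  have "(\<lambda>m. \<epsilon> m *\<^sub>R c + \<epsilon> m *\<^sub>R p) \<longlonglongrightarrow> 0 *\<^sub>R c + 0 *\<^sub>R p" by (intro tendsto_intros \<epsilon>)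
  then have "\<forall>\<^sub>F m in sequentially. \<epsilon> m *\<^sub>R c + \<epsilon> m *\<^sub>R p \<in> U" using U by (auto simp: tendsto_def)
  then show ?thesis
  proof eventually_elim
    case (elim m)
    have "open ((\<lambda>q. \<epsilon> m *\<^sub>R c + \<epsilon> m *\<^sub>R q) -` U)"
      by (rule open_vimage[OF U(1)]) (intro continuous_intros)
    then show ?case using elim U(3) by (intro exI[of _ "(\<lambda>q. \<epsilon> m *\<^sub>R c + \<epsilon> m *\<^sub>R q) -` U"]) auto
  qed
qed

lemma pconv_cutoff:
  fixes \<gamma> :: "(real^'n) \<times> (real^'n) \<Rightarrow> complex"
  assumes \<gamma>: "cutoff \<gamma>" and \<epsilon>: "\<epsilon> \<longlonglongrightarrow> 0" and b: "smooth b"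
  shows "pconv (\<lambda>m p. b p * \<gamma> (\<epsilon> m *\<^sub>R c + \<epsilon> m *\<^sub>R p)) b"
  unfolding pconv_def
proof (intro conjI allI impI b)
  show "smooth (\<lambda>p. b p * \<gamma> (\<epsilon> m *\<^sub>R c + \<epsilon> m *\<^sub>R p))" for m
    using \<gamma> by (intro smooth_mult b smooth_scaled) (simp add: cutoff_def)
  fix bs p
  have "\<forall>\<^sub>F m in sequentially. iter_partial bs b p = iter_partial bs (\<lambda>p. b p * \<gamma> (\<epsilon> m *\<^sub>R c + \<epsilon> m *\<^sub>R p)) p"
    using cutoff_eventually_1[OF \<gamma> \<epsilon>, of p c]
  proof eventually_elim
    case (elim m)
    then obtain S where "open S" "p \<in> S" "\<And>q. q \<in> S \<Longrightarrow> \<gamma> (\<epsilon> m *\<^sub>R c + \<epsilon> m *\<^sub>R q) = 1" by blast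
    then show ?case by (intro iter_partial_cong_open[of S]) auto
  qed
  then show "(\<lambda>m. iter_partial bs (\<lambda>p. b p * \<gamma> (\<epsilon> m *\<^sub>R c + \<epsilon> m *\<^sub>R p)) p) \<longlonglongrightarrow> iter_partial bs b p"
    by (rule Lim_transform_eventually[OF tendsto_const])
qed

lemma pconv_partial:
  assumes "pconv b b0" "e \<in> Basis"
  shows "pconv (\<lambda>m. partial_deriv e (b m)) (partial_deriv e b0)"
  unfolding pconv_def
proof (intro conjI allI impI)
  fix bs :: "'a list" and p assume "set bs \<subseteq> Basis"
  then have "set (bs @ [e]) \<subseteq> Basis" using assms by auto
  then have "(\<lambda>i. iter_partial (bs @ [e]) (b i) p) \<longlonglongrightarrow> iter_partial (bs @ [e]) b0 p"
    using assms(1) unfolding pconv_def by blast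
  then show "(\<lambda>i. iter_partial bs (partial_deriv e (b i)) p) \<longlonglongrightarrow> iter_partial bs (partial_deriv e b0) p" by simp
qed (use assms in \<open>auto simp: pconv_def intro: smooth_partial_deriv\<close>)

text \<open>The substitution \<open>s = 1/t\<close> makes this family closed under differentiation.\<close>
definition flat :: "real poly \<Rightarrow> real \<Rightarrow> real" where
  "flat P t = (if t > 0 then poly P (1 / t) * exp (- (1 / t)) else 0)"

lemma flat_tendsto_0: "(flat P \<longlongrightarrow> 0) (at 0)"
proof -
  have "((\<lambda>s. poly P s * exp (- s)) \<longlongrightarrow> 0) at_top"
  proof -
    have "((\<lambda>s. \<Sum>i\<le>degree P. coeff P i * (s ^ i / exp s)) \<longlongrightarrow> (\<Sum>i\<le>degree P. coeff P i * 0)) at_top"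
      by (intro tendsto_sum tendsto_mult tendsto_const tendsto_power_div_exp_0)
    then show ?thesis by (simp add: poly_altdef sum_distrib_right exp_minus divide_inverse mult.assoc)
  qed
  from filterlim_compose[OF this filterlim_inverse_at_top_right]
  have "((\<lambda>t. poly P (inverse t) * exp (- inverse t)) \<longlongrightarrow> 0) (at_right 0)" .
  then have R: "(flat P \<longlongrightarrow> 0) (at_right 0)"
    by (rule Lim_transform_eventually) (auto simp: flat_def inverse_eq_divide eventually_at_filter)
  have L: "(flat P \<longlongrightarrow> 0) (at_left 0)"
    by (rule Lim_transform_eventually[OF tendsto_const]) (auto simp: flat_def eventually_at_filter)
  show ?thesis by (rule filterlim_split_at[OF L R])
qed

text \<open>With s = 1/t one has ds/dt = -s^2, so P(s) exp(-s) has t-derivative s^2 (P - P')(s)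
  exp(-s); the polynomial \<open>[:0, 0, 1:]\<close> is s^2.\<close>

lemma flat_deriv: "(flat P has_real_derivative flat ([:0, 0, 1:] * (P - pderiv P)) t) (at t)"
proof -
  consider "t > 0" | "t < 0" | "t = 0" by linarith
  then show ?thesis
  proof cases
    case 1
    have "((\<lambda>t. poly P (1 / t) * exp (- (1 / t))) has_real_derivative
        flat ([:0, 0, 1:] * (P - pderiv P)) t) (at t)"
      using 1 by (auto intro!: derivative_eq_intros DERIV_chain2[OF poly_DERIV] simp: flat_def field_simps power2_eq_square)
    then show ?thesis
      by (rule DERIV_cong_ev[THEN iffD1, rotated -1, OF _ refl _ refl])
        (use 1 eventually_nhds_in_open[of "{0<..}" t] in \<open>auto simp: flat_def elim!: eventually_mono\<close>)
  next
    case 2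
    have "((\<lambda>t. 0) has_real_derivative flat ([:0, 0, 1:] * (P - pderiv P)) t) (at t)"
      using 2 by (auto simp: flat_def)
    then show ?thesis
      by (rule DERIV_cong_ev[THEN iffD1, rotated -1, OF _ refl _ refl])
        (use 2 eventually_nhds_in_open[of "{..<0}" t] in \<open>auto simp: flat_def elim!: eventually_mono\<close>)
  next
    case 3
    \<comment> \<open>At 0 the difference quotient of \<open>flat P\<close> is the flat function of
      the polynomial s P(s), which tends to 0.\<close>
    have "((\<lambda>h. (flat P (0 + h) - flat P 0) / h) \<longlongrightarrow> 0) (at 0)"
      by (rule Lim_transform_eventually[OF flat_tendsto_0[of "[:0, 1:] * P"]])
        (auto simp: flat_def eventually_at_filter)
    then show ?thesis using 3 by (simp add: DERIV_def flat_def)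
  qed
qed

lemma smooth_flat: "smooth (flat P)"
proof (rule smooth_coinduct[where X="range flat"])
  fix f :: "real \<Rightarrow> real" assume "f \<in> range flat"
  then obtain P where f: "f = flat P" by auto
  have D: "(f has_derivative (\<lambda>h. h * flat ([:0, 0, 1:] * (P - pderiv P)) t)) (at t)" for t
    using flat_deriv[of P t] unfolding f has_field_derivative_def by (rule has_derivative_eq_rhs) (simp add: fun_eq_iff)
  show "continuous_on UNIV f"
    by (intro continuous_at_imp_continuous_on ballI) (rule has_derivative_continuous[OF D])
  show "(\<lambda>t::real. f (x + t *\<^sub>R b)) differentiable at 0" for x b
    by (rule has_derivative_imp_differentiable_dir[OF D])
  fix b :: real assume "b \<in> Basis"
  then have "partial_deriv b f = flat ([:0, 0, 1:] * (P - pderiv P))"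
    using partial_deriv_has_derivative[OF D] by auto
  then show "partial_deriv b f \<in> range flat" by auto
qed auto

text \<open>\<open>has_osc_value\<close> quantifies over all cutoffs and would hold for every L if
  there were none; existence is what makes the oscillatory value unique. It also supplies the cutoff
  in \<open>osc_I_coord\<close>.\<close>

lemma cutoff_exists: "\<exists>\<gamma> :: (real^'n) \<times> (real^'n) \<Rightarrow> complex. cutoff \<gamma>"
proof -
  \<comment> \<open>The factor \<open>exp 1\<close> normalises \<open>flat 1\<close> to take the
    value 1 at 1. The subtracted term is 0 for t \<le> 1 and at least 1 for t \<ge> 2, so \<psi> is
    1 on the first range and 0 on the second.\<close>
  define \<psi> where "\<psi> t = exp 1 * flat 1 (1 - exp 1 * flat 1 (t - 1))" for t
  define \<gamma> :: "(real^'n) \<times> (real^'n) \<Rightarrow> complex" where "\<gamma> p = complex_of_real (\<psi> (p \<bullet> p))" for p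
  have 1: "\<psi> t = 1" if "t < 1" for t
    using that by (simp add: \<psi>_def flat_def flip: exp_add)
  have 0: "\<psi> t = 0" if "t > 3" for t
  proof -
    have "1 / (t - 1) \<le> 1" using that by simp
    then have "1 \<le> exp 1 * exp (- (1 / (t - 1)))" by (simp flip: exp_add)
    then show ?thesis using that by (simp add: \<psi>_def flat_def)
  qed
  have s1: "smooth \<psi>"
  proof -
    have "smooth (\<lambda>t::real. flat 1 (t - 1))"
      by (rule smooth_compose[OF smooth_flat]) (intro smooth_diff smooth_const smooth_linear bounded_linear_ident)
    then have "smooth (\<lambda>t. 1 - exp 1 * flat 1 (t - 1))"
      by (intro smooth_diff smooth_const smooth_cmult)
    then show ?thesis unfolding \<psi>_def[abs_def] by (intro smooth_cmult smooth_compose[OF smooth_flat])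
  qed
  have "smooth \<gamma>"
    unfolding \<gamma>_def[abs_def]
    by (intro smooth_bounded_linear[OF bounded_linear_of_real] smooth_compose[OF s1]
        smooth_bilinear[OF bounded_bilinear_inner] smooth_linear bounded_linear_ident)
  moreover have "compact (closure {p. \<gamma> p \<noteq> 0})"
  proof -
    have "norm p \<le> 2" if "\<gamma> p \<noteq> 0" for p
    proof (rule power2_le_imp_le)
      have "p \<bullet> p \<le> 3" using that 0[of "p \<bullet> p"] by (force simp: \<gamma>_def)
      then show "(norm p)\<^sup>2 \<le> 2\<^sup>2" by (simp add: power2_norm_eq_inner)
    qed simp
    then show ?thesis by (auto simp: bounded_iff)
  qed
  moreover have "\<forall>\<^sub>F p in nhds 0. \<gamma> p = 1"
    unfolding eventually_nhds
    by (intro exI[of _ "{p. p \<bullet> p < 1}"]) (auto simp: \<gamma>_def 1 intro!: open_Collect_less continuous_intros)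
  ultimately show ?thesis unfolding cutoff_def by blast
qed

section \<open>Multiplication by a coordinate and integration by parts in \<eta>\<close>

lemma ubd_coord_fst:
  fixes e :: "'a::euclidean_space"
  assumes e: "e \<in> Basis"
  shows "ubd1 (pw 1 0) (\<lambda>p :: 'a \<times> 'b::euclidean_space. complex_of_real (fst p \<bullet> e))"
proof (rule ubdI)
  let ?L = "\<lambda>p :: 'a \<times> 'b. complex_of_real (fst p \<bullet> e)"
  have L: "bounded_linear ?L"
    by (intro bounded_linear_compose[OF bounded_linear_of_real] bounded_linear_compose[OF bounded_linear_inner_left] bounded_linear_fst)
  then show "smooth ?L" by (rule smooth_linear)
  fix bs :: "('a \<times> 'b) list" assume bs: "set bs \<subseteq> Basis"
  have ge1: "1 \<le> pw 1 0 p" for p :: "'a \<times> 'b"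
    using jbracket_ge_1[of "fst p"] by (simp add: pw_def less_imp_le)
  have pd: "partial_deriv b ?L = (\<lambda>p. ?L b)" for b
    using partial_deriv_linear[OF L, of b 0] by simp
  have 0: "iter_partial bs (\<lambda>p. c) = (\<lambda>p :: 'a \<times> 'b. if bs = [] then c else (0::complex))" for bs c
  proof (induction bs)
    case (Cons b bs)
    then show ?case by (cases "bs = []") (auto simp: partial_deriv_const)
  qed auto
  show "\<exists>C. \<forall>i\<in>UNIV. \<forall>p. norm (iter_partial bs ?L p) \<le> C * pw 1 0 p"
  proof (cases bs rule: rev_cases)
    case Nil
    have "norm (?L p) \<le> 1 * pw 1 0 p" for p
    proof -
      have "norm (?L p) = \<bar>fst p \<bullet> e\<bar>" by simp
      also have "\<dots> \<le> norm (fst p)" using e by (rule Basis_le_norm)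
      also have "\<dots> \<le> pw 1 0 p" by (simp add: pw_def norm_le_jbracket less_imp_le)
      finally show ?thesis by simp
    qed
    then show ?thesis unfolding Nil iter_partial_Nil by blast
  next
    case (snoc cs c)
    then have "iter_partial bs ?L = (\<lambda>p. if cs = [] then ?L c else 0)" by (simp add: pd 0)
    then have "norm (iter_partial bs ?L p) \<le> norm (?L c) * pw 1 0 p" for p
      using mult_left_mono[OF ge1[of p], of "norm (?L c)"] by auto
    then show ?thesis by blast
  qed
qed (rule less_imp_le[OF pw_pos])

lemma pconv_mult_left_eventually:
  fixes \<gamma> :: "(real^'n) \<times> (real^'n) \<Rightarrow> complex"
  assumes \<gamma>: "cutoff \<gamma>" and \<epsilon>: "\<epsilon> \<longlonglongrightarrow> 0" and b: "smooth b" and f: "smooth f"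
  shows "pconv (\<lambda>m p. f p * (b p * \<gamma> (\<epsilon> m *\<^sub>R c + \<epsilon> m *\<^sub>R p))) (\<lambda>p. f p * b p)"
  using pconv_cutoff[OF \<gamma> \<epsilon> smooth_mult[OF f b], of c] by (simp add: mult.assoc)

text \<open>Integration by parts in \<open>\<eta>\<close>, justified by cutoffs.\<close>
lemma osc_I_coord:
  fixes b :: "(real^'n) \<times> (real^'n) \<Rightarrow> complex"
  assumes b: "ubd1 (pw M M') b" and k: "M' - 2 * real k \<le> - 2 * real CARD('n)" and e: "e \<in> Basis"
  shows "osc_I k (\<lambda>p. complex_of_real (fst p \<bullet> e) * b p) = - \<i> * osc_I k (partial_deriv (0, e) b)"
proof -
  obtain \<gamma> :: "(real^'n) \<times> (real^'n) \<Rightarrow> complex" where \<gamma>: "cutoff \<gamma>" using cutoff_exists by blast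
  define \<epsilon> where "\<epsilon> m = 1 / (real m + 1)" for m
  have \<epsilon>: "\<epsilon> m > 0" "\<epsilon> m \<le> 1" "\<epsilon> \<longlonglongrightarrow> 0" for m
    unfolding \<epsilon>_def using LIMSEQ_inverse_real_of_nat by (auto simp: inverse_eq_divide add.commute)
  let ?b = "\<lambda>m p. b p * \<gamma> (\<epsilon> m *\<^sub>R 0 + \<epsilon> m *\<^sub>R p)"
  let ?L = "\<lambda>p :: (real^'n) \<times> (real^'n). complex_of_real (fst p \<bullet> e)"
  have sb: "smooth b" using ubd_smooth[OF b] by auto
  have e': "(0, e) \<in> (Basis :: ((real^'n) \<times> (real^'n)) set)" using e by simp
  have "ubd (pw 0 0) UNIV (\<lambda>m p. \<gamma> (\<epsilon> m *\<^sub>R 0 + \<epsilon> m *\<^sub>R p))"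
    using ubd_reindex[OF cutoff_scaled_ubd[OF \<gamma>], of UNIV "\<lambda>m. (\<epsilon> m, 0)"] \<epsilon> by (simp add: less_imp_le)
  then have ub: "ubd (pw M M') UNIV ?b"
    using ubd_pw_mult[OF ubd1_const_family[OF b]] by fastforce
  \<comment> \<open>One order beyond the threshold of integrability, to leave room for the factor
    y_e.\<close>
  define s where "s = - 2 * real CARD('n) - 1"
  have nice: "ubd1 (pw s s) (?b m)" for m
    using ubd_pw_mult[OF b cutoff_scaled_ubd1[OF \<gamma> \<epsilon>(1), of "s - M" "s - M'" "\<epsilon> m *\<^sub>R 0" m]] by simp
  have "ubd1 (pw (1 + s) (0 + s)) (\<lambda>p. ?L p * ?b m p)" for m
    by (rule ubd_pw_mult[OF ubd_coord_fst[OF e] nice])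
  then have nice': "ubd1 (pw (1 + s) (1 + s)) (\<lambda>p. ?L p * ?b m p)" for m
    by (rule ubd_pw_mono) auto
  \<comment> \<open>With the cutoff in place both sides are plain integrals of Fourier transforms in
    \<eta>, where differentiation along e becomes multiplication by i y_e.\<close>
  have eq: "osc_I k (\<lambda>p. ?L p * ?b m p) = - \<i> * osc_I k (partial_deriv (0, e) (?b m))" for m
  proof -
    have F1: "fourier (\<lambda>\<eta>. ?L (y, \<eta>) * ?b m (y, \<eta>)) y = complex_of_real (y \<bullet> e) * fourier (\<lambda>\<eta>. ?b m (y, \<eta>)) y" for y
      by (simp only: fourier_cmult fst_conv)
    have "fourier (partial_deriv e (\<lambda>\<eta>. ?b m (y, \<eta>))) y = \<i> * complex_of_real (y \<bullet> e) * fourier (\<lambda>\<eta>. ?b m (y, \<eta>)) y" for y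
      by (rule fourier_partial_ubd[OF ubd1_section_snd[OF nice] UNIV_I _ e]) (simp add: s_def)
    then have F2: "fourier (\<lambda>\<eta>. partial_deriv (0, e) (?b m) (y, \<eta>)) y = \<i> * (complex_of_real (y \<bullet> e) * fourier (\<lambda>\<eta>. ?b m (y, \<eta>)) y)" for y
      unfolding partial_deriv_section_snd[symmetric, of e "?b m"] by (simp only: mult.assoc)
    have "osc_I k (\<lambda>p. ?L p * ?b m p) = complex_of_real (1 / (2 * pi) ^ CARD('n)) * (LINT y|lborel. complex_of_real (y \<bullet> e) * fourier (\<lambda>\<eta>. ?b m (y, \<eta>)) y)"
      unfolding F1[symmetric] by (rule osc_I_plain(2)[OF nice']) (simp add: s_def)
    moreover have "osc_I k (partial_deriv (0, e) (?b m)) = complex_of_real (1 / (2 * pi) ^ CARD('n)) * (LINT y|lborel. \<i> * (complex_of_real (y \<bullet> e) * fourier (\<lambda>\<eta>. ?b m (y, \<eta>)) y))"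
      unfolding F2[symmetric] by (rule osc_I_plain(2)[OF ubd_partial[OF nice e']]) (simp add: s_def)
    ultimately show ?thesis unfolding integral_mult_right_zero by simp
  qed
  \<comment> \<open>The coordinate raises only the order in y, so the condition on k is unchanged in
    the limit.\<close>
  have "ubd (pw (1 + M) (0 + M')) UNIV (\<lambda>m p. ?L p * ?b m p)"
    by (rule ubd_pw_mult[OF ubd1_const_family[OF ubd_coord_fst[OF e]] ub])
  then have "(\<lambda>m. osc_I k (\<lambda>p. ?L p * ?b m p)) \<longlonglongrightarrow> osc_I k (\<lambda>p. ?L p * b p)"
    using k sb ubd_smooth[OF ubd_coord_fst[OF e] UNIV_I]
    by (intro osc_I_tendsto pconv_mult_left_eventually \<gamma> \<epsilon>) auto
  moreover have "(\<lambda>m. - \<i> * osc_I k (partial_deriv (0, e) (?b m))) \<longlonglongrightarrow> - \<i> * osc_I k (partial_deriv (0, e) b)"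
    by (intro tendsto_mult tendsto_const osc_I_tendsto[OF ubd_partial[OF ub e'] k] pconv_partial pconv_cutoff \<gamma> \<epsilon> sb e')
  ultimately show ?thesis unfolding eq by (rule LIMSEQ_unique)
qed

section \<open>Amplitudes and their symbols\<close>

lemma Basis_fst3 [simp]: "e \<in> Basis \<Longrightarrow> (e, 0, 0) \<in> Basis"
  by (auto simp: Basis_prod_def zero_prod_def)

lemma partial_deriv_linear_map: "bounded_linear L \<Longrightarrow> partial_deriv v L = (\<lambda>x. L v)"
  by (rule ext, rule partial_deriv_has_derivative, rule bounded_linear_imp_has_derivative)

definition tw :: "real \<Rightarrow> real \<Rightarrow> real \<Rightarrow> 'a::real_normed_vector \<times> 'a \<times> 'a \<Rightarrow> real" where
  "tw m1 m m3 q = jbracket (fst q) powr m1 * jbracket (fst (snd q)) powr m * jbracket (snd (snd q)) powr m3"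

lemma tw_pos: "0 < tw m1 m m3 q"
  unfolding tw_def by (intro mult_pos_pos) auto

lemma tw_mono: "m \<le> m' \<Longrightarrow> tw m1 m m3 q \<le> tw m1 m' m3 q"
  unfolding tw_def by (intro mult_mono jbracket_powr_mono) auto

text \<open>On basis vectors the test singles out the y-directions, the only ones in which
  differentiation gains a power of decay.\<close>

definition ycount :: "('a::real_normed_vector \<times> 'a \<times> 'a) list \<Rightarrow> nat" where
  "ycount bs = length (filter (\<lambda>b. fst (snd b) \<noteq> 0) bs)"

lemma ycount_simps [simp]:
  "ycount [] = 0" "ycount (b # bs) = (if fst (snd b) \<noteq> 0 then 1 else 0) + ycount bs"
  "ycount (bs @ cs) = ycount bs + ycount cs"
  by (simp_all add: ycount_def)

text \<open>The symbol class of the theorem, with derivatives in any order. Only the y-order m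
  varies below: \<open>mixed\<close> lowers it by one, \<open>dshift\<close> keeps it.\<close>

definition ampl :: "real \<Rightarrow> real \<Rightarrow> real \<Rightarrow> ('a::euclidean_space \<times> 'a \<times> 'a \<Rightarrow> complex) \<Rightarrow> bool" where
  "ampl m1 m m3 A \<longleftrightarrow> smooth A \<and> (\<forall>bs. set bs \<subseteq> Basis \<longrightarrow>
     (\<exists>C. \<forall>q. norm (iter_partial bs A q) \<le> C * tw m1 (m - real (ycount bs)) m3 q))"

lemma ampl_smooth: "ampl m1 m m3 A \<Longrightarrow> smooth A"
  by (simp add: ampl_def)

text \<open>The gain of y-derivatives is forgotten here: the oscillatory integral only needs
  derivatives that do not grow faster than the amplitude. The gain enters later through
  \<open>mixed\<close>.\<close>

lemma ampl_ubd: "ampl m1 m m3 A \<Longrightarrow> ubd1 (tw m1 m m3) A"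
proof (rule ubdI)
  assume A: "ampl m1 m m3 A"
  fix bs :: "('a \<times> 'a \<times> 'a) list" assume "set bs \<subseteq> Basis"
  then obtain C where C: "\<And>q. norm (iter_partial bs A q) \<le> C * tw m1 (m - real (ycount bs)) m3 q"
    using A unfolding ampl_def by metis
  have "norm (iter_partial bs A q) \<le> \<bar>C\<bar> * tw m1 m m3 q" for q
  proof -
    have "C * tw m1 (m - real (ycount bs)) m3 q \<le> \<bar>C\<bar> * tw m1 m m3 q"
      by (intro mult_mono tw_mono) (auto intro: less_imp_le[OF tw_pos])
    then show ?thesis using C[of q] by linarith
  qed
  then show "\<exists>C. \<forall>i\<in>UNIV. \<forall>q. norm (iter_partial bs A q) \<le> C * tw m1 m m3 q" by blast
qed (auto simp: ampl_def intro: less_imp_le[OF tw_pos])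

lemma ampl_partial_gen:
  assumes A: "ampl m1 m m3 A" and b: "b \<in> Basis"
  shows "ampl m1 (m - (if fst (snd b) \<noteq> 0 then 1 else 0)) m3 (partial_deriv b A)"
  unfolding ampl_def
proof (intro conjI allI impI)
  fix bs :: "('a \<times> 'a \<times> 'a) list" assume "set bs \<subseteq> Basis"
  then have "set (bs @ [b]) \<subseteq> Basis" using b by auto
  then obtain C where "\<And>q. norm (iter_partial (bs @ [b]) A q) \<le> C * tw m1 (m - real (ycount (bs @ [b]))) m3 q"
    using A unfolding ampl_def by metis
  then show "\<exists>C. \<forall>q. norm (iter_partial bs (partial_deriv b A) q) \<le>
      C * tw m1 (m - (if fst (snd b) \<noteq> 0 then 1 else 0) - real (ycount bs)) m3 q"
    by (intro exI[of _ C]) (auto simp: algebra_simps)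
qed (use A b in \<open>auto intro: smooth_partial_deriv ampl_smooth\<close>)

lemma ampl_mono:
  assumes A: "ampl m1 m m3 A" and m: "m \<le> m'"
  shows "ampl m1 m' m3 A"
  unfolding ampl_def
proof (intro conjI allI impI)
  fix bs :: "('a \<times> 'a \<times> 'a) list" assume "set bs \<subseteq> Basis"
  then obtain C where C: "\<And>q. norm (iter_partial bs A q) \<le> C * tw m1 (m - real (ycount bs)) m3 q"
    using A unfolding ampl_def by metis
  have "norm (iter_partial bs A q) \<le> \<bar>C\<bar> * tw m1 (m' - real (ycount bs)) m3 q" for q
  proof -
    have "C * tw m1 (m - real (ycount bs)) m3 q \<le> \<bar>C\<bar> * tw m1 (m' - real (ycount bs)) m3 q"
      using m by (intro mult_mono tw_mono) (auto intro: less_imp_le[OF tw_pos])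
    then show ?thesis using C[of q] by linarith
  qed
  then show "\<exists>C. \<forall>q. norm (iter_partial bs A q) \<le> C * tw m1 (m' - real (ycount bs)) m3 q" by blast
qed (use A in \<open>auto intro: ampl_smooth\<close>)

lemma ampl_partial:
  assumes A: "ampl m1 m m3 A" and b: "b \<in> Basis"
  shows "ampl m1 m m3 (partial_deriv b A)"
  by (rule ampl_mono[OF ampl_partial_gen[OF A b]]) auto

lemma ampl_partial_y:
  assumes A: "ampl m1 m m3 A" and e: "e \<in> Basis"
  shows "ampl m1 (m - 1) m3 (partial_deriv (0, e, 0) A)"
  using ampl_partial_gen[OF A, of "(0, e, 0)"] e nonzero_Basis[OF e] by simp

lemma ampl_add:
  assumes A: "ampl m1 m m3 A" and B: "ampl m1 m m3 B"
  shows "ampl m1 m m3 (\<lambda>q. A q + B q)"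
  unfolding ampl_def
proof (intro conjI allI impI)
  fix bs :: "('a \<times> 'a \<times> 'a) list" assume bs: "set bs \<subseteq> Basis"
  obtain C where C: "\<And>q. norm (iter_partial bs A q) \<le> C * tw m1 (m - real (ycount bs)) m3 q"
    using A bs unfolding ampl_def by metis
  obtain D where D: "\<And>q. norm (iter_partial bs B q) \<le> D * tw m1 (m - real (ycount bs)) m3 q"
    using B bs unfolding ampl_def by metis
  have "norm (iter_partial bs (\<lambda>q. A q + B q) q) \<le> (C + D) * tw m1 (m - real (ycount bs)) m3 q" for q
    unfolding iter_partial_add[OF ampl_smooth[OF A] ampl_smooth[OF B] bs] distrib_right
    by (rule norm_triangle_mono[OF C D])
  then show "\<exists>C. \<forall>q. norm (iter_partial bs (\<lambda>q. A q + B q) q) \<le> C * tw m1 (m - real (ycount bs)) m3 q" by blast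
qed (use A B in \<open>auto intro: smooth_add ampl_smooth\<close>)

lemma ampl_cmult:
  assumes A: "ampl m1 m m3 A"
  shows "ampl m1 m m3 (\<lambda>q. c * A q)"
  unfolding ampl_def
proof (intro conjI allI impI)
  fix bs :: "('a \<times> 'a \<times> 'a) list" assume bs: "set bs \<subseteq> Basis"
  obtain C where C: "\<And>q. norm (iter_partial bs A q) \<le> C * tw m1 (m - real (ycount bs)) m3 q"
    using A bs unfolding ampl_def by metis
  have "norm (iter_partial bs (\<lambda>q. c * A q) q) \<le> (norm c * C) * tw m1 (m - real (ycount bs)) m3 q" for q
    using mult_left_mono[OF C norm_ge_zero]
    by (simp add: iter_partial_cmult[OF ampl_smooth[OF A] bs] norm_mult mult.assoc)
  then show "\<exists>C. \<forall>q. norm (iter_partial bs (\<lambda>q. c * A q) q) \<le> C * tw m1 (m - real (ycount bs)) m3 q" by blast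
qed (use A in \<open>auto intro: smooth_cmult ampl_smooth\<close>)

lemma ampl_zero: "ampl m1 m m3 (\<lambda>q. 0)"
  unfolding ampl_def
proof (intro conjI allI impI)
  fix bs :: "('a \<times> 'a \<times> 'a) list"
  have "iter_partial bs (\<lambda>q. 0) = (\<lambda>q::'a \<times> 'a \<times> 'a. 0 :: complex)" by (induction bs) (auto simp: partial_deriv_const)
  then show "\<exists>C. \<forall>q. norm (iter_partial bs (\<lambda>q. 0 :: complex) q) \<le> C * tw m1 (m - real (ycount bs)) m3 q"
    by (intro exI[of _ 0]) simp
qed auto

lemma ampl_sum: "(\<And>j. j \<in> J \<Longrightarrow> ampl m1 m m3 (A j)) \<Longrightarrow> ampl m1 m m3 (\<lambda>q. \<Sum>j\<in>J. A j q)"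
  by (induction J rule: infinite_finite_induct) (auto intro: ampl_zero ampl_add)

text \<open>The factor \<open>-i\<close> comes from \<open>osc_I_coord\<close>.\<close>
definition mixed :: "('a::euclidean_space \<times> 'a \<times> 'a \<Rightarrow> complex) \<Rightarrow> 'a \<times> 'a \<times> 'a \<Rightarrow> complex" where
  "mixed A = (\<lambda>q. - \<i> * (\<Sum>e\<in>Basis. partial_deriv (0, 0, e) (partial_deriv (0, e, 0) A) q))"

lemma ampl_mixed: "ampl m1 m m3 A \<Longrightarrow> ampl m1 (m - 1) m3 (mixed A)"
  unfolding mixed_def by (intro ampl_cmult ampl_sum ampl_partial ampl_partial_y) auto

lemma ampl_mixed_pow: "ampl m1 m m3 A \<Longrightarrow> ampl m1 (m - real j) m3 ((mixed ^^ j) A)"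
proof (induction j)
  case (Suc j)
  from ampl_mixed[OF Suc.IH[OF Suc.prems]] show ?case by (simp add: algebra_simps)
qed simp

lemma smooth_mixed: "smooth A \<Longrightarrow> smooth (mixed A)"
  unfolding mixed_def by (intro smooth_cmult smooth_sum smooth_partial_deriv) auto

lemma smooth_mixed_pow: "smooth A \<Longrightarrow> smooth ((mixed ^^ j) A)"
  by (induction j) (auto intro: smooth_mixed)

text \<open>\<open>dshift b\<close> for \<open>b = (e,0)\<close> is \<open>\<partial>\<^sub>x + \<partial>\<^sub>y\<close> in direction \<open>e\<close>, for \<open>b = (0,e)\<close> it is \<open>\<partial>\<^sub>\<xi>\<close>.\<close>
definition dshift :: "'a::euclidean_space \<times> 'a \<Rightarrow> ('a \<times> 'a \<times> 'a \<Rightarrow> complex) \<Rightarrow> 'a \<times> 'a \<times> 'a \<Rightarrow> complex" where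
  "dshift b A = partial_deriv (fst b, fst b, snd b) A"

lemma dshift_cases:
  assumes "smooth A" "b \<in> Basis"
  obtains e where "e \<in> Basis" "dshift b A = (\<lambda>q. partial_deriv (e, 0, 0) A q + partial_deriv (0, e, 0) A q)"
  | e where "e \<in> Basis" "dshift b A = partial_deriv (0, 0, e) A"
proof -
  have "(\<exists>e\<in>Basis. b = (e, 0)) \<or> (\<exists>e\<in>Basis. b = (0, e))" using assms(2) by (auto simp: Basis_prod_def)
  then show ?thesis
  proof (elim disjE bexE)
    fix e assume e: "e \<in> Basis" "b = (e, 0)"
    have "dshift b A = (\<lambda>q. partial_deriv (e, 0, 0) A q + partial_deriv (0, e, 0) A q)"
      using partial_deriv_add_dir[OF assms(1), of "(e, 0, 0)" "(0, e, 0)"] e by (auto simp: dshift_def)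
    then show ?thesis using e that(1) by blast
  next
    fix e assume e: "e \<in> Basis" "b = (0, e)"
    then have "dshift b A = partial_deriv (0, 0, e) A" by (simp add: dshift_def)
    then show ?thesis using e that(2) by blast
  qed
qed

text \<open>In the first kind of direction the operator is the sum of an x- and a y-derivative; the
  x-part gains nothing, so the gain of the y-part is dropped as well.\<close>

lemma ampl_dshift:
  assumes A: "ampl m1 m m3 A" and b: "b \<in> Basis" shows "ampl m1 m m3 (dshift b A)"
  by (rule dshift_cases[OF ampl_smooth[OF A] b])
    (simp_all only:, auto intro!: ampl_add ampl_partial[OF A])

lemma mixed_commute_partial:
  assumes A: "smooth A" and b: "b \<in> Basis"
  shows "mixed (partial_deriv b A) = partial_deriv b (mixed A)"
proof -
  have s: "smooth (partial_deriv (0, e, 0) A)" "smooth (partial_deriv (0, 0, e) (partial_deriv (0, e, 0) A))" if "e \<in> Basis" for e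
    using that A by (auto intro!: smooth_partial_deriv)
  have "partial_deriv b (mixed A) = (\<lambda>q. - \<i> * (\<Sum>e\<in>Basis. partial_deriv b (partial_deriv (0, 0, e) (partial_deriv (0, e, 0) A)) q))"
    unfolding mixed_def by (subst partial_deriv_cmult) (auto intro!: smooth_sum s simp: partial_deriv_sum[OF s(2)])
  also have "\<dots> = mixed (partial_deriv b A)"
    unfolding mixed_def
  proof (rule ext, intro arg_cong2[where f="(*)"] refl sum.cong)
    fix q and e :: 'a assume e: "e \<in> Basis"
    have e': "(0, e, 0) \<in> (Basis :: ('a \<times> 'a \<times> 'a) set)" "(0, 0, e) \<in> (Basis :: ('a \<times> 'a \<times> 'a) set)" using e by auto
    show "partial_deriv b (partial_deriv (0, 0, e) (partial_deriv (0, e, 0) A)) q = partial_deriv (0, 0, e) (partial_deriv (0, e, 0) (partial_deriv b A)) q"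
      unfolding partial_deriv_commute[OF s(1)[OF e] b e'(2)] partial_deriv_commute[OF A b e'(1)] ..
  qed
  finally show ?thesis ..
qed

lemma mixed_add:
  assumes "smooth A" "smooth B" shows "mixed (\<lambda>q. A q + B q) = (\<lambda>q. mixed A q + mixed B q)"
  unfolding mixed_def using assms
  by (intro ext) (simp add: partial_deriv_add smooth_partial_deriv sum.distrib distrib_left)

lemma mixed_commute_dshift:
  assumes A: "smooth A" and b: "b \<in> Basis"
  shows "mixed (dshift b A) = dshift b (mixed A)"
proof -
  have "(\<exists>e\<in>Basis. b = (e, 0)) \<or> (\<exists>e\<in>Basis. b = (0, e))" using b by (auto simp: Basis_prod_def)
  then show ?thesis
  proof (elim disjE bexE)
    fix e assume e: "e \<in> Basis" "b = (e, 0)"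
    have 1: "dshift b B = (\<lambda>q. partial_deriv (e, 0, 0) B q + partial_deriv (0, e, 0) B q)" if "smooth B" for B
      using partial_deriv_add_dir[OF that, of "(e, 0, 0)" "(0, e, 0)"] e by (auto simp: dshift_def)
    show ?thesis
      unfolding 1[OF A] 1[OF smooth_mixed[OF A]]
      by (subst mixed_add) (use e A mixed_commute_partial[OF A, of "(e, 0, 0)"] mixed_commute_partial[OF A, of "(0, e, 0)"] in
        \<open>auto intro!: smooth_partial_deriv\<close>)
  next
    fix e assume e: "e \<in> Basis" "b = (0, e)"
    then show ?thesis using mixed_commute_partial[OF A, of "(0, 0, e)"] by (simp add: dshift_def)
  qed
qed

lemma smooth_dshift: "smooth A \<Longrightarrow> b \<in> Basis \<Longrightarrow> smooth (dshift b A)"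
  by (rule dshift_cases[of A b]) (auto intro!: smooth_add smooth_partial_deriv)

text \<open>Constant-coefficient operators commute on smooth functions. This makes the expansion of
  \<open>dshift b A\<close> the derivative of the expansion of A.\<close>

lemma mixed_pow_commute_dshift:
  assumes A: "smooth A" and b: "b \<in> Basis"
  shows "(mixed ^^ j) (dshift b A) = dshift b ((mixed ^^ j) A)"
proof (induction j)
  case (Suc j)
  then show ?case using mixed_commute_dshift[OF smooth_mixed_pow[OF A] b, of j] by simp
qed simp

section \<open>The amplitude at a base point and its bounds\<close>

definition ampl_at :: "('a::euclidean_space \<times> 'a \<times> 'a \<Rightarrow> complex) \<Rightarrow> real \<Rightarrow> 'a \<Rightarrow> 'a \<Rightarrow> 'a \<times> 'a \<Rightarrow> complex" where
  "ampl_at A t x \<xi> p = A (x, x + t *\<^sub>R fst p, \<xi> + snd p)"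

definition ampl_at_lin :: "real \<Rightarrow> 'a::euclidean_space \<times> 'a \<Rightarrow> 'a \<times> 'a \<times> 'a" where
  "ampl_at_lin t p = (0, t *\<^sub>R fst p, snd p)"

lemma ampl_at_lin: "bounded_linear (ampl_at_lin t)"
  unfolding ampl_at_lin_def[abs_def]
  by (intro bounded_linear_Pair bounded_linear_zero bounded_linear_snd
      bounded_linear_compose[OF bounded_linear_scaleR_right bounded_linear_fst])

lemma sub_eq: "ampl_at A t x \<xi> = (\<lambda>p. A ((x, x, \<xi>) + ampl_at_lin t p))"
  by (rule ext) (simp add: ampl_at_def ampl_at_lin_def)

lemma smooth_sub: "smooth A \<Longrightarrow> smooth (ampl_at A t x \<xi>)"
  unfolding sub_eq by (rule smooth_compose) (auto intro: smooth_affine ampl_at_lin)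

lemma iter_partial_sub:
  assumes A: "smooth A" and bs: "set bs \<subseteq> Basis"
  shows "iter_partial bs (ampl_at A t x \<xi>) =
    (\<lambda>p. prod_list (map (\<lambda>b. if fst b = 0 then 1 else t) bs) *\<^sub>R iter_partial (map (Pair 0) bs) A ((x, x, \<xi>) + ampl_at_lin t p))"
  unfolding sub_eq
proof (rule iter_partial_affine[OF A smooth_affine[OF ampl_at_lin] _ _ bs])
  fix b p assume b: "b \<in> (Basis :: ('a \<times> 'a) set)"
  show "(0, b) \<in> (Basis :: ('a \<times> 'a \<times> 'a) set)" using b by simp
  show "partial_deriv b (\<lambda>p. (x, x, \<xi>) + ampl_at_lin t p) p = (if fst b = 0 then 1 else t) *\<^sub>R (0, b)"
    using b unfolding partial_deriv_linear[OF ampl_at_lin] by (auto simp: ampl_at_lin_def Basis_prod_def)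
qed

lemma jbracket_scale_le:
  assumes "\<bar>t\<bar> \<le> 2" shows "jbracket (t *\<^sub>R y) \<le> 2 * jbracket y"
proof (rule power2_le_imp_le)
  have "\<bar>t\<bar>\<^sup>2 \<le> 2\<^sup>2" using assms by (intro power_mono) auto
  then have "t\<^sup>2 * (norm y)\<^sup>2 \<le> 4 * (norm y)\<^sup>2" by (intro mult_right_mono) auto
  then show "(jbracket (t *\<^sub>R y))\<^sup>2 \<le> (2 * jbracket y)\<^sup>2"
    unfolding power_mult_distrib jbracket_sq norm_scaleR power2_abs by simp
qed (simp add: less_imp_le)

text \<open>Peetre's inequality splits off the displacement p. One factor 2^|m| is Peetre's for x +
  ty, the other comes from \<langle>ty\<rangle> \<le> 2\<langle>y\<rangle>, which is where |t| \<le>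
  2 enters; 2^|m3| is Peetre's for \<xi> + \<eta>.\<close>

lemma tw_sub_le:
  fixes p :: "'a::euclidean_space \<times> 'a"
  assumes t: "\<bar>t\<bar> \<le> 2"
  shows "tw m1 m m3 ((x, x, \<xi>) + ampl_at_lin t p) \<le>
    (2 powr \<bar>m\<bar> * 2 powr \<bar>m\<bar> * 2 powr \<bar>m3\<bar>) * (jbracket x powr (m1 + m) * jbracket \<xi> powr m3) * pw \<bar>m\<bar> \<bar>m3\<bar> p"
proof -
  have 1: "jbracket (x + t *\<^sub>R fst p) powr m \<le> 2 powr \<bar>m\<bar> * jbracket x powr m * (2 powr \<bar>m\<bar> * jbracket (fst p) powr \<bar>m\<bar>)"
  proof -
    have "jbracket (t *\<^sub>R fst p) powr \<bar>m\<bar> \<le> (2 * jbracket (fst p)) powr \<bar>m\<bar>"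
      using jbracket_scale_le[OF t] by (intro powr_mono2) (auto simp: less_imp_le)
    also have "\<dots> = 2 powr \<bar>m\<bar> * jbracket (fst p) powr \<bar>m\<bar>" by (simp add: powr_mult less_imp_le)
    finally have "2 powr \<bar>m\<bar> * jbracket x powr m * jbracket (t *\<^sub>R fst p) powr \<bar>m\<bar> \<le>
        2 powr \<bar>m\<bar> * jbracket x powr m * (2 powr \<bar>m\<bar> * jbracket (fst p) powr \<bar>m\<bar>)"
      by (rule mult_left_mono) simp
    then show ?thesis using peetre_inequality[of x "t *\<^sub>R fst p" m] by linarith
  qed
  have "tw m1 m m3 ((x, x, \<xi>) + ampl_at_lin t p) = jbracket x powr m1 * jbracket (x + t *\<^sub>R fst p) powr m * jbracket (\<xi> + snd p) powr m3"
    by (simp add: tw_def ampl_at_lin_def)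
  also have "\<dots> \<le> jbracket x powr m1 * (2 powr \<bar>m\<bar> * jbracket x powr m * (2 powr \<bar>m\<bar> * jbracket (fst p) powr \<bar>m\<bar>)) *
      (2 powr \<bar>m3\<bar> * jbracket \<xi> powr m3 * jbracket (snd p) powr \<bar>m3\<bar>)"
    by (intro mult_mono order_refl 1 peetre_inequality) auto
  also have "\<dots> = (2 powr \<bar>m\<bar> * 2 powr \<bar>m\<bar> * 2 powr \<bar>m3\<bar>) * (jbracket x powr (m1 + m) * jbracket \<xi> powr m3) * pw \<bar>m\<bar> \<bar>m3\<bar> p"
    by (simp add: pw_def powr_add mult_ac)
  finally show ?thesis .
qed

text \<open>Dividing by the weight expected of the symbol and indexing by (t, x, \<xi>) gives one
  bounded family, from which \<open>osc_I_bound\<close> yields the symbol estimate with a single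
  constant.\<close>

lemma sub_ubd:
  fixes A :: "'a::euclidean_space \<times> 'a \<times> 'a \<Rightarrow> complex"
  assumes A: "ubd1 (tw m1 m m3) A"
  shows "ubd (pw \<bar>m\<bar> \<bar>m3\<bar>) {(t, x, \<xi>). \<bar>t\<bar> \<le> 2}
    (\<lambda>(t, x, \<xi>) p. complex_of_real (1 / (jbracket x powr (m1 + m) * jbracket \<xi> powr m3)) * ampl_at A t x \<xi> p)"
proof (rule ubdI)
  have sA: "smooth A" using ubd_smooth[OF A] by auto
  fix bs :: "('a \<times> 'a) list" assume bs: "set bs \<subseteq> Basis"
  then have bs': "set (map (Pair (0::'a)) bs) \<subseteq> Basis" by auto
  obtain C where C: "C \<ge> 0" "\<And>q. norm (iter_partial (map (Pair 0) bs) A q) \<le> C * tw m1 m m3 q"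
    using ubdE[OF A bs'] by auto
  define K where "K = 2 powr \<bar>m\<bar> * 2 powr \<bar>m\<bar> * 2 powr \<bar>m3\<bar>"
  have "norm (iter_partial bs (\<lambda>p. complex_of_real (1 / (jbracket x powr (m1 + m) * jbracket \<xi> powr m3)) * ampl_at A t x \<xi> p) p) \<le>
      2 ^ length bs * (C * K) * pw \<bar>m\<bar> \<bar>m3\<bar> p" if t: "\<bar>t\<bar> \<le> 2" for t x \<xi> p
  proof -
    let ?W = "jbracket x powr (m1 + m) * jbracket \<xi> powr m3"
    have W: "?W > 0" by (intro mult_pos_pos) auto
    have pl: "\<bar>prod_list (map (\<lambda>b. if fst b = 0 then 1 else t) bs)\<bar> \<le> 2 ^ length bs"
    proof (induction bs)
      case (Cons b bs)
      then show ?case using t by (auto simp: abs_mult intro!: mult_mono order_trans[OF Cons])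
    qed simp
    have "norm (iter_partial bs (ampl_at A t x \<xi>) p) \<le> 2 ^ length bs * (C * tw m1 m m3 ((x, x, \<xi>) + ampl_at_lin t p))"
      unfolding iter_partial_sub[OF sA bs] norm_scaleR by (intro mult_mono pl C) auto
    also have "\<dots> \<le> 2 ^ length bs * (C * (K * ?W * pw \<bar>m\<bar> \<bar>m3\<bar> p))"
      unfolding K_def by (intro mult_left_mono tw_sub_le[OF t] C(1)) simp
    finally have "1 / ?W * norm (iter_partial bs (ampl_at A t x \<xi>) p) \<le> 1 / ?W * (2 ^ length bs * (C * (K * ?W * pw \<bar>m\<bar> \<bar>m3\<bar> p)))"
      using W by (intro mult_left_mono) auto
    also have "\<dots> = 2 ^ length bs * (C * K) * pw \<bar>m\<bar> \<bar>m3\<bar> p" using W by (simp add: field_simps)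
    finally show ?thesis
      unfolding iter_partial_cmult[OF smooth_sub[OF sA] bs] norm_mult norm_of_real using W by simp
  qed
  then show "\<exists>C. \<forall>i\<in>{(t, x, \<xi>). \<bar>t\<bar> \<le> 2}. \<forall>p. norm (iter_partial bs ((\<lambda>(t, x, \<xi>) p. complex_of_real (1 / (jbracket x powr (m1 + m) * jbracket \<xi> powr m3)) * ampl_at A t x \<xi> p) i) p) \<le> C * pw \<bar>m\<bar> \<bar>m3\<bar> p"
    by (intro exI[of _ "2 ^ length bs * (C * K)"]) auto
next
  show "smooth ((\<lambda>(t, x, \<xi>) p. complex_of_real (1 / (jbracket x powr (m1 + m) * jbracket \<xi> powr m3)) * ampl_at A t x \<xi> p) i)" for i
    by (cases i) (simp only: prod.case, intro smooth_cmult smooth_sub ubd_smooth[OF A UNIV_I])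
qed (rule less_imp_le[OF pw_pos])

lemma jbracket_powr_bounded:
  assumes "norm x \<le> R" shows "jbracket x powr s \<le> sqrt (1 + R\<^sup>2) powr \<bar>s\<bar>"
proof -
  have "jbracket x powr s \<le> jbracket x powr \<bar>s\<bar>" by (rule jbracket_powr_mono) simp
  also have "\<dots> \<le> sqrt (1 + R\<^sup>2) powr \<bar>s\<bar>"
    using assms by (intro powr_mono2) (auto simp: jbracket_def intro!: power_mono)
  finally show ?thesis .
qed

text \<open>Limits in x, \<xi> or t concern the amplitudes themselves, not their normalisations.
  Over a bounded set of parameters the weight divided out in \<open>sub_ubd\<close> is bounded and
  can be restored.\<close>

lemma sub_ubd_local:
  fixes A :: "'a::euclidean_space \<times> 'a \<times> 'a \<Rightarrow> complex"
  assumes A: "ubd1 (tw m1 m m3) A"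
    and I: "\<And>i. i \<in> I \<Longrightarrow> \<bar>t i\<bar> \<le> 2" "\<And>i. i \<in> I \<Longrightarrow> norm (x i) \<le> R" "\<And>i. i \<in> I \<Longrightarrow> norm (\<xi> i) \<le> R"
  shows "ubd (pw \<bar>m\<bar> \<bar>m3\<bar>) I (\<lambda>i. ampl_at A (t i) (x i) (\<xi> i))"
proof -
  have 1: "ubd (\<lambda>p :: 'a \<times> 'a. 1) I (\<lambda>i p. complex_of_real (jbracket (x i) powr (m1 + m) * jbracket (\<xi> i) powr m3))"
  proof (rule ubd_const)
    fix i assume "i \<in> I"
    then show "norm (complex_of_real (jbracket (x i) powr (m1 + m) * jbracket (\<xi> i) powr m3)) \<le> sqrt (1 + R\<^sup>2) powr \<bar>m1 + m\<bar> * sqrt (1 + R\<^sup>2) powr \<bar>m3\<bar>"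
      unfolding norm_of_real by (simp add: abs_mult, intro mult_mono jbracket_powr_bounded I) auto
  qed
  have 2: "ubd (pw \<bar>m\<bar> \<bar>m3\<bar>) I (\<lambda>i. (\<lambda>(t, x, \<xi>) p. complex_of_real (1 / (jbracket x powr (m1 + m) * jbracket \<xi> powr m3)) * ampl_at A t x \<xi> p) (t i, x i, \<xi> i))"
    by (rule ubd_reindex[OF sub_ubd[OF A]]) (use I in auto)
  have W: "jbracket x powr (m1 + m) * jbracket \<xi> powr m3 \<noteq> 0" for x \<xi> :: 'a
    by auto
  show ?thesis
    by (rule ubd_cong[OF ubd_mult[OF 1 2, simplified]]) (use W in \<open>auto simp: fun_eq_iff\<close>)
qed

text \<open>Interpolates between \<open>A(x,x,\<xi>)\<close> at \<open>t = 0\<close> and the symbol of the operator at \<open>t = 1\<close>.\<close>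
definition osc_c :: "nat \<Rightarrow> real \<Rightarrow> ((real^'n) \<times> (real^'n) \<times> (real^'n) \<Rightarrow> complex) \<Rightarrow> (real^'n) \<times> (real^'n) \<Rightarrow> complex" where
  "osc_c k t A z = osc_I k (ampl_at A t (fst z) (snd z))"

section \<open>Bounds, continuity and derivatives of the interpolated symbol\<close>

lemma osc_c_bound:
  fixes A :: "(real^'n) \<times> (real^'n) \<times> (real^'n) \<Rightarrow> complex"
  assumes A: "ubd1 (tw m1 m m3) A" and k: "\<bar>m3\<bar> - 2 * real k \<le> - 2 * real CARD('n)"
  shows "\<exists>C\<ge>0. \<forall>t x \<xi>. \<bar>t\<bar> \<le> 2 \<longrightarrow> norm (osc_c k t A (x, \<xi>)) \<le> C * (jbracket x powr (m1 + m) * jbracket \<xi> powr m3)"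
proof -
  obtain C where C: "C \<ge> 0" "\<And>i. i \<in> {(t, x, \<xi>). \<bar>t\<bar> \<le> 2} \<Longrightarrow> norm (osc_I k ((\<lambda>(t, x, \<xi>) p. complex_of_real (1 / (jbracket x powr (m1 + m) * jbracket \<xi> powr m3)) * ampl_at A t x \<xi> p) i)) \<le> C"
    using osc_I_bound[OF sub_ubd[OF A] k] by blast
  have "norm (osc_c k t A (x, \<xi>)) \<le> C * (jbracket x powr (m1 + m) * jbracket \<xi> powr m3)" if t: "\<bar>t\<bar> \<le> 2" for t x \<xi>
  proof -
    let ?W = "jbracket x powr (m1 + m) * jbracket \<xi> powr m3"
    have W: "?W > 0" by (intro mult_pos_pos) auto
    have "norm (osc_I k (\<lambda>p. complex_of_real (1 / ?W) * ampl_at A t x \<xi> p)) \<le> C"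
      using C(2)[of "(t, x, \<xi>)"] t by simp
    then have "norm (osc_c k t A (x, \<xi>)) / ?W \<le> C"
      unfolding osc_I_cmult[OF smooth_sub[OF ubd_smooth[OF A UNIV_I]]] norm_mult norm_of_real
      using W by (simp add: osc_c_def)
    then show ?thesis using W by (simp add: pos_divide_le_eq)
  qed
  then show ?thesis using C by blast
qed

lemma osc_c_continuous:
  fixes A :: "(real^'n) \<times> (real^'n) \<times> (real^'n) \<Rightarrow> complex"
  assumes A: "ubd1 (tw m1 m m3) A" and k: "\<bar>m3\<bar> - 2 * real k \<le> - 2 * real CARD('n)" and t: "\<bar>t\<bar> \<le> 2"
  shows "continuous_on UNIV (osc_c k t A)"
proof (rule continuous_on_sequentiallyI)
  fix u and z :: "(real^'n) \<times> (real^'n)" assume u: "u \<longlonglongrightarrow> z"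
  have sA: "smooth A" using ubd_smooth[OF A] by auto
  obtain R where R: "\<And>i. norm (u i) \<le> R"
    using convergent_imp_bounded[OF u] by (auto simp: bounded_iff)
  have "norm (fst (u i)) \<le> R" "norm (snd (u i)) \<le> R" for i
    using R[of i] norm_fst_le[of "fst (u i)" "snd (u i)"] norm_snd_le[of "snd (u i)" "fst (u i)"] by auto
  then have ub: "ubd (pw \<bar>m\<bar> \<bar>m3\<bar>) UNIV (\<lambda>i. ampl_at A t (fst (u i)) (snd (u i)))"
    using t by (intro sub_ubd_local[OF A]) auto
  have "pconv (\<lambda>i. ampl_at A t (fst (u i)) (snd (u i))) (ampl_at A t (fst z) (snd z))"
    unfolding pconv_def
  proof (intro conjI allI impI smooth_sub sA)
    fix bs :: "((real^'n) \<times> (real^'n)) list" and p assume bs: "set bs \<subseteq> Basis"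
    then have bs': "set (map (Pair (0::real^'n)) bs) \<subseteq> Basis" by auto
    show "(\<lambda>i. iter_partial bs (ampl_at A t (fst (u i)) (snd (u i))) p) \<longlonglongrightarrow> iter_partial bs (ampl_at A t (fst z) (snd z)) p"
      unfolding iter_partial_sub[OF sA bs]
      by (intro tendsto_scaleR tendsto_const continuous_on_tendsto_compose[OF smooth_continuous[OF smooth_iter_partial[OF sA bs']]]
          tendsto_intros u) auto
  qed
  from osc_I_tendsto[OF ub k this] show "(\<lambda>i. osc_c k t A (u i)) \<longlonglongrightarrow> osc_c k t A z"
    by (simp add: osc_c_def)
qed

text \<open>At t = 1 moving x shifts the first two arguments of A, and moving \<xi> the third,
  whence \<open>dshift\<close>.\<close>

lemma osc_c_has_vector_derivative:
  fixes A :: "(real^'n) \<times> (real^'n) \<times> (real^'n) \<Rightarrow> complex"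
  assumes A: "ampl m1 m m3 A" and k: "\<bar>m3\<bar> - 2 * real k \<le> - 2 * real CARD('n)" and b: "b \<in> Basis"
  shows "((\<lambda>s. osc_c k 1 A (z + s *\<^sub>R b)) has_vector_derivative osc_c k 1 (dshift b A) z) (at 0)"
proof -
  obtain x \<xi> where z: "z = (x, \<xi>)" by (cases z)
  obtain e f where ef: "b = (e, f)" by (cases b)
  have sA: "smooth A" by (rule ampl_smooth[OF A])
  \<comment> \<open>The parameter s becomes an extra coordinate: the function B below is the
    amplitude at the base point z + s b, the form that \<open>osc_I_has_vector_derivative\<close>
    takes.\<close>
  define L :: "real \<times> ((real^'n) \<times> (real^'n)) \<Rightarrow> (real^'n) \<times> (real^'n) \<times> (real^'n)" where
    "L r = fst r *\<^sub>R (e, e, f) + ampl_at_lin 1 (snd r)" for r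
  have L: "bounded_linear L" unfolding L_def[abs_def]
    by (intro bounded_linear_add bounded_linear_compose[OF bounded_linear_scaleR_left bounded_linear_fst]
        bounded_linear_compose[OF ampl_at_lin bounded_linear_snd])
  define B where "B r = A ((x, x, \<xi>) + L r)" for r
  have B: "B (s, p) = ampl_at A 1 (x + s *\<^sub>R e) (\<xi> + s *\<^sub>R f) p" for s p
  proof -
    have "(x, x, \<xi>) + L (s, p) = (x + s *\<^sub>R e, x + s *\<^sub>R e + 1 *\<^sub>R fst p, \<xi> + s *\<^sub>R f + snd p)"
      by (simp add: prod_eq_iff L_def ampl_at_lin_def)
    then show ?thesis by (simp add: B_def ampl_at_def)
  qed
  have sB: "smooth B" unfolding B_def[abs_def] by (rule smooth_compose[OF sA smooth_affine[OF L]])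
  have *: "partial_deriv (1, 0) B r = partial_deriv (e, e, f) A ((x, x, \<xi>) + L r)" for r
  proof -
    have "L (1, 0) = (e, e, f)" by (simp add: L_def ampl_at_lin_def)
    then show ?thesis unfolding B_def[abs_def] partial_deriv_compose[OF sA smooth_affine[OF L]] partial_deriv_linear[OF L] by simp
  qed
  then have B': "partial_deriv (1, 0) B (s, p) = ampl_at (dshift b A) 1 (x + s *\<^sub>R e) (\<xi> + s *\<^sub>R f) p" for s p
  proof -
    have "(x, x, \<xi>) + L (s, p) = (x + s *\<^sub>R e, x + s *\<^sub>R e + 1 *\<^sub>R fst p, \<xi> + s *\<^sub>R f + snd p)"
      by (simp add: prod_eq_iff L_def ampl_at_lin_def)
    then show ?thesis using * by (simp add: ampl_at_def ef dshift_def)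
  qed
  define R where "R = norm x + norm e + norm \<xi> + norm f"
  have R: "norm (x + s *\<^sub>R e) \<le> R" "norm (\<xi> + s *\<^sub>R f) \<le> R" if "\<bar>s - 0\<bar> < 1" for s
  proof -
    have "\<bar>s\<bar> * norm e \<le> norm e" "\<bar>s\<bar> * norm f \<le> norm f" using that by (simp_all add: mult_left_le_one_le)
    then show "norm (x + s *\<^sub>R e) \<le> R" "norm (\<xi> + s *\<^sub>R f) \<le> R"
      using norm_triangle_ineq[of x "s *\<^sub>R e"] norm_triangle_ineq[of \<xi> "s *\<^sub>R f"]
        norm_ge_zero[of x] norm_ge_zero[of \<xi>] norm_ge_zero[of e] norm_ge_zero[of f] unfolding R_def norm_scaleR by linarith+
  qed
  have "((\<lambda>s. osc_I k (\<lambda>p. B (s, p))) has_vector_derivative osc_I k (\<lambda>p. partial_deriv (1, 0) B (0, p))) (at 0)"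
  proof (rule osc_I_has_vector_derivative[OF sB _ _ k])
    show "ubd (pw \<bar>m\<bar> \<bar>m3\<bar>) {s. \<bar>s - 0\<bar> < 1} (\<lambda>s p. B (s, p))"
      unfolding B using R by (intro sub_ubd_local[OF ampl_ubd[OF A]]) auto
    show "ubd (pw \<bar>m\<bar> \<bar>m3\<bar>) {s. \<bar>s - 0\<bar> < 1} (\<lambda>s p. partial_deriv (1, 0) B (s, p))"
      unfolding B' using R by (intro sub_ubd_local[OF ampl_ubd[OF ampl_dshift[OF A b]]]) auto
  qed
  then show ?thesis unfolding B B' osc_c_def by (simp add: z ef)
qed

text \<open>At t = 0 the amplitude no longer depends on y, so \<open>osc_I_independent\<close>
  evaluates it.\<close>

lemma osc_c_0:
  fixes A :: "(real^'n) \<times> (real^'n) \<times> (real^'n) \<Rightarrow> complex"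
  assumes A: "ubd1 (tw m1 m m3) A" and k: "\<bar>m3\<bar> - 2 * real k \<le> - 2 * real CARD('n)"
  shows "osc_c k 0 A (x, \<xi>) = A (x, x, \<xi>)"
proof -
  have "ubd1 (pw \<bar>m\<bar> \<bar>m3\<bar>) (ampl_at A 0 x \<xi>)"
    by (rule sub_ubd_local[OF A, where R="norm x + norm \<xi>"]) auto
  from osc_I_independent[OF ubd1_section_snd[OF this, of 0] k] show ?thesis
    by (simp add: osc_c_def ampl_at_def[abs_def])
qed

lemma osc_c_deriv_t:
  fixes A :: "(real^'n) \<times> (real^'n) \<times> (real^'n) \<Rightarrow> complex"
  assumes A: "ampl m1 m m3 A" and k: "\<bar>m3\<bar> - 2 * real k \<le> - 2 * real CARD('n)" and t: "\<bar>t\<bar> \<le> 1"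
  shows "((\<lambda>t. osc_c k t A (x, \<xi>)) has_vector_derivative osc_c k t (mixed A) (x, \<xi>)) (at t)"
proof -
  have sA: "smooth A" by (rule ampl_smooth[OF A])
  \<comment> \<open>Here the extra variable t multiplies y. The map is therefore not affine, and its
    t-derivative brings down the factor y.\<close>
  define \<psi> :: "real \<times> ((real^'n) \<times> (real^'n)) \<Rightarrow> (real^'n) \<times> (real^'n) \<times> (real^'n)" where
    "\<psi> r = ((x, x, \<xi>) + (0, 0, snd (snd r))) + fst r *\<^sub>R (0, fst (snd r), 0)" for r
  have l1: "bounded_linear (\<lambda>r :: real \<times> ((real^'n) \<times> (real^'n)). (0 :: real^'n, 0 :: real^'n, snd (snd r)))"
    and l2: "bounded_linear (\<lambda>r :: real \<times> ((real^'n) \<times> (real^'n)). (0 :: real^'n, fst (snd r), 0 :: real^'n))"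
    by (intro bounded_linear_Pair bounded_linear_zero bounded_linear_compose[OF bounded_linear_snd bounded_linear_snd]
        bounded_linear_compose[OF bounded_linear_fst bounded_linear_snd])+
  have s\<psi>: "smooth \<psi>" unfolding \<psi>_def[abs_def]
    by (intro smooth_add smooth_affine smooth_scaleR smooth_linear l1 l2 bounded_linear_fst smooth_const)
  have d\<psi>: "partial_deriv (1, 0) \<psi> r = (0, fst (snd r), 0)" for r
    unfolding \<psi>_def[abs_def]
      partial_deriv_add[OF smooth_affine[OF l1] smooth_scaleR[OF smooth_linear[OF bounded_linear_fst] smooth_linear[OF l2]]]
      partial_deriv_linear[OF l1] partial_deriv_bilinear[OF bounded_bilinear_scaleR smooth_linear[OF bounded_linear_fst] smooth_linear[OF l2]]
      partial_deriv_linear_map[OF bounded_linear_fst] partial_deriv_linear_map[OF l2]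
    by (simp add: zero_prod_def)
  define B where "B r = A (\<psi> r)" for r
  have B: "(\<lambda>p. B (s, p)) = ampl_at A s x \<xi>" for s
    by (rule ext) (simp add: B_def \<psi>_def ampl_at_def)
  have sB: "smooth B" unfolding B_def[abs_def] by (rule smooth_compose[OF sA s\<psi>])
  let ?A = "\<lambda>e. partial_deriv (0, e, 0) A"
  have B': "(\<lambda>p. partial_deriv (1, 0) B (s, p)) = (\<lambda>p. \<Sum>e\<in>Basis. complex_of_real (fst p \<bullet> e) * ampl_at (?A e) s x \<xi> p)" for s
  proof
    fix p :: "(real^'n) \<times> (real^'n)"
    have lin: "linear (\<lambda>v. partial_deriv v A (\<psi> (s, p)))"
      by (rule has_derivative_linear[OF smooth_has_derivative_partial[OF sA]])
    have "(0, fst p, 0) = (\<Sum>e\<in>Basis. (fst p \<bullet> e) *\<^sub>R ((0, e, 0) :: (real^'n) \<times> (real^'n) \<times> (real^'n)))"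
      by (simp add: prod_eq_iff fst_sum snd_sum euclidean_representation)
    then have "partial_deriv (0, fst p, 0) A (\<psi> (s, p)) = (\<Sum>e\<in>Basis. (fst p \<bullet> e) *\<^sub>R partial_deriv (0, e, 0) A (\<psi> (s, p)))"
      by (simp only: linear_sum[OF lin] linear_scale[OF lin])
    then show "partial_deriv (1, 0) B (s, p) = (\<Sum>e\<in>Basis. complex_of_real (fst p \<bullet> e) * ampl_at (?A e) s x \<xi> p)"
      unfolding B_def[abs_def] partial_deriv_compose[OF sA s\<psi>] d\<psi>
      by (simp add: \<psi>_def ampl_at_def scaleR_conv_of_real)
  qed
  have Ae: "ampl m1 m m3 (?A e)" if "e \<in> Basis" for e using that by (intro ampl_partial A) auto
  have sub1: "ubd1 (pw \<bar>m\<bar> \<bar>m3\<bar>) (ampl_at A' s x \<xi>)" if "ampl m1 m m3 A'" "\<bar>s\<bar> \<le> 2" for A' s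
    by (rule sub_ubd_local[OF ampl_ubd[OF that(1)], where R="norm x + norm \<xi>"]) (use that in auto)
  have "((\<lambda>s. osc_I k (\<lambda>p. B (s, p))) has_vector_derivative osc_I k (\<lambda>p. partial_deriv (1, 0) B (t, p))) (at t)"
  proof (rule osc_I_has_vector_derivative[OF sB _ _ k])
    \<comment> \<open>A step below 1 from |t| \<le> 1 stays in |s| \<le> 2, the range of the uniform
      bounds.\<close>
    have s2: "\<bar>s\<bar> \<le> 2" if "\<bar>s - t\<bar> < 1" for s using that t by linarith
    have "ubd (pw \<bar>m\<bar> \<bar>m3\<bar>) {s. \<bar>s - t\<bar> < 1} (\<lambda>s. ampl_at A s x \<xi>)"
      by (rule sub_ubd_local[OF ampl_ubd[OF A], where R="norm x + norm \<xi>"]) (auto intro: s2)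
    \<comment> \<open>B and its t-derivative must lie in one weight class; the factor y_e in the
      derivative raises the order in y by one.\<close>
    then show "ubd (pw (1 + \<bar>m\<bar>) \<bar>m3\<bar>) {s. \<bar>s - t\<bar> < 1} (\<lambda>s p. B (s, p))"
      unfolding B by (rule ubd_pw_mono) auto
    show "ubd (pw (1 + \<bar>m\<bar>) \<bar>m3\<bar>) {s. \<bar>s - t\<bar> < 1} (\<lambda>s p. partial_deriv (1, 0) B (s, p))"
      unfolding B'
    proof (rule ubd_sum)
      fix e :: "real^'n" assume e: "e \<in> Basis"
      have "ubd (pw \<bar>m\<bar> \<bar>m3\<bar>) {s. \<bar>s - t\<bar> < 1} (\<lambda>s. ampl_at (?A e) s x \<xi>)"
        by (rule sub_ubd_local[OF ampl_ubd[OF Ae[OF e]], where R="norm x + norm \<xi>"]) (auto intro: s2)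
      from ubd_pw_mult[OF ubd1_const_family[OF ubd_coord_fst[OF e]] this]
      show "ubd (pw (1 + \<bar>m\<bar>) \<bar>m3\<bar>) {s. \<bar>s - t\<bar> < 1} (\<lambda>s p. complex_of_real (fst p \<bullet> e) * ampl_at (?A e) s x \<xi> p)"
        by simp
    qed (rule less_imp_le[OF pw_pos])
  qed
  moreover have "osc_I k (\<lambda>p. partial_deriv (1, 0) B (t, p)) = osc_I k (ampl_at (mixed A) t x \<xi>)"
  proof -
    have t2: "\<bar>t\<bar> \<le> 2" using t by simp
    have "osc_I k (\<lambda>p. partial_deriv (1, 0) B (t, p)) = (\<Sum>e\<in>Basis. osc_I k (\<lambda>p. complex_of_real (fst p \<bullet> e) * ampl_at (?A e) t x \<xi> p))"
      unfolding B'
    proof (rule osc_I_sum[OF _ k])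
      fix e :: "real^'n" assume e: "e \<in> Basis"
      show "ubd1 (pw (1 + \<bar>m\<bar>) \<bar>m3\<bar>) (\<lambda>p. complex_of_real (fst p \<bullet> e) * ampl_at (?A e) t x \<xi> p)"
        using ubd_pw_mult[OF ubd_coord_fst[OF e] sub1[OF Ae[OF e] t2]] by simp
    qed
    also have "\<dots> = (\<Sum>e\<in>Basis. - \<i> * osc_I k (partial_deriv (0, e) (ampl_at (?A e) t x \<xi>)))"
      by (intro sum.cong refl osc_I_coord[OF sub1[OF Ae t2] k])
    also have "\<dots> = (\<Sum>e\<in>Basis. - \<i> * osc_I k (ampl_at (partial_deriv (0, 0, e) (?A e)) t x \<xi>))"
    proof (intro sum.cong refl arg_cong2[where f="(*)"] arg_cong2[where f=osc_I])
      fix e :: "real^'n" assume e: "e \<in> Basis"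
      have "iter_partial [(0, e)] (ampl_at (?A e) t x \<xi>) = ampl_at (partial_deriv (0, 0, e) (?A e)) t x \<xi>"
        by (subst iter_partial_sub) (use e in \<open>auto simp: sub_eq intro: ampl_smooth[OF Ae]\<close>)
      then show "partial_deriv (0, e) (ampl_at (?A e) t x \<xi>) = ampl_at (partial_deriv (0, 0, e) (?A e)) t x \<xi>" by simp
    qed
    also have "\<dots> = - \<i> * (\<Sum>e\<in>Basis. osc_I k (ampl_at (partial_deriv (0, 0, e) (?A e)) t x \<xi>))"
      by (simp add: sum_distrib_left)
    also have "\<dots> = - \<i> * osc_I k (\<lambda>p. \<Sum>e\<in>Basis. ampl_at (partial_deriv (0, 0, e) (?A e)) t x \<xi> p)"
      by (subst osc_I_sum[OF sub1[OF ampl_partial[OF Ae] t2] k]) auto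
    also have "\<dots> = osc_I k (\<lambda>p. - \<i> * (\<Sum>e\<in>Basis. ampl_at (partial_deriv (0, 0, e) (?A e)) t x \<xi> p))"
      by (rule osc_I_cmult[symmetric]) (auto intro!: smooth_sum smooth_sub ampl_smooth[OF ampl_partial[OF Ae]])
    also have "\<dots> = osc_I k (ampl_at (mixed A) t x \<xi>)"
      by (simp add: mixed_def ampl_at_def[abs_def])
    finally show ?thesis .
  qed
  ultimately show ?thesis unfolding B osc_c_def by simp
qed

section \<open>Taylor expansion in t\<close>

definition diag_expansion :: "nat \<Rightarrow> ('a::euclidean_space \<times> 'a \<times> 'a \<Rightarrow> complex) \<Rightarrow> 'a \<times> 'a \<Rightarrow> complex" where
  "diag_expansion N A z = (\<Sum>j<N. complex_of_real (1 / fact j) * (mixed ^^ j) A (fst z, fst z, snd z))"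

text \<open>One constant from \<open>osc_c_bound\<close> controls the N-th t-derivative for all t in
  [0,1], and the Taylor kernel is at most 1 there, so the remainder inherits the weight of
  \<open>(mixed ^^ N) A\<close>.\<close>

lemma osc_c_taylor:
  fixes A :: "(real^'n) \<times> (real^'n) \<times> (real^'n) \<Rightarrow> complex"
  assumes A: "ampl m1 m m3 A" and k: "\<bar>m3\<bar> - 2 * real k \<le> - 2 * real CARD('n)" and N: "N > 0"
  shows "\<exists>C. \<forall>x \<xi>. norm (osc_c k 1 A (x, \<xi>) - diag_expansion N A (x, \<xi>)) \<le> C * (jbracket x powr (m1 + (m - real N)) * jbracket \<xi> powr m3)"
proof -
  obtain C where C: "C \<ge> 0" "\<And>t x \<xi>. \<bar>t\<bar> \<le> 2 \<Longrightarrow> norm (osc_c k t ((mixed ^^ N) A) (x, \<xi>)) \<le> C * (jbracket x powr (m1 + (m - real N)) * jbracket \<xi> powr m3)"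
    using osc_c_bound[OF ampl_ubd[OF ampl_mixed_pow[OF A]] k] by metis
  have "norm (osc_c k 1 A (x, \<xi>) - diag_expansion N A (x, \<xi>)) \<le> C * (jbracket x powr (m1 + (m - real N)) * jbracket \<xi> powr m3)" for x \<xi>
  proof -
    let ?K = "C * (jbracket x powr (m1 + (m - real N)) * jbracket \<xi> powr m3)"
    let ?D = "\<lambda>j t. osc_c k t ((mixed ^^ j) A) (x, \<xi>)"
    have "((\<lambda>t. ((1 - t) ^ (N - 1) / fact (N - 1)) *\<^sub>R ?D N t) has_integral
        ?D 0 1 - (\<Sum>i<N. ((1 - 0) ^ i / fact i) *\<^sub>R ?D i 0)) {0..1}"
    proof (rule Taylor_has_integral[OF N])
      fix j and t :: real assume t: "j < N" "0 \<le> t" "t \<le> 1"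
      have "((\<lambda>t. ?D j t) has_vector_derivative osc_c k t (mixed ((mixed ^^ j) A)) (x, \<xi>)) (at t)"
        using t by (intro osc_c_deriv_t[OF ampl_mixed_pow[OF A] k]) auto
      then show "(?D j has_vector_derivative ?D (Suc j) t) (at t within {0..1})"
        by (simp add: has_vector_derivative_at_within)
    qed auto
    moreover have "(\<Sum>i<N. ((1 - 0) ^ i / fact i) *\<^sub>R ?D i 0) = diag_expansion N A (x, \<xi>)"
      unfolding diag_expansion_def by (simp add: osc_c_0[OF ampl_ubd[OF ampl_mixed_pow[OF A]] k] scaleR_conv_of_real)
    ultimately have I: "((\<lambda>t. ((1 - t) ^ (N - 1) / fact (N - 1)) *\<^sub>R ?D N t) has_integral
        osc_c k 1 A (x, \<xi>) - diag_expansion N A (x, \<xi>)) (cbox 0 1)" by simp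
    have "norm (osc_c k 1 A (x, \<xi>) - diag_expansion N A (x, \<xi>)) \<le> ?K * measure lborel (cbox 0 (1::real))"
    proof (rule has_integral_bound[OF _ I])
      fix t :: real assume t: "t \<in> cbox 0 1"
      have "(1 - t) ^ (N - 1) \<le> 1" using t by (intro power_le_one) auto
      then have f: "\<bar>(1 - t) ^ (N - 1) / fact (N - 1)\<bar> \<le> 1"
        using t fact_ge_1[of "N - 1", where 'a=real] by (simp add: divide_le_eq_1 abs_of_nonneg del: fact_ge_1)
      show "norm (((1 - t) ^ (N - 1) / fact (N - 1)) *\<^sub>R ?D N t) \<le> ?K"
        unfolding norm_scaleR using mult_mono[OF f C(2)[of t x \<xi>]] t by auto
    qed (use C in auto)
    then show ?thesis by simp
  qed
  then show ?thesis by blast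
qed

section \<open>Derivatives of the symbol and of the expansion\<close>

lemma partial_deriv_osc_c:
  fixes A :: "(real^'n) \<times> (real^'n) \<times> (real^'n) \<Rightarrow> complex"
  assumes A: "ampl m1 m m3 A" and k: "\<bar>m3\<bar> - 2 * real k \<le> - 2 * real CARD('n)" and b: "b \<in> Basis"
  shows "partial_deriv b (osc_c k 1 A) = osc_c k 1 (dshift b A)"
  by (rule ext) (rule partial_derivI[OF osc_c_has_vector_derivative[OF A k b]])

text \<open>The symbols of all amplitudes of one class form a set stable under derivatives, because
  \<open>dshift\<close> preserves the class; \<open>smooth_coinduct\<close> applies to this
  set.\<close>

lemma smooth_osc_c:
  fixes A :: "(real^'n) \<times> (real^'n) \<times> (real^'n) \<Rightarrow> complex"
  assumes A: "ampl m1 m m3 A" and k: "\<bar>m3\<bar> - 2 * real k \<le> - 2 * real CARD('n)"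
  shows "smooth (osc_c k 1 A)"
proof (rule smooth_coinduct[where X="{osc_c k 1 A | A. ampl m1 m m3 A}"])
  fix f :: "(real^'n) \<times> (real^'n) \<Rightarrow> complex" assume "f \<in> {osc_c k 1 A | A. ampl m1 m m3 A}"
  then obtain A where f: "f = osc_c k 1 A" and A: "ampl m1 m m3 A" by auto
  show "continuous_on UNIV f" unfolding f by (rule osc_c_continuous[OF ampl_ubd[OF A] k]) simp
  fix b :: "(real^'n) \<times> (real^'n)" assume b: "b \<in> Basis"
  show "(\<lambda>t::real. f (z + t *\<^sub>R b)) differentiable at 0" for z
    unfolding f by (rule differentiableI_vector[OF osc_c_has_vector_derivative[OF A k b]])
  show "partial_deriv b f \<in> {osc_c k 1 A | A. ampl m1 m m3 A}"
    unfolding f partial_deriv_osc_c[OF A k b] using ampl_dshift[OF A b] by blast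
qed (use A in blast)

lemma iter_partial_osc_c:
  fixes A :: "(real^'n) \<times> (real^'n) \<times> (real^'n) \<Rightarrow> complex"
  assumes A: "ampl m1 m m3 A" and k: "\<bar>m3\<bar> - 2 * real k \<le> - 2 * real CARD('n)" and bs: "set bs \<subseteq> Basis"
  shows "iter_partial bs (osc_c k 1 A) = osc_c k 1 (foldr dshift bs A)" "ampl m1 m m3 (foldr dshift bs A)"
proof -
  have "iter_partial bs (osc_c k 1 A) = osc_c k 1 (foldr dshift bs A) \<and> ampl m1 m m3 (foldr dshift bs A)"
    using bs by (induction bs) (auto simp: A partial_deriv_osc_c[OF _ k] intro: ampl_dshift)
  then show "iter_partial bs (osc_c k 1 A) = osc_c k 1 (foldr dshift bs A)" "ampl m1 m m3 (foldr dshift bs A)" by auto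
qed

lemma diag_lin: "bounded_linear (\<lambda>z::'a::euclidean_space \<times> 'a. (fst z, fst z, snd z))"
  by (intro bounded_linear_Pair bounded_linear_fst bounded_linear_snd)

lemma smooth_diag: "smooth A \<Longrightarrow> smooth (\<lambda>z. (mixed ^^ j) A (fst z, fst z, snd z))"
  by (rule smooth_compose[where \<phi>="\<lambda>z. (fst z, fst z, snd z)", OF smooth_mixed_pow smooth_linear[OF diag_lin]])

lemma smooth_texp: "smooth A \<Longrightarrow> smooth (diag_expansion N A)"
  unfolding diag_expansion_def[abs_def] by (intro smooth_sum smooth_cmult smooth_diag)

text \<open>The diagonal map sends the direction (e, f) to (e, e, f), the direction of
  \<open>dshift\<close>. Symbol and expansion are thus differentiated by the same rule, and so is
  the remainder.\<close>

lemma partial_deriv_texp: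
  fixes A :: "'a::euclidean_space \<times> 'a \<times> 'a \<Rightarrow> complex"
  assumes A: "smooth A" and b: "b \<in> Basis"
  shows "partial_deriv b (diag_expansion N A) = diag_expansion N (dshift b A)"
proof -
  let ?\<delta> = "\<lambda>z::'a \<times> 'a. (fst z, fst z, snd z)"
  have s: "smooth (\<lambda>z. (mixed ^^ j) A (?\<delta> z))" for j
    by (rule smooth_diag[OF A])
  have "partial_deriv b (\<lambda>z. (mixed ^^ j) A (?\<delta> z)) z = (mixed ^^ j) (dshift b A) (?\<delta> z)" for j z
    unfolding partial_deriv_compose[OF smooth_mixed_pow[OF A] smooth_linear[OF diag_lin]]
      partial_deriv_linear_map[OF diag_lin] mixed_pow_commute_dshift[OF A b]
    unfolding dshift_def ..
  note 1 = this
  have "partial_deriv b (diag_expansion N A) = (\<lambda>z. \<Sum>j<N. partial_deriv b (\<lambda>z. complex_of_real (1 / fact j) * (mixed ^^ j) A (?\<delta> z)) z)"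
    unfolding diag_expansion_def[abs_def] by (rule partial_deriv_sum) (intro smooth_cmult s)
  also have "\<dots> = diag_expansion N (dshift b A)"
    unfolding partial_deriv_cmult[OF s] 1 diag_expansion_def[abs_def] ..
  finally show ?thesis .
qed

lemma iter_partial_texp:
  assumes A: "smooth A" and bs: "set bs \<subseteq> Basis"
  shows "iter_partial bs (diag_expansion N A) = diag_expansion N (foldr dshift bs A)"
proof -
  have "iter_partial bs (diag_expansion N A) = diag_expansion N (foldr dshift bs A) \<and> smooth (foldr dshift bs A)"
    using bs by (induction bs) (auto simp: A partial_deriv_texp intro: smooth_dshift)
  then show ?thesis by simp
qed

section \<open>Multi-indices\<close>

lemma coords: "distinct (coords :: 'n::finite list)" "set (coords :: 'n list) = UNIV"
proof -
  have "\<exists>l :: 'n list. distinct l \<and> set l = UNIV" using finite_distinct_list[OF finite, of UNIV] by blast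
  from someI_ex[OF this] show "distinct (coords :: 'n list)" "set (coords :: 'n list) = UNIV"
    unfolding coords_def by auto
qed

definition mlist :: "('n::finite \<Rightarrow> nat) \<Rightarrow> (real^'n) list" where
  "mlist \<alpha> = concat (map (\<lambda>i. replicate (\<alpha> i) (axis i 1)) coords)"

lemma mderiv_iter_partial: "mderiv \<alpha> f = iter_partial (mlist \<alpha>) f"
proof -
  have 1: "(partial_deriv b ^^ m) f = iter_partial (replicate m b) f" for b :: "real^'a" and m and f :: "real^'a \<Rightarrow> 'b"
    by (induction m) auto
  have "foldr (\<lambda>i. partial_deriv (axis i 1) ^^ \<alpha> i) l f = iter_partial (concat (map (\<lambda>i. replicate (\<alpha> i) (axis i 1)) l)) f" for l
    by (induction l) (auto simp: 1)
  then show ?thesis by (simp add: mderiv_def mlist_def)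
qed

lemma set_mlist: "set (mlist \<alpha>) \<subseteq> Basis"
  by (auto simp: mlist_def axis_in_Basis_iff)

lemma mset_mlist: "mset (mlist \<alpha>) = (\<Sum>i\<in>UNIV. replicate_mset (\<alpha> i) (axis i 1))"
proof -
  have "mset (mlist \<alpha>) = (\<Sum>i\<leftarrow>coords. replicate_mset (\<alpha> i) (axis i 1))"
    by (simp add: mlist_def mset_concat o_def)
  also have "\<dots> = (\<Sum>i\<in>set coords. replicate_mset (\<alpha> i) (axis i 1))"
    by (rule sum_list_distinct_conv_sum_set[OF coords(1)])
  finally show ?thesis by (simp add: coords(2))
qed

lemma length_mlist: "length (mlist \<alpha>) = mlen \<alpha>"
  by (simp flip: size_mset add: mset_mlist mlen_def size_multiset_sum)

definition minc :: "'n \<Rightarrow> ('n \<Rightarrow> nat) \<Rightarrow> 'n \<Rightarrow> nat" where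
  "minc i \<alpha> = \<alpha>(i := Suc (\<alpha> i))"

lemma mset_mlist_minc: "mset (mlist (minc i \<alpha>)) = add_mset (axis i 1) (mset (mlist \<alpha>))"
  unfolding mset_mlist by (subst (1 2) sum.remove[of UNIV i]) (auto simp: minc_def intro!: sum.cong)

lemma mlen_minc: "mlen (minc i \<alpha>) = Suc (mlen \<alpha>)"
  unfolding mlen_def by (subst (1 2) sum.remove[of UNIV i]) (auto simp: minc_def intro!: sum.cong)

lemma mfact_minc: "mfact (minc i \<alpha>) = Suc (\<alpha> i) * mfact \<alpha>"
proof -
  have "(\<Prod>j\<in>UNIV - {i}. fact (minc i \<alpha> j)) = (\<Prod>j\<in>UNIV - {i}. fact (\<alpha> j) :: nat)"
    by (rule prod.cong) (auto simp: minc_def)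
  then show ?thesis unfolding mfact_def
    by (subst (1 2) prod.remove[of UNIV i]) (auto simp: minc_def algebra_simps)
qed

lemma mlist_zero: "mlist (\<lambda>_. 0) = []"
  by (simp add: mlist_def)

lemma Basis_axis: "b \<in> (Basis :: (real^'n) set) \<Longrightarrow> \<exists>i. b = axis i 1"
  by (auto simp: Basis_vec_def)

text \<open>The multi-index counts how often each direction occurs. With
  \<open>iter_partial_perm\<close> this turns bounds for all multi-indices into bounds for all lists
  of directions.\<close>

lemma mlist_exhaust:
  "set bs \<subseteq> (Basis :: (real^'n) set) \<Longrightarrow> \<exists>\<alpha>. mset bs = mset (mlist \<alpha>)"
proof (induction bs)
  case Nil
  show ?case by (intro exI[of _ "\<lambda>_. 0"]) (simp add: mlist_zero)
next
  case (Cons b bs)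
  then obtain \<alpha> i where "mset bs = mset (mlist \<alpha>)" "b = axis i 1" using Basis_axis by fastforce
  then show ?case by (intro exI[of _ "minc i \<alpha>"]) (simp add: mset_mlist_minc)
qed

lemma Basis3_cases:
  assumes "b \<in> (Basis :: ('a::euclidean_space \<times> 'a \<times> 'a) set)"
  obtains e where "e \<in> Basis" "b = (e, 0, 0)" | e where "e \<in> Basis" "b = (0, e, 0)" | e where "e \<in> Basis" "b = (0, 0, e)"
  using assms by (auto simp: Basis_prod_def zero_prod_def)

definition mlist3 :: "('n::finite \<Rightarrow> nat) \<Rightarrow> ('n \<Rightarrow> nat) \<Rightarrow> ('n \<Rightarrow> nat) \<Rightarrow> ((real^'n) \<times> (real^'n) \<times> (real^'n)) list" where
  "mlist3 \<alpha> \<beta> \<gamma> = map (\<lambda>e. (e, 0, 0)) (mlist \<alpha>) @ map (\<lambda>e. (0, e, 0)) (mlist \<beta>) @ map (\<lambda>e. (0, 0, e)) (mlist \<gamma>)"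

lemma mlist3_exhaust:
  "set bs \<subseteq> (Basis :: ((real^'n) \<times> (real^'n) \<times> (real^'n)) set) \<Longrightarrow> \<exists>\<alpha> \<beta> \<gamma>. mset bs = mset (mlist3 \<alpha> \<beta> \<gamma>)"
proof (induction bs)
  case Nil
  show ?case by (intro exI[of _ "\<lambda>_. 0"]) (simp add: mlist3_def mlist_zero)
next
  case (Cons b bs)
  then obtain \<alpha> \<beta> \<gamma> where IH: "mset bs = mset (mlist3 \<alpha> \<beta> \<gamma>)" by auto
  have "b \<in> Basis" using Cons.prems by simp
  then show ?case
  proof (cases rule: Basis3_cases)
    case (1 e)
    then obtain i where "e = axis i 1" using Basis_axis by blast
    then show ?thesis using IH 1
      by (intro exI[of _ "minc i \<alpha>"] exI[of _ \<beta>] exI[of _ \<gamma>]) (simp add: mlist3_def mset_mlist_minc)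
  next
    case (2 e)
    then obtain i where "e = axis i 1" using Basis_axis by blast
    then show ?thesis using IH 2
      by (intro exI[of _ \<alpha>] exI[of _ "minc i \<beta>"] exI[of _ \<gamma>]) (simp add: mlist3_def mset_mlist_minc)
  next
    case (3 e)
    then obtain i where "e = axis i 1" using Basis_axis by blast
    then show ?thesis using IH 3
      by (intro exI[of _ \<alpha>] exI[of _ \<beta>] exI[of _ "minc i \<gamma>"]) (simp add: mlist3_def mset_mlist_minc)
  qed
qed

lemma ycount_mset: "mset bs = mset cs \<Longrightarrow> ycount bs = ycount cs"
  unfolding ycount_def by (metis mset_filter size_mset)

lemma ycount_mlist3: "ycount (mlist3 \<alpha> \<beta> \<gamma>) = mlen \<beta>"
proof -
  have 1: "ycount (map (\<lambda>e. (e, 0, 0)) l) = 0" "ycount (map (\<lambda>e. (0, 0, e)) l) = 0" for l :: "(real^'a) list"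
    by (induction l) auto
  have 2: "ycount (map (\<lambda>e. (0, e, 0)) l) = length l" if "set l \<subseteq> Basis" for l :: "(real^'a) list"
    using that by (induction l) (auto simp: nonzero_Basis)
  show ?thesis by (simp add: mlist3_def 1 2[OF set_mlist] length_mlist)
qed

section \<open>Multi-index derivatives in each variable as lists of directions\<close>

lemma iter_partial_slot3: "iter_partial bs (\<lambda>\<xi>. A (x, y, \<xi>)) = (\<lambda>\<xi>. iter_partial (map (\<lambda>e. (0, 0, e)) bs) A (x, y, \<xi>))"
  using iter_partial_section_snd[of bs "\<lambda>p. A (x, p)" y] iter_partial_section_snd[of "map (Pair 0) bs" A x]
  by (simp add: o_def)

lemma iter_partial_slot2: "iter_partial bs (\<lambda>y. A (x, y, \<xi>)) = (\<lambda>y. iter_partial (map (\<lambda>e. (0, e, 0)) bs) A (x, y, \<xi>))"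
  using iter_partial_section_fst[of bs "\<lambda>p. A (x, p)" \<xi>] iter_partial_section_snd[of "map (\<lambda>b. (b, 0)) bs" A x]
  by (simp add: o_def)

lemma iter_partial_slot1:
  fixes A :: "'a::real_normed_vector \<times> 'b::real_normed_vector \<times> 'c::real_normed_vector \<Rightarrow> 'd::real_normed_vector"
  shows "iter_partial bs (\<lambda>x. A (x, y, \<xi>)) = (\<lambda>x. iter_partial (map (\<lambda>e. (e, 0, 0)) bs) A (x, y, \<xi>))"
  using iter_partial_section_fst[of bs A "(y, \<xi>)"] by (simp add: zero_prod_def)

lemma mderiv3:
  "mderiv \<alpha> (\<lambda>x'. mderiv \<beta> (\<lambda>y'. mderiv \<gamma> (\<lambda>\<xi>'. A (x', y', \<xi>')) \<xi>) y) x = iter_partial (mlist3 \<alpha> \<beta> \<gamma>) A (x, y, \<xi>)"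
  unfolding mderiv_iter_partial iter_partial_slot3 iter_partial_slot2 iter_partial_slot1 mlist3_def by simp

lemma mderiv2:
  "mderiv \<alpha> (\<lambda>x'. mderiv \<beta> (\<lambda>\<xi>'. C (x', \<xi>')) \<xi>) x =
    iter_partial (map (\<lambda>b. (b, 0)) (mlist \<alpha>) @ map (Pair 0) (mlist \<beta>)) C (x, \<xi>)"
  unfolding mderiv_iter_partial iter_partial_section_snd iter_partial_section_fst by simp

lemma ampl_from_mderiv:
  fixes a :: "real^'n \<Rightarrow> real^'n \<Rightarrow> real^'n \<Rightarrow> complex"
  assumes a_smooth: "smooth (\<lambda>(x, y, \<xi>). a x y \<xi>)"
    and a_bound: "\<forall>\<alpha> \<beta> \<gamma>. \<exists>C. \<forall>x y \<xi>.
      norm (mderiv \<alpha> (\<lambda>x'. mderiv \<beta> (\<lambda>y'. mderiv \<gamma> (\<lambda>\<xi>'. a x' y' \<xi>') \<xi>) y) x)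
        \<le> C * jbracket x powr m1 * jbracket y powr (m2 - real (mlen \<beta>)) * jbracket \<xi> powr m3"
  shows "ampl m1 m2 m3 (\<lambda>(x, y, \<xi>). a x y \<xi>)"
  unfolding ampl_def
proof (intro conjI allI impI a_smooth)
  let ?A = "\<lambda>(x, y, \<xi>). a x y \<xi>"
  fix bs :: "((real^'n) \<times> (real^'n) \<times> (real^'n)) list" assume bs: "set bs \<subseteq> Basis"
  \<comment> \<open>Sorting the directions into x, y and \<xi> preserves the number of y-directions,
    so the gain |\<beta>| in the hypothesis matches \<open>ycount bs\<close>.\<close>
  obtain \<alpha> \<beta> \<gamma> where p: "mset bs = mset (mlist3 \<alpha> \<beta> \<gamma>)" using mlist3_exhaust[OF bs] by blast
  obtain C where C: "\<And>x y \<xi>. norm (mderiv \<alpha> (\<lambda>x'. mderiv \<beta> (\<lambda>y'. mderiv \<gamma> (\<lambda>\<xi>'. ?A (x', y', \<xi>')) \<xi>) y) x)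
        \<le> C * jbracket x powr m1 * jbracket y powr (m2 - real (mlen \<beta>)) * jbracket \<xi> powr m3"
    using a_bound unfolding prod.case by blast
  have "norm (iter_partial bs ?A q) \<le> C * tw m1 (m2 - real (ycount bs)) m3 q" for q
  proof -
    obtain x y \<xi> where q: "q = (x, y, \<xi>)" by (cases q)
    have "ycount bs = mlen \<beta>" using ycount_mset[OF p] by (simp add: ycount_mlist3)
    then show ?thesis
      using C[where x=x and y=y and \<xi>=\<xi>] unfolding mderiv3 iter_partial_perm[OF a_smooth p bs] q by (simp add: tw_def mult.assoc)
  qed
  then show "\<exists>C. \<forall>q. norm (iter_partial bs ?A q) \<le> C * tw m1 (m2 - real (ycount bs)) m3 q" by blast
qed

section \<open>The expansion as a sum over multi-indices\<close>

lemma finite_mlen: "finite {\<beta> :: 'n::finite \<Rightarrow> nat. mlen \<beta> = j}"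
proof (rule finite_subset)
  show "{\<beta> :: 'n \<Rightarrow> nat. mlen \<beta> = j} \<subseteq> {f. \<forall>x. (x \<in> UNIV \<longrightarrow> f x \<in> {..j}) \<and> (x \<notin> UNIV \<longrightarrow> f x = 0)}"
    by (auto simp: mlen_def intro: member_le_sum)
  show "finite {f :: 'n \<Rightarrow> nat. \<forall>x. (x \<in> UNIV \<longrightarrow> f x \<in> {..j}) \<and> (x \<notin> UNIV \<longrightarrow> f x = 0)}"
    by (rule finite_set_of_finite_funs) auto
qed

text \<open>The inverse lowers the i-th entry; truncated subtraction is harmless because that entry
  is nonzero on the target. The bijection reindexes the sum in the multinomial formula.\<close>

lemma bij_betw_minc: "bij_betw (minc i) {\<beta>. mlen \<beta> = j} {\<beta>. mlen \<beta> = Suc j \<and> \<beta> i \<noteq> 0}"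
proof (rule bij_betwI[where g="\<lambda>\<beta>. \<beta>(i := \<beta> i - 1)"])
  show "(\<lambda>\<beta>. \<beta>(i := \<beta> i - 1)) \<in> {\<beta>. mlen \<beta> = Suc j \<and> \<beta> i \<noteq> 0} \<rightarrow> {\<beta>. mlen \<beta> = j}"
  proof (rule, clarify)
    fix \<beta> :: "'a \<Rightarrow> nat" assume "mlen \<beta> = Suc j" "0 < \<beta> i"
    moreover have "minc i (\<beta>(i := \<beta> i - 1)) = \<beta>" using \<open>0 < \<beta> i\<close> by (auto simp: minc_def)
    ultimately show "mlen (\<beta>(i := \<beta> i - 1)) = j" using mlen_minc[of i "\<beta>(i := \<beta> i - 1)"] by simp
  qed
qed (auto simp: mlen_minc, auto simp: minc_def)

definition mterm :: "('n::finite \<Rightarrow> nat) \<Rightarrow> ((real^'n) \<times> (real^'n) \<times> (real^'n) \<Rightarrow> complex) \<Rightarrow> (real^'n) \<times> (real^'n) \<times> (real^'n) \<Rightarrow> complex" where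
  "mterm \<beta> A = iter_partial (map (\<lambda>e. (0, 0, e)) (mlist \<beta>) @ map (\<lambda>e. (0, e, 0)) (mlist \<beta>)) A"

lemma smooth_mterm: "smooth A \<Longrightarrow> smooth (mterm \<beta> A)"
  unfolding mterm_def using set_mlist[of \<beta>] by (intro smooth_iter_partial) auto

lemma mterm_minc:
  assumes A: "smooth A"
  shows "partial_deriv (0, 0, axis i 1) (partial_deriv (0, axis i 1, 0) (mterm \<beta> A)) = mterm (minc i \<beta>) A"
proof -
  have "iter_partial ([(0, 0, axis i 1), (0, axis i 1, 0)] @ map (\<lambda>e. (0, 0, e)) (mlist \<beta>) @ map (\<lambda>e. (0, e, 0)) (mlist \<beta>)) A =
      iter_partial (map (\<lambda>e. (0, 0, e)) (mlist (minc i \<beta>)) @ map (\<lambda>e. (0, e, 0)) (mlist (minc i \<beta>))) A"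
    using set_mlist[of \<beta>] by (intro iter_partial_perm[OF A]) (auto simp: mset_mlist_minc axis_in_Basis_iff)
  then show ?thesis by (simp add: mterm_def)
qed

lemma sum_Basis_axis: "(\<Sum>e\<in>(Basis :: (real^'n) set). f e) = (\<Sum>i\<in>UNIV. f (axis i 1))"
proof -
  have "(Basis :: (real^'n) set) = (\<lambda>i. axis i 1) ` UNIV" by (auto simp: Basis_vec_def)
  then have "(\<Sum>e\<in>(Basis :: (real^'n) set). f e) = (\<Sum>e\<in>(\<lambda>i. axis i (1::real)) ` UNIV. f e)" by (rule arg_cong)
  also have "\<dots> = (\<Sum>i\<in>UNIV. f (axis i 1))"
    by (subst sum.reindex) (auto simp: inj_on_def axis_eq_axis)
  finally show ?thesis .
qed

text \<open>
  The multinomial theorem for the commuting operators \<open>-i \<partial>\<^sub>\<xi>\<^sub>i \<partial>\<^sub>y\<^sub>i\<close>. With \<open>E\<^sub>j\<close> the right-hand side, the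
  induction rests on \<open>(j + 1) E\<^sub>j\<^sub>+\<^sub>1 = mixed E\<^sub>j\<close>.
\<close>
lemma mixed_pow_multinomial:
  fixes A :: "(real^'n) \<times> (real^'n) \<times> (real^'n) \<Rightarrow> complex"
  assumes A: "smooth A"
  shows "complex_of_real (1 / fact j) * (mixed ^^ j) A q =
    (\<Sum>\<beta>\<in>{\<beta>. mlen \<beta> = j}. (- \<i>) ^ j / of_nat (mfact \<beta>) * mterm \<beta> A q)"
proof (induction j arbitrary: q)
  case 0
  have "{\<beta> :: 'n \<Rightarrow> nat. mlen \<beta> = 0} = {\<lambda>_. 0}" by (auto simp: mlen_def)
  then show ?case by (simp add: mterm_def mlist_zero mfact_def)
next
  case (Suc j)
  let ?c = "\<lambda>\<beta> :: 'n \<Rightarrow> nat. (- \<i>) ^ mlen \<beta> / of_nat (mfact \<beta>)"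
  have mf: "of_nat (mfact \<beta>) \<noteq> (0::complex)" for \<beta> :: "'n \<Rightarrow> nat" by (simp add: mfact_def)
  \<comment> \<open>The factor \<open>Suc (\<beta> i)\<close> cancels against the growth of the
    factorial, and one more factor -i is released.\<close>
  have c: "of_nat (Suc (\<beta> i)) * ?c (minc i \<beta>) = - \<i> * ?c \<beta>" for i \<beta>
    using mf[of \<beta>] unfolding mlen_minc mfact_minc of_nat_mult by (simp add: field_simps del: of_nat_Suc)
  have st: "smooth (\<lambda>q. ?c \<beta> * mterm \<beta> A q)" for \<beta> by (intro smooth_cmult smooth_mterm A)
  have IH: "(mixed ^^ j) A = (\<lambda>q. fact j * (\<Sum>\<beta>\<in>{\<beta>. mlen \<beta> = j}. ?c \<beta> * mterm \<beta> A q))"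
  proof
    fix q
    have "(mixed ^^ j) A q = fact j * (complex_of_real (1 / fact j) * (mixed ^^ j) A q)" by simp
    also have "\<dots> = fact j * (\<Sum>\<beta>\<in>{\<beta>. mlen \<beta> = j}. ?c \<beta> * mterm \<beta> A q)" unfolding Suc by simp
    finally show "(mixed ^^ j) A q = fact j * (\<Sum>\<beta>\<in>{\<beta>. mlen \<beta> = j}. ?c \<beta> * mterm \<beta> A q)" .
  qed
  have P: "partial_deriv (0, 0, axis i 1) (partial_deriv (0, axis i 1, 0) ((mixed ^^ j) A)) q =
      fact j * (\<Sum>\<beta>\<in>{\<beta>. mlen \<beta> = j}. ?c \<beta> * mterm (minc i \<beta>) A q)" for i
  proof -
    have b: "(0, axis i 1, 0) \<in> (Basis :: ((real^'n) \<times> (real^'n) \<times> (real^'n)) set)"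
      by (simp add: axis_in_Basis_iff)
    have s1: "smooth (partial_deriv (0, axis i 1, 0) (mterm \<beta> A))" for \<beta> by (intro smooth_partial_deriv smooth_mterm A b)
    show ?thesis
      unfolding IH partial_deriv_cmult[OF smooth_sum[OF st]] partial_deriv_sum[OF st] partial_deriv_cmult[OF smooth_mterm[OF A]]
        partial_deriv_cmult[OF smooth_sum[OF smooth_cmult[OF s1]]] partial_deriv_sum[OF smooth_cmult[OF s1]] partial_deriv_cmult[OF s1]
        mterm_minc[OF A] ..
  qed
  \<comment> \<open>j + 1 is written as the sum of the entries of \<beta>, which distributes each
    term over the coordinates from which it can arise.\<close>
  have "of_nat (Suc j) * (\<Sum>\<beta>\<in>{\<beta>. mlen \<beta> = Suc j}. ?c \<beta> * mterm \<beta> A q) =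
      (\<Sum>\<beta>\<in>{\<beta>. mlen \<beta> = Suc j}. \<Sum>i\<in>UNIV. of_nat (\<beta> i) * ?c \<beta> * mterm \<beta> A q)"
    unfolding sum_distrib_left
  proof (rule sum.cong[OF refl])
    fix \<beta> :: "'n \<Rightarrow> nat" assume "\<beta> \<in> {\<beta>. mlen \<beta> = Suc j}"
    then have "of_nat (Suc j) = (\<Sum>i\<in>UNIV. of_nat (\<beta> i) :: complex)" unfolding mlen_def by (simp flip: of_nat_sum)
    then show "of_nat (Suc j) * (?c \<beta> * mterm \<beta> A q) = (\<Sum>i\<in>UNIV. of_nat (\<beta> i) * ?c \<beta> * mterm \<beta> A q)"
      by (simp only: sum_distrib_right mult.assoc)
  qed
  also have "\<dots> = (\<Sum>i\<in>UNIV. \<Sum>\<beta>\<in>{\<beta>. mlen \<beta> = Suc j}. of_nat (\<beta> i) * ?c \<beta> * mterm \<beta> A q)"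
    by (rule sum.swap)
  \<comment> \<open>Terms with \<beta> i = 0 carry the factor 0; the remaining indices are exactly
    the images under \<open>minc i\<close>.\<close>
  also have "\<dots> = (\<Sum>i\<in>UNIV. \<Sum>\<beta>\<in>{\<beta>. mlen \<beta> = Suc j \<and> \<beta> i \<noteq> 0}. of_nat (\<beta> i) * ?c \<beta> * mterm \<beta> A q)"
    by (intro sum.cong refl sum.mono_neutral_right) (auto simp: finite_mlen)
  also have "\<dots> = (\<Sum>i\<in>UNIV. \<Sum>\<beta>\<in>{\<beta>. mlen \<beta> = j}. of_nat (minc i \<beta> i) * ?c (minc i \<beta>) * mterm (minc i \<beta>) A q)"
    by (intro sum.cong refl sum.reindex_bij_betw[symmetric] bij_betw_minc)
  also have "\<dots> = (\<Sum>i\<in>UNIV. \<Sum>\<beta>\<in>{\<beta>. mlen \<beta> = j}. - \<i> * (?c \<beta> * mterm (minc i \<beta>) A q))"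
    using c by (intro sum.cong refl) (simp add: minc_def mult.assoc del: of_nat_Suc)
  also have "\<dots> = - \<i> * (\<Sum>i\<in>UNIV. \<Sum>\<beta>\<in>{\<beta>. mlen \<beta> = j}. ?c \<beta> * mterm (minc i \<beta>) A q)"
    by (simp add: sum_distrib_left)
  also have "fact j * \<dots> = mixed ((mixed ^^ j) A) q"
    unfolding mixed_def sum_Basis_axis P by (simp add: sum_distrib_left mult_ac)
  finally have "fact j * (of_nat (Suc j) * (\<Sum>\<beta>\<in>{\<beta>. mlen \<beta> = Suc j}. ?c \<beta> * mterm \<beta> A q)) = mixed ((mixed ^^ j) A) q" .
  then have "(mixed ^^ Suc j) A q = fact (Suc j) * (\<Sum>\<beta>\<in>{\<beta>. mlen \<beta> = Suc j}. ?c \<beta> * mterm \<beta> A q)"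
    by (simp add: mult_ac del: of_nat_Suc)
  then show ?case by (simp del: fact_Suc)
qed

lemma expansion_sum_texp:
  fixes a :: "real^'n \<Rightarrow> real^'n \<Rightarrow> real^'n \<Rightarrow> complex"
  assumes A: "smooth (\<lambda>(x, y, \<xi>). a x y \<xi>)"
  shows "expansion_sum a N x \<xi> = diag_expansion N (\<lambda>(x, y, \<xi>). a x y \<xi>) (x, \<xi>)"
proof -
  let ?A = "\<lambda>(x, y, \<xi>). a x y \<xi>"
  have fin: "finite {\<beta> :: 'n \<Rightarrow> nat. mlen \<beta> < N}"
  proof -
    have "{\<beta> :: 'n \<Rightarrow> nat. mlen \<beta> < N} = (\<Union>j<N. {\<beta>. mlen \<beta> = j})" by auto
    then show ?thesis by (simp add: finite_mlen)
  qed
  have "mderiv \<beta> (\<lambda>\<eta>. mderiv \<beta> (\<lambda>y. ?A (x, y, \<eta>)) x) \<xi> = mterm \<beta> ?A (x, x, \<xi>)" for \<beta>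
    unfolding mderiv_iter_partial iter_partial_slot2 iter_partial_slot3 mterm_def by simp
  \<comment> \<open>Here i^(-|\<beta>|) becomes (-i)^|\<beta>|, since 1/i = -i.\<close>
  then have "expansion_sum a N x \<xi> = (\<Sum>\<beta>\<in>{\<beta>. mlen \<beta> < N}. (- \<i>) ^ mlen \<beta> / of_nat (mfact \<beta>) * mterm \<beta> ?A (x, x, \<xi>))"
    unfolding expansion_sum_def by (simp add: power_int_minus flip: power_inverse)
  also have "\<dots> = (\<Sum>j<N. \<Sum>\<beta>\<in>{\<beta> \<in> {\<beta>. mlen \<beta> < N}. mlen \<beta> = j}. (- \<i>) ^ mlen \<beta> / of_nat (mfact \<beta>) * mterm \<beta> ?A (x, x, \<xi>))"
    by (rule sum.group[symmetric]) (auto simp: fin)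
  also have "\<dots> = (\<Sum>j<N. \<Sum>\<beta>\<in>{\<beta>. mlen \<beta> = j}. (- \<i>) ^ j / of_nat (mfact \<beta>) * mterm \<beta> ?A (x, x, \<xi>))"
    by (intro sum.cong) auto
  also have "\<dots> = diag_expansion N ?A (x, \<xi>)"
    unfolding diag_expansion_def fst_conv snd_conv mixed_pow_multinomial[OF A] ..
  finally show ?thesis .
qed

text \<open>The Schwartz seminorms only see monomials. |x|^2 is at most n times the square of the
  largest coordinate, and the power 2l of that coordinate is one of the summands; the zero index
  contributes the constant 1.\<close>

lemma jbracket_pow_le_mpow:
  fixes x :: "real^'n"
  shows "((jbracket x)\<^sup>2) ^ l \<le> (1 + real CARD('n)) ^ l * (\<bar>mpow x (\<lambda>_. 0)\<bar> + (\<Sum>i\<in>UNIV. \<bar>mpow x (\<lambda>j. if j = i then 2 * l else 0)\<bar>))"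
proof -
  have m0: "mpow x (\<lambda>_. 0) = 1" by (simp add: mpow_def)
  have mi: "mpow x (\<lambda>j. if j = i then 2 * l else 0) = ((x $ i)\<^sup>2) ^ l" for i
  proof -
    have "(\<Prod>j\<in>UNIV. x $ j ^ (if j = i then 2 * l else 0)) = (\<Prod>j\<in>UNIV. if j = i then x $ j ^ (2 * l) else 1)"
      by (rule prod.cong) auto
    then show ?thesis unfolding mpow_def by (simp add: power_mult)
  qed
  have "Max ((\<lambda>i. (x $ i)\<^sup>2) ` UNIV) \<in> (\<lambda>i. (x $ i)\<^sup>2) ` UNIV" by (rule Max_in) auto
  then obtain k where k: "Max ((\<lambda>i. (x $ i)\<^sup>2) ` UNIV) = (x $ k)\<^sup>2" by (rule imageE) blast
  have le: "(x $ i)\<^sup>2 \<le> (x $ k)\<^sup>2" for i unfolding k[symmetric] by (rule Max_ge) auto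
  have "(norm x)\<^sup>2 = (\<Sum>i\<in>UNIV. (x $ i)\<^sup>2)"
    unfolding power2_norm_eq_inner inner_vec_def by (simp add: power2_eq_square)
  also have "\<dots> \<le> (\<Sum>i\<in>(UNIV :: 'n set). (x $ k)\<^sup>2)" by (rule sum_mono) (rule le)
  finally have n: "(jbracket x)\<^sup>2 \<le> 1 + real CARD('n) * (x $ k)\<^sup>2" unfolding jbracket_sq by simp
  let ?m = "max 1 ((x $ k)\<^sup>2)"
  have "real CARD('n) * (x $ k)\<^sup>2 \<le> real CARD('n) * ?m" by (intro mult_left_mono) auto
  then have "(jbracket x)\<^sup>2 \<le> (1 + real CARD('n)) * ?m" using n max.cobounded1[of 1 "(x $ k)\<^sup>2"] unfolding distrib_right by linarith
  then have "((jbracket x)\<^sup>2) ^ l \<le> ((1 + real CARD('n)) * ?m) ^ l" by (intro power_mono) auto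
  also have "\<dots> = (1 + real CARD('n)) ^ l * ?m ^ l" by (rule power_mult_distrib)
  also have "?m ^ l \<le> 1 + ((x $ k)\<^sup>2) ^ l" by (simp add: max_def)
  also have "((x $ k)\<^sup>2) ^ l \<le> (\<Sum>i\<in>UNIV. ((x $ i)\<^sup>2) ^ l)"
    by (rule member_le_sum) auto
  finally show ?thesis by (simp add: m0 mi mult_left_mono)
qed

text \<open>Since s is arbitrary, u fits every weight class and its transform decays fast enough to
  absorb any polynomial growth of the symbol.\<close>

lemma schwartz_ubd:
  fixes u :: "real^'n \<Rightarrow> complex"
  assumes u: "u \<in> schwartz"
  shows "ubd1 (\<lambda>x. jbracket x powr s) u"
proof (rule ubdI)
  have su: "smooth u" using u by (simp add: schwartz_def)
  then show "smooth u" .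
  fix bs :: "(real^'n) list" assume bs: "set bs \<subseteq> Basis"
  obtain \<beta> where \<beta>: "mset bs = mset (mlist \<beta>)" using mlist_exhaust[OF bs] by blast
  have eq: "iter_partial bs u = mderiv \<beta> u"
    unfolding mderiv_iter_partial by (rule iter_partial_perm[OF su \<beta> bs])
  have "\<forall>\<alpha>. \<exists>C. \<forall>x. norm (complex_of_real (mpow x \<alpha>) * mderiv \<beta> u x) \<le> C"
    using u by (simp add: schwartz_def)
  then obtain K where K: "\<And>\<alpha> x. norm (complex_of_real (mpow x \<alpha>) * mderiv \<beta> u x) \<le> K \<alpha>" by metis
  obtain l :: nat where "- s / 2 \<le> real l" using real_arch_simple by blast
  then have l: "- 2 * real l \<le> s" by simp
  define C where "C = (1 + real CARD('n)) ^ l * (K (\<lambda>_. 0) + (\<Sum>i\<in>UNIV. K (\<lambda>j. if j = i then 2 * l else 0)))"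
  have "norm (iter_partial bs u x) \<le> \<bar>C\<bar> * jbracket x powr s" for x
  proof -
    have "((jbracket x)\<^sup>2) ^ l * norm (mderiv \<beta> u x) \<le>
      (1 + real CARD('n)) ^ l * (\<bar>mpow x (\<lambda>_. 0)\<bar> + (\<Sum>i\<in>UNIV. \<bar>mpow x (\<lambda>j. if j = i then 2 * l else 0)\<bar>)) * norm (mderiv \<beta> u x)"
      by (intro mult_right_mono jbracket_pow_le_mpow) auto
    also have "\<dots> = (1 + real CARD('n)) ^ l * (norm (complex_of_real (mpow x (\<lambda>_. 0)) * mderiv \<beta> u x) +
        (\<Sum>i\<in>UNIV. norm (complex_of_real (mpow x (\<lambda>j. if j = i then 2 * l else 0)) * mderiv \<beta> u x)))"
      by (simp only: norm_mult norm_of_real sum_distrib_right distrib_right mult.assoc)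
    also have "\<dots> \<le> C" unfolding C_def by (intro mult_left_mono add_mono sum_mono K) auto
    finally have 1: "jbracket x powr (2 * real l) * norm (mderiv \<beta> u x) \<le> C" unfolding jbracket_powr_even .
    have "0 \<le> jbracket x powr (2 * real l) * norm (mderiv \<beta> u x)" by simp
    then have C0: "0 \<le> C" using 1 by linarith
    have "norm (mderiv \<beta> u x) \<le> C / jbracket x powr (2 * real l)"
      using 1 by (subst pos_le_divide_eq) (auto simp: mult.commute)
    also have "\<dots> = C * jbracket x powr (- 2 * real l)" by (simp add: powr_minus divide_inverse)
    also have "\<dots> \<le> C * jbracket x powr s" using C0 l by (intro mult_left_mono jbracket_powr_mono) auto
    finally show ?thesis using C0 by (simp add: eq)
  qed
  then show "\<exists>C. \<forall>i\<in>UNIV. \<forall>x. norm (iter_partial bs u x) \<le> C * jbracket x powr s" by blast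
qed simp

section \<open>Reduction to a pseudo-differential operator\<close>

text \<open>The cutoff acts on the original variables; after the shift to the centre (x, \<zeta>) it
  reads \<gamma>(\<epsilon>(x, \<zeta>) + \<epsilon> p), a cutoff with a moving centre. This is why
  \<open>cutoff_scaled_ubd\<close> is uniform in the centre.\<close>

definition osc_cut :: "((real^'n) \<times> (real^'n) \<times> (real^'n) \<Rightarrow> complex) \<Rightarrow> ((real^'n) \<times> (real^'n) \<Rightarrow> complex) \<Rightarrow>
    real \<Rightarrow> real^'n \<Rightarrow> real^'n \<Rightarrow> (real^'n) \<times> (real^'n) \<Rightarrow> complex" where
  "osc_cut A \<gamma> \<epsilon> x \<zeta> p = ampl_at A 1 x \<zeta> p * \<gamma> (\<epsilon> *\<^sub>R (x, \<zeta>) + \<epsilon> *\<^sub>R p)"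

lemma osc_cut_shift: "osc_cut A \<gamma> \<epsilon> x \<zeta> p = A (x, (x, \<zeta>) + p) * \<gamma> (\<epsilon> *\<^sub>R ((x, \<zeta>) + p))"
proof -
  have "(x, \<zeta>) + p = (x + 1 *\<^sub>R fst p, \<zeta> + snd p)" by (simp add: prod_eq_iff)
  then have 1: "A (x, (x, \<zeta>) + p) = A (x, x + 1 *\<^sub>R fst p, \<zeta> + snd p)" by (simp only:)
  show ?thesis unfolding osc_cut_def ampl_at_def scaleR_add_right 1 ..
qed

lemma osc_cut_nice:
  fixes A :: "(real^'n) \<times> (real^'n) \<times> (real^'n) \<Rightarrow> complex"
  assumes A: "ampl m1 m m3 A" and \<gamma>: "cutoff \<gamma>" and \<epsilon>: "\<epsilon> > 0"
  shows "ubd1 (pw s s) (osc_cut A \<gamma> \<epsilon> x \<zeta>)"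
proof -
  have "ubd1 (pw \<bar>m\<bar> \<bar>m3\<bar>) (ampl_at A 1 x \<zeta>)"
    by (rule sub_ubd_local[OF ampl_ubd[OF A], where R="norm x + norm \<zeta>"]) auto
  from ubd_pw_mult[OF this cutoff_scaled_ubd1[OF \<gamma> \<epsilon>, of "s - \<bar>m\<bar>" "s - \<bar>m3\<bar>" "\<epsilon> *\<^sub>R (x, \<zeta>)"]]
  show ?thesis by (simp add: osc_cut_def[abs_def])
qed

text \<open>Before the shift the compact support of the cutoff alone gives the decay that Fubini
  requires.\<close>

lemma osc_cut_unshifted_nice:
  fixes A :: "(real^'n) \<times> (real^'n) \<times> (real^'n) \<Rightarrow> complex"
  assumes A: "smooth A" and \<gamma>: "cutoff \<gamma>" and \<epsilon>: "\<epsilon> > 0"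
  shows "ubd1 (pw s s) (\<lambda>p. A (x, p) * \<gamma> (\<epsilon> *\<^sub>R p))"
proof -
  obtain R where R: "\<And>p. R < norm p \<Longrightarrow> \<gamma> p = 0" using cutoff_support[OF \<gamma>] by blast
  show ?thesis
  proof (rule ubd1_compact_support[where R="R / \<epsilon>"])
    show "smooth (\<lambda>p. A (x, p) * \<gamma> (\<epsilon> *\<^sub>R p))"
      using \<gamma> smooth_scaled[of \<gamma> 0 \<epsilon>] by (intro smooth_mult smooth_section_snd A) (simp_all add: cutoff_def)
    show "A (x, p) * \<gamma> (\<epsilon> *\<^sub>R p) = 0" if "R / \<epsilon> < norm p" for p
      using that \<epsilon> by (simp add: R pos_divide_less_eq mult.commute)
    show "continuous_on UNIV (pw s s :: (real^'n) \<times> (real^'n) \<Rightarrow> real)"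
      unfolding pw_def[abs_def] by (intro continuous_intros)
  qed (rule pw_pos)
qed

lemma pw_integrable_pair:
  fixes f :: "(real^'n) \<times> (real^'n) \<Rightarrow> complex"
  assumes c: "continuous_on UNIV f" and b: "\<And>p. norm (f p) \<le> C * pw s s p" and s: "s \<le> - 2 * real CARD('n)"
  shows "integrable (lborel \<Otimes>\<^sub>M lborel) f" "integrable lborel f"
proof -
  show "integrable (lborel \<Otimes>\<^sub>M lborel) f"
  proof (rule integrable_prod_bound[OF borel_measurable_continuous_onI[OF c]])
    show "integrable lborel (\<lambda>y::real^'n. C * jbracket y powr s)" "integrable lborel (\<lambda>\<eta>::real^'n. jbracket \<eta> powr s)"
      using s by (auto intro!: integrable_jbracket)
    show "norm (f (y, \<eta>)) \<le> C * jbracket y powr s * jbracket \<eta> powr s" for y \<eta> :: "real^'n"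
      using b[of "(y, \<eta>)"] by (simp add: pw_def mult.assoc)
  qed
  then show "integrable lborel f" by (simp add: lborel_prod)
qed

lemma lborel_iterated:
  fixes f :: "(real^'n) \<times> (real^'n) \<Rightarrow> complex"
  assumes "integrable (lborel \<Otimes>\<^sub>M lborel) f"
  shows "(LINT \<eta>|lborel. LINT y|lborel. f (y, \<eta>)) = integral\<^sup>L lborel f"
  using lborel_pair.integral_snd[of "\<lambda>y \<eta>. f (y, \<eta>)"] assms by (simp add: lborel_prod)

lemma osc_cut_plain:
  fixes A :: "(real^'n) \<times> (real^'n) \<times> (real^'n) \<Rightarrow> complex"
  assumes A: "ampl m1 m m3 A" and \<gamma>: "cutoff \<gamma>" and \<epsilon>: "\<epsilon> > 0"
  shows "osc_I k (osc_cut A \<gamma> \<epsilon> x \<zeta>) = complex_of_real (1 / (2 * pi) ^ CARD('n)) *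
      (LINT q|lborel. exp (- \<i> * complex_of_real (fst q \<bullet> snd q)) * osc_cut A \<gamma> \<epsilon> x \<zeta> q)"
proof -
  define s where "s = - 2 * real CARD('n)"
  have n: "ubd1 (pw s s) (osc_cut A \<gamma> \<epsilon> x \<zeta>)" by (rule osc_cut_nice[OF A \<gamma> \<epsilon>])
  obtain C where C: "\<And>p. norm (osc_cut A \<gamma> \<epsilon> x \<zeta> p) \<le> C * pw s s p" by (rule ubdE0[OF n]) blast
  have "integrable (lborel \<Otimes>\<^sub>M lborel) (\<lambda>q. exp (- \<i> * complex_of_real (fst q \<bullet> snd q)) * osc_cut A \<gamma> \<epsilon> x \<zeta> q)"
    using integrable_osc_plain[OF smooth_continuous[OF ubd_smooth[OF n UNIV_I]] C, unfolded case_prod_beta prod.collapse]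
    by (simp add: s_def)
  from lborel_iterated[OF this] osc_I_plain(1)[OF n, of k] show ?thesis by (simp add: s_def)
qed

lemma osc_cut_measurable:
  fixes A :: "(real^'n) \<times> (real^'n) \<times> (real^'n) \<Rightarrow> complex"
  assumes A: "ampl m1 m m3 A" and \<gamma>: "cutoff \<gamma>" and \<epsilon>: "\<epsilon> > 0"
  shows "(\<lambda>\<zeta>. osc_I k (osc_cut A \<gamma> \<epsilon> x \<zeta>)) \<in> borel_measurable borel"
proof -
  have sA: "continuous_on UNIV A" by (intro smooth_continuous ampl_smooth[OF A])
  have cg: "continuous_on UNIV \<gamma>" using \<gamma> by (auto simp: cutoff_def intro: smooth_continuous)
  have "continuous_on UNIV (\<lambda>(\<zeta>, q). exp (- \<i> * complex_of_real (fst q \<bullet> snd q)) * osc_cut A \<gamma> \<epsilon> x \<zeta> q)"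
    unfolding osc_cut_shift case_prod_beta
    by (intro continuous_intros continuous_on_compose2[OF sA] continuous_on_compose2[OF cg]) auto
  then have "(\<lambda>(\<zeta>, q). exp (- \<i> * complex_of_real (fst q \<bullet> snd q)) * osc_cut A \<gamma> \<epsilon> x \<zeta> q) \<in> borel_measurable (borel \<Otimes>\<^sub>M borel)"
    unfolding borel_prod by (rule borel_measurable_continuous_onI)
  then have [measurable]: "(\<lambda>(\<zeta>, q). exp (- \<i> * complex_of_real (fst q \<bullet> snd q)) * osc_cut A \<gamma> \<epsilon> x \<zeta> q) \<in> borel_measurable (borel \<Otimes>\<^sub>M lborel)"
    by (simp cong: measurable_cong_sets)
  show ?thesis unfolding osc_cut_plain[OF A \<gamma> \<epsilon>] by measurable
qed

text \<open>Insert \<open>u(y) = (2\<pi>)\<^sup>-\<^sup>n \<integral> e\<^sup>i\<^sup>y\<^sup>\<zeta> (fourier u)(\<zeta>) d\<zeta>\<close>, exchange the integrals and shift \<open>(y,\<eta>)\<close> by \<open>(x,\<zeta>)\<close>.\<close>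
lemma amplitude_integral_cutoff:
  fixes A :: "(real^'n) \<times> (real^'n) \<times> (real^'n) \<Rightarrow> complex"
  assumes A: "ampl m1 m m3 A" and \<gamma>: "cutoff \<gamma>" and \<epsilon>: "\<epsilon> > 0" and u: "u \<in> schwartz"
  shows "amplitude_integral (\<lambda>x y \<xi>. A (x, y, \<xi>) * \<gamma> (\<epsilon> *\<^sub>R y, \<epsilon> *\<^sub>R \<xi>)) u x =
    complex_of_real (1 / (2 * pi) ^ CARD('n)) *
    (LINT \<zeta>|lborel. exp (\<i> * complex_of_real (x \<bullet> \<zeta>)) * osc_I k (osc_cut A \<gamma> \<epsilon> x \<zeta>) * fourier u \<zeta>)"
proof -
  define s where "s = - 2 * real CARD('n)"
  define K where "K = complex_of_real (1 / (2 * pi) ^ CARD('n))"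
  define H where "H p = A (x, p) * \<gamma> (\<epsilon> *\<^sub>R p)" for p
  have uH: "ubd1 (pw s s) H"
    unfolding H_def[abs_def] by (rule osc_cut_unshifted_nice[OF ampl_smooth[OF A] \<gamma> \<epsilon>])
  have cH: "continuous_on UNIV H" by (rule smooth_continuous[OF ubd_smooth[OF uH UNIV_I]])
  obtain C where C: "C \<ge> 0" "\<And>p. norm (H p) \<le> C * pw s s p" by (rule ubdE0[OF uH]) blast
  have uu: "ubd1 (\<lambda>x. jbracket x powr t) u" for t by (rule schwartz_ubd[OF u])
  have cu: "continuous_on UNIV u" by (rule smooth_continuous[OF ubd_smooth[OF uu UNIV_I]])
  have iu: "integrable lborel u" by (rule ubd_integrable[OF uu[of "- 2 * real CARD('n)"] UNIV_I]) simp
  have cf: "continuous_on UNIV (fourier u)" by (rule fourier_continuous[OF iu])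
  have if': "integrable lborel (fourier u)" by (rule fourier_inversion(2)[OF uu UNIV_I order_refl])
  obtain U where U: "U \<ge> 0" "\<And>y. norm (u y) \<le> U" by (rule ubdE0[OF uu[of 0]]) auto
  have inv: "u y = K * (LINT \<zeta>|lborel. exp (\<i> * complex_of_real (y \<bullet> \<zeta>)) * fourier u \<zeta>)" for y
    unfolding fourier_inversion(1)[OF uu UNIV_I order_refl] K_def by simp
  let ?e = "\<lambda>p. exp (\<i> * complex_of_real ((x - fst p) \<bullet> snd p))"
  define F where "F p \<zeta> = ?e p * H p * (exp (\<i> * complex_of_real (fst p \<bullet> \<zeta>)) * fourier u \<zeta>)" for p \<zeta>
  have IF: "integrable (lborel \<Otimes>\<^sub>M lborel) (\<lambda>(p, \<zeta>). F p \<zeta>)"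
  proof (rule integrable_prod_bound)
    have "continuous_on UNIV (\<lambda>(p, \<zeta>). F p \<zeta>)"
      unfolding F_def case_prod_beta
      by (intro continuous_intros continuous_on_compose2[OF cH] continuous_on_compose2[OF cf]) auto
    then show "(\<lambda>(p, \<zeta>). F p \<zeta>) \<in> borel_measurable borel" by (rule borel_measurable_continuous_onI)
    show "integrable lborel (\<lambda>p. norm (H p))"
      by (intro integrable_norm pw_integrable_pair(2)[OF cH C(2)]) (simp add: s_def)
    show "integrable lborel (\<lambda>\<zeta>. norm (fourier u \<zeta>))" using if' by simp
    show "norm (case (p, \<zeta>) of (p, \<zeta>) \<Rightarrow> F p \<zeta>) \<le> norm (H p) * norm (fourier u \<zeta>)" for p \<zeta>
      by (simp add: F_def norm_mult)
  qed
  have IH: "integrable (lborel \<Otimes>\<^sub>M lborel) (\<lambda>p. ?e p * H p * u (fst p))"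
  proof (rule pw_integrable_pair(1))
    show "continuous_on UNIV (\<lambda>p. ?e p * H p * u (fst p))"
      by (intro continuous_intros cH continuous_on_compose2[OF cu]) auto
    show "norm (?e p * H p * u (fst p)) \<le> (C * U) * pw s s p" for p
      using mult_mono[OF C(2)[of p] U(2)[of "fst p"]] C(1) less_imp_le[OF pw_pos[of s s p]]
      by (simp add: norm_mult mult_ac)
  qed (simp add: s_def)
  have inner: "(LINT p|lborel. F p \<zeta>) = fourier u \<zeta> * exp (\<i> * complex_of_real (x \<bullet> \<zeta>)) *
      (LINT q|lborel. exp (- \<i> * complex_of_real (fst q \<bullet> snd q)) * osc_cut A \<gamma> \<epsilon> x \<zeta> q)" for \<zeta>
  proof -
    have "(\<lambda>p. F p \<zeta>) \<in> borel_measurable borel"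
      unfolding F_def by (intro borel_measurable_continuous_onI continuous_intros cH)
    then have "(LINT p|lborel. F p \<zeta>) = (LINT q|lborel. F ((x, \<zeta>) + q) \<zeta>)"
      by (rule lborel_integral_translate[symmetric])
    also have "\<dots> = (LINT q|lborel. (fourier u \<zeta> * exp (\<i> * complex_of_real (x \<bullet> \<zeta>))) *
        (exp (- \<i> * complex_of_real (fst q \<bullet> snd q)) * osc_cut A \<gamma> \<epsilon> x \<zeta> q))"
    proof (rule Bochner_Integration.integral_cong[OF refl])
      fix q :: "(real^'n) \<times> (real^'n)"
      \<comment> \<open>The phases: with y = x + q_1 and \<eta> = \<zeta> + q_2 one has (x -
        y).\<eta> + y.\<zeta> = x.\<zeta> - q_1.q_2.\<close>
      have "?e ((x, \<zeta>) + q) * exp (\<i> * complex_of_real (fst ((x, \<zeta>) + q) \<bullet> \<zeta>)) =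
          exp (\<i> * complex_of_real (x \<bullet> \<zeta>)) * exp (- \<i> * complex_of_real (fst q \<bullet> snd q))"
        unfolding exp_add[symmetric] by (rule arg_cong[where f=exp]) (simp add: inner_add_left inner_add_right algebra_simps)
      then show "F ((x, \<zeta>) + q) \<zeta> = (fourier u \<zeta> * exp (\<i> * complex_of_real (x \<bullet> \<zeta>))) *
        (exp (- \<i> * complex_of_real (fst q \<bullet> snd q)) * osc_cut A \<gamma> \<epsilon> x \<zeta> q)"
        unfolding F_def osc_cut_shift H_def by (simp only: mult_ac)
    qed
    finally show ?thesis by (simp only: integral_mult_right_zero)
  qed
  have "amplitude_integral (\<lambda>x y \<xi>. A (x, y, \<xi>) * \<gamma> (\<epsilon> *\<^sub>R y, \<epsilon> *\<^sub>R \<xi>)) u x =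
      K * (LINT \<eta>|lborel. LINT y|lborel. ?e (y, \<eta>) * H (y, \<eta>) * u (fst (y, \<eta>)))"
    by (simp add: amplitude_integral_def K_def H_def)
  also have "\<dots> = K * (LINT p|lborel. ?e p * H p * u (fst p))"
    by (subst lborel_iterated[OF IH]) (rule refl)
  also have "\<dots> = K * (LINT p|lborel. K * (LINT \<zeta>|lborel. F p \<zeta>))"
    unfolding F_def integral_mult_right_zero inv[symmetric] by (subst inv) (simp add: mult_ac)
  also have "\<dots> = K * (K * (LINT \<zeta>|lborel. LINT p|lborel. F p \<zeta>))"
    unfolding integral_mult_right_zero lborel_pair.Fubini_integral[OF IF] ..
  \<comment> \<open>One factor K belongs to the pseudo-differential operator, the other is absorbed
    into \<open>osc_I\<close>.\<close>
  also have "\<dots> = K * (LINT \<zeta>|lborel. K * (LINT p|lborel. F p \<zeta>))"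
    by (simp only: integral_mult_right_zero)
  also have "(\<lambda>\<zeta>. K * (LINT p|lborel. F p \<zeta>)) =
      (\<lambda>\<zeta>. exp (\<i> * complex_of_real (x \<bullet> \<zeta>)) * osc_I k (osc_cut A \<gamma> \<epsilon> x \<zeta>) * fourier u \<zeta>)"
    unfolding inner osc_cut_plain[OF A \<gamma> \<epsilon>] K_def[symmetric] by (rule ext) (simp only: mult_ac)
  finally show ?thesis unfolding K_def .
qed

text \<open>Dominated convergence in \<zeta>: the cut-off symbols are bounded by C w(\<zeta>) with C
  independent of \<epsilon> \<le> 1, and the rapid decay of the transform of u absorbs w. The limit
  does not involve \<gamma>, which is the independence of the cutoff.\<close>

lemma has_osc_value_pseudo:
  fixes A :: "(real^'n) \<times> (real^'n) \<times> (real^'n) \<Rightarrow> complex"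
  assumes A: "ampl m1 m m3 A" and k: "\<bar>m3\<bar> - 2 * real k \<le> - 2 * real CARD('n)" and u: "u \<in> schwartz"
  shows "has_osc_value (\<lambda>x y \<xi>. A (x, y, \<xi>)) u x (pseudo_diff_op (\<lambda>x \<xi>. osc_c k 1 A (x, \<xi>)) u x)"
  unfolding has_osc_value_def
proof (intro allI impI)
  fix \<gamma> :: "(real^'n) \<times> (real^'n) \<Rightarrow> complex" assume \<gamma>: "cutoff \<gamma>"
  let ?f = "\<lambda>\<epsilon>. amplitude_integral (\<lambda>x y \<xi>. A (x, y, \<xi>) * \<gamma> (\<epsilon> *\<^sub>R y, \<epsilon> *\<^sub>R \<xi>)) u x"
  let ?L = "pseudo_diff_op (\<lambda>x \<xi>. osc_c k 1 A (x, \<xi>)) u x"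
  have uu: "ubd1 (\<lambda>x. jbracket x powr t) u" for t by (rule schwartz_ubd[OF u])
  have iu: "integrable lborel u" by (rule ubd_integrable[OF uu[of "- 2 * real CARD('n)"] UNIV_I]) simp
  have mf: "fourier u \<in> borel_measurable borel" by (rule borel_measurable_continuous_onI[OF fourier_continuous[OF iu]])
  have lim: "(\<lambda>i. ?f (\<epsilon> i)) \<longlonglongrightarrow> ?L" if \<epsilon>: "\<And>i. 0 < \<epsilon> i" "\<And>i. \<epsilon> i \<le> 1" "\<epsilon> \<longlonglongrightarrow> 0" for \<epsilon> :: "nat \<Rightarrow> real"
  proof -
    define w where "w \<zeta> = jbracket x powr (m1 + m) * jbracket \<zeta> powr m3" for \<zeta> :: "real^'n"
    have w: "w \<zeta> > 0" for \<zeta> unfolding w_def by (intro mult_pos_pos) auto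
    have sA: "smooth A" by (rule ampl_smooth[OF A])
    have scut: "smooth (osc_cut A \<gamma> e x \<zeta>)" if "e > 0" for e \<zeta>
      using ubd_smooth[OF osc_cut_nice[OF A \<gamma> that] UNIV_I] .
    \<comment> \<open>Normalised by w and indexed by the step and by \<zeta> together, so that the
      constant C below depends on neither.\<close>
    have F: "ubd (pw \<bar>m\<bar> \<bar>m3\<bar>) (UNIV :: (nat \<times> (real^'n)) set)
        (\<lambda>j p. complex_of_real (1 / w (snd j)) * osc_cut A \<gamma> (\<epsilon> (fst j)) x (snd j) p)"
    proof -
      have 1: "ubd (pw \<bar>m\<bar> \<bar>m3\<bar>) (UNIV :: (nat \<times> (real^'n)) set)
          (\<lambda>j p. complex_of_real (1 / w (snd j)) * ampl_at A 1 x (snd j) p)"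
        using ubd_reindex[OF sub_ubd[OF ampl_ubd[OF A]], of UNIV "\<lambda>j. (1, x, snd j)"] by (simp add: w_def)
      have 2: "ubd (pw 0 0) (UNIV :: (nat \<times> (real^'n)) set)
          (\<lambda>j p. \<gamma> (\<epsilon> (fst j) *\<^sub>R (x, snd j) + \<epsilon> (fst j) *\<^sub>R p))"
        using ubd_reindex[OF cutoff_scaled_ubd[OF \<gamma>], of UNIV "\<lambda>j. (\<epsilon> (fst j), \<epsilon> (fst j) *\<^sub>R (x, snd j))"] \<epsilon>
        by (simp add: less_imp_le)
      show ?thesis using ubd_pw_mult[OF 1 2] by (simp add: osc_cut_def mult.assoc)
    qed
    obtain C where C: "C \<ge> 0" "\<And>j. norm (osc_I k (\<lambda>p. complex_of_real (1 / w (snd j)) * osc_cut A \<gamma> (\<epsilon> (fst j)) x (snd j) p)) \<le> C"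
      using osc_I_bound[OF F k] by blast
    have bnd: "norm (osc_I k (osc_cut A \<gamma> (\<epsilon> i) x \<zeta>)) \<le> C * w \<zeta>" for i \<zeta>
    proof -
      have "norm (osc_I k (osc_cut A \<gamma> (\<epsilon> i) x \<zeta>)) / w \<zeta> \<le> C"
        using C(2)[of "(i, \<zeta>)"] w[of \<zeta>] unfolding fst_conv snd_conv osc_I_cmult[OF scut[OF \<epsilon>(1)]] norm_mult norm_of_real by simp
      then show ?thesis using w[of \<zeta>] by (simp add: pos_divide_le_eq)
    qed
    have conv: "(\<lambda>i. osc_I k (osc_cut A \<gamma> (\<epsilon> i) x \<zeta>)) \<longlonglongrightarrow> osc_c k 1 A (x, \<zeta>)" for \<zeta>
    proof -
      have u1: "ubd (pw \<bar>m\<bar> \<bar>m3\<bar>) UNIV (\<lambda>i. osc_cut A \<gamma> (\<epsilon> i) x \<zeta>)"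
        using ubd_cmult[OF ubd_reindex[OF F, of UNIV "\<lambda>i. (i, \<zeta>)"], of "complex_of_real (w \<zeta>)"] w[of \<zeta>]
        by (simp add: mult.assoc[symmetric])
      show ?thesis
        using osc_I_tendsto[OF u1 k] pconv_cutoff[OF \<gamma> \<epsilon>(3) smooth_sub[OF sA, of 1 x \<zeta>], of "(x, \<zeta>)"]
        by (simp add: osc_cut_def[abs_def] osc_c_def)
    qed
    \<comment> \<open>The decay of order 2l compensates the growth of order m3 of the symbol and
      leaves an integrable majorant.\<close>
    obtain l :: nat where "(m3 + 2 * real CARD('n)) / 2 \<le> real l" using real_arch_simple by blast
    then have l: "m3 - 2 * real l \<le> - 2 * real CARD('n)" by simp
    obtain D where D: "D \<ge> 0" "\<And>\<zeta>. norm (fourier u \<zeta>) \<le> D * jbracket \<zeta> powr (- 2 * real l)"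
      using fourier_decay[OF uu[of "- 2 * real CARD('n)"] order_refl, of l] by auto
    have "(\<lambda>i. LINT \<zeta>|lborel. exp (\<i> * complex_of_real (x \<bullet> \<zeta>)) * osc_I k (osc_cut A \<gamma> (\<epsilon> i) x \<zeta>) * fourier u \<zeta>) \<longlonglongrightarrow>
        (LINT \<zeta>|lborel. exp (\<i> * complex_of_real (x \<bullet> \<zeta>)) * osc_c k 1 A (x, \<zeta>) * fourier u \<zeta>)"
    proof (rule integral_dominated_convergence[where w="\<lambda>\<zeta>. C * jbracket x powr (m1 + m) * D * jbracket \<zeta> powr (m3 - 2 * real l)"])
      have me: "(\<lambda>\<zeta>. exp (\<i> * complex_of_real (x \<bullet> \<zeta>))) \<in> borel_measurable borel"
        by (intro borel_measurable_continuous_onI continuous_intros)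
      have mc: "(\<lambda>\<zeta>. osc_c k 1 A (x, \<zeta>)) \<in> borel_measurable borel"
        by (intro borel_measurable_continuous_onI smooth_continuous smooth_section_snd smooth_osc_c[OF A k])
      show "(\<lambda>\<zeta>. exp (\<i> * complex_of_real (x \<bullet> \<zeta>)) * osc_c k 1 A (x, \<zeta>) * fourier u \<zeta>) \<in> borel_measurable lborel"
        using me mc mf by simp
      show "(\<lambda>\<zeta>. exp (\<i> * complex_of_real (x \<bullet> \<zeta>)) * osc_I k (osc_cut A \<gamma> (\<epsilon> i) x \<zeta>) * fourier u \<zeta>) \<in> borel_measurable lborel" for i
        using me osc_cut_measurable[OF A \<gamma> \<epsilon>(1)] mf by simp
      show "integrable lborel (\<lambda>\<zeta>::real^'n. C * jbracket x powr (m1 + m) * D * jbracket \<zeta> powr (m3 - 2 * real l))"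
        using l by (intro integrable_mult_right integrable_jbracket) simp
      show "AE \<zeta> in lborel. (\<lambda>i. exp (\<i> * complex_of_real (x \<bullet> \<zeta>)) * osc_I k (osc_cut A \<gamma> (\<epsilon> i) x \<zeta>) * fourier u \<zeta>)
          \<longlonglongrightarrow> exp (\<i> * complex_of_real (x \<bullet> \<zeta>)) * osc_c k 1 A (x, \<zeta>) * fourier u \<zeta>"
        by (intro AE_I2 tendsto_intros conv)
      show "AE \<zeta> in lborel. norm (exp (\<i> * complex_of_real (x \<bullet> \<zeta>)) * osc_I k (osc_cut A \<gamma> (\<epsilon> i) x \<zeta>) * fourier u \<zeta>)
          \<le> C * jbracket x powr (m1 + m) * D * jbracket \<zeta> powr (m3 - 2 * real l)" for i
      proof (rule AE_I2)
        fix \<zeta> :: "real^'n"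
        have "norm (exp (\<i> * complex_of_real (x \<bullet> \<zeta>)) * osc_I k (osc_cut A \<gamma> (\<epsilon> i) x \<zeta>) * fourier u \<zeta>) \<le>
            (C * w \<zeta>) * (D * jbracket \<zeta> powr (- 2 * real l))"
          unfolding norm_mult norm_exp_i_times mult_1 using C(1) less_imp_le[OF w] by (intro mult_mono bnd D) auto
        also have "\<dots> = C * jbracket x powr (m1 + m) * D * (jbracket \<zeta> powr m3 * jbracket \<zeta> powr (- 2 * real l))"
          by (simp only: w_def mult_ac)
        also have "\<dots> = C * jbracket x powr (m1 + m) * D * jbracket \<zeta> powr (m3 - 2 * real l)"
          unfolding powr_add[symmetric] by simp
        finally show "norm (exp (\<i> * complex_of_real (x \<bullet> \<zeta>)) * osc_I k (osc_cut A \<gamma> (\<epsilon> i) x \<zeta>) * fourier u \<zeta>)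
          \<le> C * jbracket x powr (m1 + m) * D * jbracket \<zeta> powr (m3 - 2 * real l)" .
      qed
    qed
    then show ?thesis
      unfolding amplitude_integral_cutoff[OF A \<gamma> \<epsilon>(1) u, where k=k] pseudo_diff_op_def
      by (intro tendsto_mult tendsto_const)
  qed
  show "(?f \<longlongrightarrow> ?L) (at_right 0)"
    unfolding tendsto_at_iff_sequentially o_def
  proof (intro allI impI)
    fix X :: "nat \<Rightarrow> real" assume X: "\<forall>i. X i \<in> {0<..} - {0}" "X \<longlonglongrightarrow> 0"
    have "\<forall>\<^sub>F i in sequentially. X i < 1" using X(2) by (rule order_tendstoD) simp
    \<comment> \<open>The uniform bounds hold for \<epsilon> \<le> 1, so an initial segment of the
      sequence is dropped.\<close>
    then obtain n where n: "\<And>i. i \<ge> n \<Longrightarrow> X i < 1" by (auto simp: eventually_sequentially)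
    have "(\<lambda>i. ?f (X (i + n))) \<longlonglongrightarrow> ?L"
      using X n by (intro lim) (auto intro: less_imp_le LIMSEQ_ignore_initial_segment)
    then show "(\<lambda>i. ?f (X i)) \<longlonglongrightarrow> ?L" by (rule LIMSEQ_offset)
  qed
qed

lemma has_osc_value_unique:
  fixes a :: "real^'n \<Rightarrow> real^'n \<Rightarrow> real^'n \<Rightarrow> complex"
  assumes "has_osc_value a u x L" "has_osc_value a u x L'"
  shows "L = L'"
proof -
  obtain \<gamma> :: "(real^'n) \<times> (real^'n) \<Rightarrow> complex" where \<gamma>: "cutoff \<gamma>" using cutoff_exists by blast
  show ?thesis
    by (rule tendsto_unique[OF trivial_limit_at_right_real assms(1)[unfolded has_osc_value_def, rule_format, OF \<gamma>]
          assms(2)[unfolded has_osc_value_def, rule_format, OF \<gamma>]])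
qed

theorem corollary2p10:
  fixes a :: "real^'n::finite \<Rightarrow> real^'n \<Rightarrow> real^'n \<Rightarrow> complex"
    and T :: "(real^'n \<Rightarrow> complex) \<Rightarrow> real^'n \<Rightarrow> complex"
    and m1 m2 m3 :: real
  assumes a_smooth: "smooth (\<lambda>(x, y, \<xi>). a x y \<xi>)"
    and a_bound: "\<forall>\<alpha> \<beta> \<gamma>. \<exists>C. \<forall>x y \<xi>.
      norm (mderiv \<alpha> (\<lambda>x'. mderiv \<beta> (\<lambda>y'. mderiv \<gamma> (\<lambda>\<xi>'. a x' y' \<xi>') \<xi>) y) x)
        \<le> C * jbracket x powr m1 * jbracket y powr (m2 - real (mlen \<beta>)) * jbracket \<xi> powr m3"
    and T_form: "\<forall>u\<in>schwartz. \<forall>x. T u x = osc_op a u x"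
  shows "(\<forall>u\<in>schwartz. \<forall>x. has_osc_value a u x (T u x)) \<and>
    (\<exists>c :: real^'n \<Rightarrow> real^'n \<Rightarrow> complex.
      smooth (\<lambda>(x, \<xi>). c x \<xi>) \<and>
      (\<forall>u\<in>schwartz. \<forall>x. T u x = pseudo_diff_op c u x) \<and>
      (\<forall>\<alpha> \<beta>. \<exists>C. \<forall>x \<xi>.
        norm (mderiv \<alpha> (\<lambda>x'. mderiv \<beta> (\<lambda>\<xi>'. c x' \<xi>') \<xi>) x)
          \<le> C * jbracket x powr (m1 + m2) * jbracket \<xi> powr m3) \<and>
      (\<forall>\<alpha> \<beta>. \<forall>M :: real. \<exists>N C. \<forall>x \<xi>.
        norm (mderiv \<alpha> (\<lambda>x'. mderiv \<beta> (\<lambda>\<xi>'. c x' \<xi>' - expansion_sum a N x' \<xi>') \<xi>) x)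
          \<le> C * jbracket x powr (m1 + m2 - M) * jbracket \<xi> powr m3))"
proof -
  let ?A = "\<lambda>(x, y, \<xi>). a x y \<xi>"
  have A: "ampl m1 m2 m3 ?A" by (rule ampl_from_mderiv[OF a_smooth a_bound])
  \<comment> \<open>k is fixed by m3 and the dimension, before the derivatives and the order of the
    expansion are known; the same c therefore serves every estimate.\<close>
  obtain k :: nat where "(\<bar>m3\<bar> + 2 * real CARD('n)) / 2 \<le> real k" using real_arch_simple by blast
  then have k: "\<bar>m3\<bar> - 2 * real k \<le> - 2 * real CARD('n)" by simp
  define c where "c x \<xi> = osc_c k 1 ?A (x, \<xi>)" for x \<xi>
  have osc: "has_osc_value a u x (pseudo_diff_op c u x)" if "u \<in> schwartz" for u x
    using has_osc_value_pseudo[OF A k that, of x] by (simp add: c_def[abs_def])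
  have T: "T u x = pseudo_diff_op c u x" if u: "u \<in> schwartz" for u x
  proof -
    have "osc_op a u x = pseudo_diff_op c u x"
      unfolding osc_op_def
    proof (rule the_equality)
      show "has_osc_value a u x (pseudo_diff_op c u x)" by (rule osc[OF u])
      show "L = pseudo_diff_op c u x" if "has_osc_value a u x L" for L
        by (rule has_osc_value_unique[OF that osc[OF u]])
    qed
    then show ?thesis using T_form u by simp
  qed
  let ?bs = "\<lambda>\<alpha> \<beta>. map (\<lambda>b. (b, 0)) (mlist \<alpha>) @ map (Pair 0) (mlist \<beta>) :: ((real^'n) \<times> (real^'n)) list"
  have bs: "set (?bs \<alpha> \<beta>) \<subseteq> Basis" for \<alpha> \<beta> using set_mlist[of \<alpha>] set_mlist[of \<beta>] by auto
  show ?thesis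
  proof (intro conjI exI[of _ c] ballI allI)
    show "has_osc_value a u x (T u x)" if "u \<in> schwartz" for u x using osc[OF that] T[OF that] by simp
    show "T u x = pseudo_diff_op c u x" if "u \<in> schwartz" for u x by (rule T[OF that])
    show "smooth (\<lambda>(x, \<xi>). c x \<xi>)" using smooth_osc_c[OF A k] by (simp add: c_def case_prod_beta)
    fix \<alpha> \<beta> :: "'n \<Rightarrow> nat"
    note I = iter_partial_osc_c[OF A k bs[of \<alpha> \<beta>]]
    obtain C where C: "\<And>x \<xi>. norm (osc_c k 1 (foldr dshift (?bs \<alpha> \<beta>) ?A) (x, \<xi>)) \<le> C * (jbracket x powr (m1 + m2) * jbracket \<xi> powr m3)"
      using osc_c_bound[OF ampl_ubd[OF I(2)] k] by (metis abs_1 one_le_numeral)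
    show "\<exists>C. \<forall>x \<xi>. norm (mderiv \<alpha> (\<lambda>x'. mderiv \<beta> (\<lambda>\<xi>'. c x' \<xi>') \<xi>) x)
        \<le> C * jbracket x powr (m1 + m2) * jbracket \<xi> powr m3"
      unfolding c_def mderiv2 I(1) using C by (auto simp: mult.assoc)
    fix M :: real
    obtain N0 :: nat where N0: "M \<le> real N0" using real_arch_simple by blast
    \<comment> \<open>N \<ge> M is enough for the decay; the successor makes N positive, as
      \<open>osc_c_taylor\<close> requires.\<close>
    define N where "N = Suc N0"
    obtain C where C: "\<And>x \<xi>. norm (osc_c k 1 (foldr dshift (?bs \<alpha> \<beta>) ?A) (x, \<xi>) - diag_expansion N (foldr dshift (?bs \<alpha> \<beta>) ?A) (x, \<xi>))
        \<le> C * (jbracket x powr (m1 + (m2 - real N)) * jbracket \<xi> powr m3)"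
      using osc_c_taylor[OF I(2) k, of N] by (auto simp: N_def)
    have "norm (mderiv \<alpha> (\<lambda>x'. mderiv \<beta> (\<lambda>\<xi>'. c x' \<xi>' - expansion_sum a N x' \<xi>') \<xi>) x)
        \<le> \<bar>C\<bar> * jbracket x powr (m1 + m2 - M) * jbracket \<xi> powr m3" for x \<xi>
    proof -
      have "mderiv \<alpha> (\<lambda>x'. mderiv \<beta> (\<lambda>\<xi>'. c x' \<xi>' - expansion_sum a N x' \<xi>') \<xi>) x =
          iter_partial (?bs \<alpha> \<beta>) (\<lambda>z. osc_c k 1 ?A z - diag_expansion N ?A z) (x, \<xi>)"
        unfolding c_def expansion_sum_texp[OF a_smooth] by (rule mderiv2)
      also have "\<dots> = osc_c k 1 (foldr dshift (?bs \<alpha> \<beta>) ?A) (x, \<xi>) - diag_expansion N (foldr dshift (?bs \<alpha> \<beta>) ?A) (x, \<xi>)"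
        unfolding iter_partial_diff[OF smooth_osc_c[OF A k] smooth_texp[OF a_smooth] bs] I(1) iter_partial_texp[OF a_smooth bs] ..
      also have "norm \<dots> \<le> C * (jbracket x powr (m1 + (m2 - real N)) * jbracket \<xi> powr m3)" by (rule C)
      also have "\<dots> \<le> \<bar>C\<bar> * (jbracket x powr (m1 + m2 - M) * jbracket \<xi> powr m3)"
        using N0 by (intro mult_mono jbracket_powr_mono) (auto simp: N_def)
      finally show ?thesis by (simp only: mult.assoc)
    qed
    then show "\<exists>N C. \<forall>x \<xi>. norm (mderiv \<alpha> (\<lambda>x'. mderiv \<beta> (\<lambda>\<xi>'. c x' \<xi>' - expansion_sum a N x' \<xi>') \<xi>) x)
        \<le> C * jbracket x powr (m1 + m2 - M) * jbracket \<xi> powr m3" by blast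
  qed
qed

end
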